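(* Let $n\ge2$, let $\Omega\subset\mathbb{C}^n$ be a domain, let $\omega=\sqrt{-1}\sum_j dz_j\wedge d\bar z_j$ be the standard Kähler form on $\Omega$, let $\pi:E\to\Omega$ be a holomorphic vector bundle over $\Omega$ and $h$ a smooth Hermitian metric on $E$. Fix $a\in\Omega$ and $c,d\in\mathbb{R}$ with $c\le d$. Then the following two conditions are equivalent: (1) $c\,\omega\otimes\mathrm{Id}_E\le_{\mathrm{Grif.}}\sqrt{-1}\Theta_h\le_{\mathrm{Grif.}}d\,\omega\otimes\mathrm{Id}_E$ at $a$; (2) for any $\varepsilon>0$ there exists $\rho_\varepsilon>0$ (small enough that the ball of radius $\rho_\varepsilon$ centered at $a$ lies in $\Omega$) such that $$1-(d+\varepsilon)\,\mathfrak{d}(P_{r,s,A})^2\le L_h(a,r,s,A,\xi)\le 1-(c-\varepsilon)\,\mathfrak{d}(P_{r,s,A})^2$$ for any $r,s>0$ with $r^2+s^2<\rho_\varepsilon^2$, any $A\in\mathbf{U}(n)$ and any $\xi\in E_a\setminus\{0\}$, where $\mathfrak{d}(P_{r,s,A})=\sqrt{\tfrac12 r^2+\tfrac{n-1}{n}s^2}$.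
   Context: $\mathbf{U}(n)$ is the unitary group of degree $n$. $\Delta_r\subset\mathbb{C}$ is the open disc of radius $r$ centered at $0$ and $\mathbb{B}^{k}_s\subset\mathbb{C}^k$ is the open ball of radius $s$ centered at $0$. For $r,s>0$, $A\in\mathbf{U}(n)$, put $P_{r,s,A}=A(\Delta_r\times\mathbb{B}^{n-1}_s)$, with Lebesgue measure $|P_{r,s,A}|$. For $a\in\Omega$, $r,s>0$, $A\in\mathbf{U}(n)$ with $a+P_{r,s,A}\subset\Omega$, and $\xi\in E_a\setminus\{0\}$, the $L^2$-extension index of $h$ is $$L_h(a,r,s,A,\xi)=\inf\left\{\frac{\int_{a+P_{r,s,A}}|\sigma|_h^2}{|P_{r,s,A}|\,|\xi|^2_{h(a)}}\ \middle|\ \sigma\in A^2(a+P_{r,s,A},E;h),\ \sigma(a)=\xi\right\},$$ where $A^2(a+P_{r,s,A},E;h)$ is the space of holomorphic sections of $E$ on $a+P_{r,s,A}$ that are square integrable with respect to $h$ (and Lebesgue measure). Write the Chern curvature as $\Theta_h=\sum_{j,k}\Theta_{h,j\bar k}\,dz_j\wedge d\bar z_k$ and $\Theta_h(v,\bar v)=\sum_{j,k}\Theta_{h,j\bar k}(a)v_j\bar v_k\in\mathrm{End}(E_a)$ for $v\in\mathbb{C}^n$ (sign convention: for a line bundle with $h=e^{-\varphi}$, $\Theta_{h,j\bar k}=\partial^2\varphi/\partial z_j\partial\bar z_k$). Condition (1) (inequalities in the sense of Griffiths) means $c|v|^2|\xi|^2_{h(a)}\le\langle\Theta_h(v,\bar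 v)\xi,\xi\rangle_{h(a)}\le d|v|^2|\xi|^2_{h(a)}$ for all $v\in\mathbb{C}^n$, $\xi\in E_a$. *)

theory Defs
  imports "HOL-Analysis.Analysis"
begin

section \<open>Functions on open subsets of complex n-space\<close>

definition holomorphic_fun :: "(complex^'n) set \<Rightarrow> (complex^'n \<Rightarrow> complex) \<Rightarrow> bool" where
  "holomorphic_fun S f \<longleftrightarrow>
     (\<forall>x\<in>S. \<exists>D. (f has_derivative D) (at x) \<and> (\<forall>c v. D (c *s v) = c * D v))"

definition holomorphic_map :: "(complex^'n) set \<Rightarrow> (complex^'n \<Rightarrow> complex^'k) \<Rightarrow> bool" where
  "holomorphic_map S f \<longleftrightarrow> (\<forall>\<alpha>. holomorphic_fun S (\<lambda>x. f x $ \<alpha>))"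

text \<open>Real differentiability classes on an open set \<open>S\<close>, by iterated directional derivatives.\<close>

primrec Ck_on :: "nat \<Rightarrow> 'a::real_normed_vector set \<Rightarrow> ('a \<Rightarrow> 'b::real_normed_vector) \<Rightarrow> bool" where
  "Ck_on 0 S f \<longleftrightarrow> continuous_on S f"
| "Ck_on (Suc m) S f \<longleftrightarrow>
     (\<forall>x\<in>S. f differentiable (at x)) \<and> (\<forall>v. Ck_on m S (\<lambda>x. frechet_derivative f (at x) v))"

definition smooth_fun :: "'a::real_normed_vector set \<Rightarrow> ('a \<Rightarrow> 'b::real_normed_vector) \<Rightarrow> bool" where
  "smooth_fun S f \<longleftrightarrow> (\<forall>m. Ck_on m S f)"

text \<open>The Wirtinger derivatives with respect to \<open>z\<^sub>j\<close> and its conjugate.\<close>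

definition dz :: "'n::finite \<Rightarrow> (complex^'n \<Rightarrow> complex) \<Rightarrow> complex^'n \<Rightarrow> complex" where
  "dz j f x = (frechet_derivative f (at x) (axis j 1)
                - \<i> * frechet_derivative f (at x) (axis j \<i>)) / 2"

definition dzbar :: "'n::finite \<Rightarrow> (complex^'n \<Rightarrow> complex) \<Rightarrow> complex^'n \<Rightarrow> complex" where
  "dzbar j f x = (frechet_derivative f (at x) (axis j 1)
                   + \<i> * frechet_derivative f (at x) (axis j \<i>)) / 2"

section \<open>Holomorphic vector bundles\<close>

text \<open>
  A bundle is given by its total space, projection, fibrewise vector space operations and a
  holomorphic atlas. A pair \<open>(U, \<tau>)\<close> in the atlas stands for the local trivialization
  \<open>u \<mapsto> (proj u, \<tau> u)\<close> of the bundle over \<open>U\<close>. The topology and complex structure of the total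
  space are the ones transported by the atlas; the vector space axioms in the fibres follow from
  the existence of linear bijections with \<open>complex^'k\<close>, where \<open>CARD('k)\<close> is the rank.
\<close>

record ('e, 'n, 'k) vbundle =
  total :: "'e set"
  proj :: "'e \<Rightarrow> complex^'n"
  fadd :: "'e \<Rightarrow> 'e \<Rightarrow> 'e"
  fscale :: "complex \<Rightarrow> 'e \<Rightarrow> 'e"
  fzero :: "complex^'n \<Rightarrow> 'e"
  atlas :: "((complex^'n) set \<times> ('e \<Rightarrow> complex^'k)) set"

definition fibre :: "('e, 'n::finite, 'k::finite) vbundle \<Rightarrow> complex^'n \<Rightarrow> 'e set" where
  "fibre E x = {u \<in> total E. proj E u = x}"

definition triv_inv ::
  "('e, 'n::finite, 'k::finite) vbundle \<Rightarrow> ('e \<Rightarrow> complex^'k) \<Rightarrow> complex^'n \<Rightarrow> complex^'k \<Rightarrow> 'e" where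
  "triv_inv E \<tau> x = inv_into (fibre E x) \<tau>"

definition linear_triv ::
  "('e, 'n::finite, 'k::finite) vbundle \<Rightarrow> (complex^'n) set \<Rightarrow> ('e \<Rightarrow> complex^'k) \<Rightarrow> bool" where
  "linear_triv E U \<tau> \<longleftrightarrow>
     (\<forall>x\<in>U. bij_betw \<tau> (fibre E x) UNIV \<and> \<tau> (fzero E x) = 0 \<and>
        (\<forall>u\<in>fibre E x. \<forall>v\<in>fibre E x. \<tau> (fadd E u v) = \<tau> u + \<tau> v) \<and>
        (\<forall>c. \<forall>u\<in>fibre E x. \<tau> (fscale E c u) = c *s \<tau> u))"

text \<open>
  In the last clause, fibrewise linearity makes holomorphy for every constant vector \<open>w\<close>
  the same as holomorphy of the transition matrix.
\<close>

definition holomorphic_vector_bundle ::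
  "(complex^'n) set \<Rightarrow> ('e, 'n::finite, 'k::finite) vbundle \<Rightarrow> bool" where
  "holomorphic_vector_bundle \<Omega> E \<longleftrightarrow>
     proj E ` total E \<subseteq> \<Omega> \<and>
     (\<forall>x\<in>\<Omega>. fzero E x \<in> fibre E x \<and>
        (\<forall>u\<in>fibre E x. \<forall>v\<in>fibre E x. fadd E u v \<in> fibre E x) \<and>
        (\<forall>c. \<forall>u\<in>fibre E x. fscale E c u \<in> fibre E x)) \<and>
     (\<forall>(U, \<tau>)\<in>atlas E. open U \<and> U \<subseteq> \<Omega> \<and> linear_triv E U \<tau>) \<and>
     (\<forall>x\<in>\<Omega>. \<exists>(U, \<tau>)\<in>atlas E. x \<in> U) \<and>
     (\<forall>(U, \<tau>)\<in>atlas E. \<forall>(V, \<tau>')\<in>atlas E.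
        \<forall>w. holomorphic_map (U \<inter> V) (\<lambda>x. \<tau>' (triv_inv E \<tau> x w)))"

definition holomorphic_section ::
  "('e, 'n::finite, 'k::finite) vbundle \<Rightarrow> (complex^'n) set \<Rightarrow> (complex^'n \<Rightarrow> 'e) \<Rightarrow> bool" where
  "holomorphic_section E D \<sigma> \<longleftrightarrow>
     (\<forall>x\<in>D. \<sigma> x \<in> fibre E x) \<and>
     (\<forall>(U, \<tau>)\<in>atlas E. holomorphic_map (D \<inter> U) (\<lambda>x. \<tau> (\<sigma> x)))"

section \<open>Hermitian metrics and Chern curvature\<close>

text \<open>
  Metrics are linear in the first argument. The Gram matrix is arranged so that
  \<open>h u v = (\<tau> v)\<^sup>* G (\<tau> u)\<close>.
\<close>

definition gram ::
  "('e, 'n::finite, 'k::finite) vbundle \<Rightarrow> ('e \<Rightarrow> 'e \<Rightarrow> complex) \<Rightarrow> ('e \<Rightarrow> complex^'k)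
     \<Rightarrow> complex^'n \<Rightarrow> complex^'k^'k" where
  "gram E h \<tau> x = (\<chi> \<alpha> \<beta>. h (triv_inv E \<tau> x (axis \<beta> 1)) (triv_inv E \<tau> x (axis \<alpha> 1)))"

definition smooth_hermitian_metric ::
  "(complex^'n) set \<Rightarrow> ('e, 'n::finite, 'k::finite) vbundle \<Rightarrow> ('e \<Rightarrow> 'e \<Rightarrow> complex) \<Rightarrow> bool" where
  "smooth_hermitian_metric \<Omega> E h \<longleftrightarrow>
     (\<forall>x\<in>\<Omega>. \<forall>u\<in>fibre E x. \<forall>v\<in>fibre E x.
        (\<forall>w\<in>fibre E x. h (fadd E u v) w = h u w + h v w) \<and>
        (\<forall>c. h (fscale E c u) v = c * h u v) \<and>
        h v u = cnj (h u v) \<and>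
        (u \<noteq> fzero E x \<longrightarrow> Re (h u u) > 0)) \<and>
     (\<forall>(U, \<tau>)\<in>atlas E. \<forall>\<alpha> \<beta>. smooth_fun U (\<lambda>x. gram E h \<tau> x $ \<alpha> $ \<beta>))"

definition hnorm2 :: "('e \<Rightarrow> 'e \<Rightarrow> complex) \<Rightarrow> 'e \<Rightarrow> real" where
  "hnorm2 h u = Re (h u u)"

text \<open>
  In the frame of \<open>\<tau>\<close> the Chern connection form is \<open>G\<^sup>-\<^sup>1 \<partial>G\<close>, and its curvature is the dbar of
  that form; the minus sign below comes from writing it in terms of \<open>dz\<^sub>j\<close> wedge the conjugate
  of \<open>dz\<^sub>k\<close>.
\<close>

definition chern_connection ::
  "('e, 'n::finite, 'k::finite) vbundle \<Rightarrow> ('e \<Rightarrow> 'e \<Rightarrow> complex) \<Rightarrow> ('e \<Rightarrow> complex^'k)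
     \<Rightarrow> 'n \<Rightarrow> complex^'n \<Rightarrow> complex^'k^'k" where
  "chern_connection E h \<tau> j x =
     matrix_inv (gram E h \<tau> x) ** (\<chi> \<alpha> \<beta>. dz j (\<lambda>y. gram E h \<tau> y $ \<alpha> $ \<beta>) x)"

definition curvature_matrix ::
  "('e, 'n::finite, 'k::finite) vbundle \<Rightarrow> ('e \<Rightarrow> 'e \<Rightarrow> complex) \<Rightarrow> ('e \<Rightarrow> complex^'k)
     \<Rightarrow> 'n \<Rightarrow> 'n \<Rightarrow> complex^'n \<Rightarrow> complex^'k^'k" where
  "curvature_matrix E h \<tau> j k x =
     (\<chi> \<alpha> \<beta>. - dzbar k (\<lambda>y. chern_connection E h \<tau> j y $ \<alpha> $ \<beta>) x)"

text \<open>
  The endomorphism of the fibre over \<open>a\<close> obtained by evaluating the curvature on \<open>v\<close> and its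
  conjugate. Curvature matrices of different trivializations are conjugate by the transition
  matrix, so the choice of trivialization is immaterial.
\<close>

definition chern_curvature ::
  "('e, 'n::finite, 'k::finite) vbundle \<Rightarrow> ('e \<Rightarrow> 'e \<Rightarrow> complex)
     \<Rightarrow> complex^'n \<Rightarrow> complex^'n \<Rightarrow> 'e \<Rightarrow> 'e" where
  "chern_curvature E h a v \<xi> =
     (let \<tau> = (SOME \<tau>. \<exists>U. (U, \<tau>) \<in> atlas E \<and> a \<in> U)
      in triv_inv E \<tau> a
           ((\<chi> \<alpha> \<beta>. \<Sum>j\<in>UNIV. \<Sum>k\<in>UNIV.
               curvature_matrix E h \<tau> j k a $ \<alpha> $ \<beta> * v $ j * cnj (v $ k)) *v \<tau> \<xi>))"

text \<open>The inner product below is real, because \<open>chern_curvature E h a v\<close> is self-adjoint.\<close>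

definition griffiths_bounds ::
  "('e, 'n::finite, 'k::finite) vbundle \<Rightarrow> ('e \<Rightarrow> 'e \<Rightarrow> complex)
     \<Rightarrow> complex^'n \<Rightarrow> real \<Rightarrow> real \<Rightarrow> bool" where
  "griffiths_bounds E h a c d \<longleftrightarrow>
     (\<forall>v. \<forall>\<xi>\<in>fibre E a.
        c * (norm v)\<^sup>2 * hnorm2 h \<xi> \<le> Re (h (chern_curvature E h a v \<xi>) \<xi>) \<and>
        Re (h (chern_curvature E h a v \<xi>) \<xi>) \<le> d * (norm v)\<^sup>2 * hnorm2 h \<xi>)"

section \<open>The extension index\<close>

definition unitary_group :: "(complex^'n^'n) set" where
  "unitary_group = {A. (\<chi> i j. cnj (A $ j $ i)) ** A = mat 1 \<and> A ** (\<chi> i j. cnj (A $ j $ i)) = mat 1}"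

text \<open>The index \<open>i0\<close> plays the role of the first coordinate.\<close>

definition disc_ball :: "'n::finite \<Rightarrow> real \<Rightarrow> real \<Rightarrow> complex^'n^'n \<Rightarrow> (complex^'n) set" where
  "disc_ball i0 r s A =
     (\<lambda>z. A *v z) ` {z. cmod (z $ i0) < r \<and> L2_set (\<lambda>i. cmod (z $ i)) (UNIV - {i0}) < s}"

definition A2_space ::
  "('e, 'n::finite, 'k::finite) vbundle \<Rightarrow> ('e \<Rightarrow> 'e \<Rightarrow> complex)
     \<Rightarrow> (complex^'n) set \<Rightarrow> (complex^'n \<Rightarrow> 'e) set" where
  "A2_space E h D =
     {\<sigma>. holomorphic_section E D \<sigma> \<and> set_integrable lborel D (\<lambda>x. hnorm2 h (\<sigma> x))}"

text \<open>Extended real values, so that the infimum over the empty set is \<open>\<infinity>\<close>.\<close>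

definition extension_index ::
  "('e, 'n::finite, 'k::finite) vbundle \<Rightarrow> ('e \<Rightarrow> 'e \<Rightarrow> complex) \<Rightarrow> 'n
     \<Rightarrow> complex^'n \<Rightarrow> real \<Rightarrow> real \<Rightarrow> complex^'n^'n \<Rightarrow> 'e \<Rightarrow> ereal" where
  "extension_index E h i0 a r s A \<xi> =
     (let P = disc_ball i0 r s A; D = (\<lambda>z. a + z) ` P
      in Inf {ereal ((LINT x:D|lborel. hnorm2 h (\<sigma> x)) / (measure lborel P * hnorm2 h \<xi>))
              | \<sigma>. \<sigma> \<in> A2_space E h D \<and> \<sigma> a = \<xi>})"

definition disc_ball_size :: "nat \<Rightarrow> real \<Rightarrow> real \<Rightarrow> real" where
  "disc_ball_size n r s = sqrt (r\<^sup>2 / 2 + (real n - 1) / real n * s\<^sup>2)"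

end

theory Submission
  imports Defs "HOL-Complex_Analysis.Cauchy_Integral_Formula"
begin

text \<open>
  Everything happens in one chart around \<open>a\<close>. There the metric is a Gram matrix \<open>G\<close>, a section is a
  holomorphic vector function \<open>f\<close>, and its squared norm is \<open>G(a + z)(f, f)\<close>. Let \<open>B(z)\<close> be the
  Chern connection form at \<open>a\<close> evaluated on \<open>z\<close>; it is complex linear in \<open>z\<close>. The holomorphic
  function \<open>g = f + B(z) f\<close> has the same value at the centre as \<open>f\<close>, and the first-order terms of
  \<open>G(a + z)(f, f)\<close> and of \<open>G(a)(g, g)\<close> agree. What remains has size \<open>|z|\<^sup>2 |f|\<^sup>2\<close>. For the constant
  vector \<open>\<xi> = f(0)\<close> the leading part of this remainder is minus the curvature form
  \<open>\<langle>\<Theta>(z, z) \<xi>, \<xi>\<rangle>\<close>, up to terms that cancel under the rotation \<open>z \<mapsto> \<i> z\<close>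
  (\<open>curvature_identity\<close>).

  For an arbitrary section the deviation \<open>\<gamma> = g - \<xi>\<close> is not small. However, the flat norm contributes
  \<open>G(a)(\<gamma>, \<gamma>)\<close>, which is comparable to \<open>|\<gamma>|\<^sup>2\<close>, whereas \<open>\<gamma>\<close> enters the remainder only with a factor
  \<open>|z|\<^sup>2\<close>. Completing squares gives a pointwise inequality
  \<open>G(a + z)(f, f) \<ge> G(a)(\<xi>, \<xi>) + 2 Re G(a)(\<gamma>, \<xi>) - (second-order loss) - \<mu> |z|\<^sup>2 |\<xi>|\<^sup>2\<close>
  (\<open>pointwise_lower\<close>), and for \<open>f = \<xi> - B(z) \<xi>\<close> also the reverse (\<open>pointwise_upper\<close>). Discs times
  balls are invariant under multiplication by scalars of modulus at most one, so the holomorphic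
  function \<open>G(a)(\<gamma>, \<xi>)\<close>, which vanishes at the centre, has mean zero. Hence the
  extension index is one minus the mean of the curvature form divided by \<open>|\<xi>|\<^sup>2\<close>, up to \<open>\<mu>\<close> times the
  mean of \<open>|z|\<^sup>2\<close> (\<open>extension_index_bounds\<close>). The mean of \<open>|z|\<^sup>2\<close> is exactly the square of the size
  of the domain.

  Griffiths bounds at \<open>a\<close> are pointwise bounds of the curvature form by multiples of \<open>|z|\<^sup>2\<close>;
  averaging them proves one direction. Conversely, on a domain whose disc points in the direction \<open>v\<close> and
  whose ball factor is very thin, the mean of the curvature form is nearly \<open>r\<^sup>2/2\<close> times its value at
  \<open>v\<close>, while the squared size is nearly \<open>r\<^sup>2/2\<close>; this recovers the bounds at \<open>v\<close>
  (\<open>curvature_loss_concentration\<close>).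
\<close>

section \<open>Volume and orthogonal maps\<close>

text \<open>
  By Vitali's theorem an open set is, up to a null set, a disjoint union of balls. An orthogonal map
  sends these to disjoint balls of the same radii inside the image. Applied to the inverse map, this
  is the converse inequality as well.
\<close>

lemma emeasure_le_emeasure_orthogonal_image:
  fixes T :: "'a::euclidean_space \<Rightarrow> 'a"
  assumes T: "orthogonal_transformation T" and "open U"
  shows "emeasure lborel U \<le> emeasure lborel (T ` U)"
proof -
  define K where "K = {(x, e). 0 < e \<and> ball x e \<subseteq> U}"
  have bij: "bij T" using T orthogonal_transformation_bij by blast
  have open_img: "open (T ` U)"
    using open_bijective_linear_image_eq[OF orthogonal_transformation_linear[OF T] bij] \<open>open U\<close> by blast
  have cover: "\<exists>i. i \<in> K \<and> x \<in> ball (fst i) (snd i) \<and> snd i < d" if x: "x \<in> U" and d: "0 < d" for x d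
  proof -
    obtain e where e: "0 < e" "ball x e \<subseteq> U" using \<open>open U\<close> x open_contains_ball by blast
    have "(x, min e (d/2)) \<in> K" using e d by (auto simp: K_def)
    then show ?thesis using e d by (intro exI[of _ "(x, min e (d/2))"]) auto
  qed
  obtain C where C: "countable C" "C \<subseteq> K"
    "pairwise (\<lambda>i j. disjnt (ball (fst i) (snd i)) (ball (fst j) (snd j))) C"
    "negligible (U - (\<Union>i\<in>C. ball (fst i) (snd i)))"
    by (rule Vitali_covering_theorem_balls[of U K fst snd, OF cover]) auto
  let ?W = "\<Union>i\<in>C. ball (fst i) (snd i)"
  have W: "?W \<in> sets borel" using C(1) by (auto intro!: borel_open)
  have nulldiff: "emeasure lborel (U - ?W) = 0"
  proof -
    have "U - ?W \<in> null_sets lebesgue" using C(4) by (simp add: negligible_iff_null_sets)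
    then have "emeasure lebesgue (U - ?W) = 0" by blast
    moreover have "U - ?W \<in> sets lborel" using W \<open>open U\<close> by auto
    ultimately show ?thesis by (simp add: emeasure_completion)
  qed
  have disj: "disjoint_family_on (\<lambda>i. ball (fst i) (snd i)) C"
    using C(3) by (auto simp: disjoint_family_on_def pairwise_def disjnt_def)
  have disjT: "disjoint_family_on (\<lambda>i. ball (T (fst i)) (snd i)) C"
    unfolding disjoint_family_on_def
  proof (intro ballI impI)
    fix i j assume "i \<in> C" "j \<in> C" "i \<noteq> j"
    then have "T ` (ball (fst i) (snd i) \<inter> ball (fst j) (snd j)) = {}"
      using disj by (auto simp: disjoint_family_on_def)
    then show "ball (T (fst i)) (snd i) \<inter> ball (T (fst j)) (snd j) = {}"
      by (simp only: image_orthogonal_transformation_ball[OF T, symmetric] image_Int[OF bij_is_inj[OF bij]])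
  qed
  have "emeasure lborel U \<le> emeasure lborel (?W \<union> (U - ?W))"
    using W \<open>open U\<close> by (intro emeasure_mono) auto
  also have "\<dots> \<le> emeasure lborel ?W + emeasure lborel (U - ?W)"
    using W \<open>open U\<close> by (intro emeasure_subadditive) auto
  also have "\<dots> = emeasure lborel ?W" by (simp add: nulldiff)
  also have "\<dots> = (\<integral>\<^sup>+ i. emeasure lborel (ball (fst i) (snd i)) \<partial>count_space C)"
    using C(1) disj by (intro emeasure_UN_countable) auto
  also have "\<dots> = (\<integral>\<^sup>+ i. emeasure lborel (ball (T (fst i)) (snd i)) \<partial>count_space C)"
  proof (rule nn_integral_cong)
    fix i assume "i \<in> space (count_space C)"
    then have "0 < snd i" using C(2) by (auto simp: K_def)
    then show "emeasure lborel (ball (fst i) (snd i)) = emeasure lborel (ball (T (fst i)) (snd i))"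
      by (simp add: emeasure_ball)
  qed
  also have "\<dots> = emeasure lborel (\<Union>i\<in>C. ball (T (fst i)) (snd i))"
    using C(1) disjT by (intro emeasure_UN_countable[symmetric]) auto
  also have "\<dots> \<le> emeasure lborel (T ` U)"
  proof (rule emeasure_mono)
    show "(\<Union>i\<in>C. ball (T (fst i)) (snd i)) \<subseteq> T ` U"
    proof (rule UN_least)
      fix i assume "i \<in> C"
      then have "i \<in> K" using C(2) by blast
      then have "ball (fst i) (snd i) \<subseteq> U" by (simp add: K_def case_prod_beta)
      then show "ball (T (fst i)) (snd i) \<subseteq> T ` U"
        by (simp only: image_orthogonal_transformation_ball[OF T, symmetric] image_mono)
    qed
  qed (use open_img in auto)
  finally show ?thesis .
qed

lemma lborel_distr_orthogonal:
  fixes T :: "'a::euclidean_space \<Rightarrow> 'a"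
  assumes T: "orthogonal_transformation T"
  shows "distr lborel borel T = lborel"
proof (rule lborel_eqI[symmetric])
  have bij: "bij T" using T orthogonal_transformation_bij by blast
  have lin: "linear T" using T orthogonal_transformation_linear by blast
  have meas: "T \<in> borel_measurable borel"
    using lin by (intro borel_measurable_continuous_onI linear_continuous_on linear_conv_bounded_linear[THEN iffD1])
  fix l u :: 'a assume lu: "\<And>b. b \<in> Basis \<Longrightarrow> l \<bullet> b \<le> u \<bullet> b"
  let ?V = "T -` box l u"
  have oV: "open ?V" using lin by (intro open_vimage) (auto simp: linear_continuous_on linear_linear)
  have img: "T ` ?V = box l u" using bij by (simp add: bij_betw_def surj_image_vimage_eq)
  have img2: "inv T ` box l u = ?V" using bij by (simp add: bij_vimage_eq_inv_image)
  have "emeasure lborel ?V = emeasure lborel (box l u)"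
  proof (rule antisym)
    show "emeasure lborel ?V \<le> emeasure lborel (box l u)"
      using emeasure_le_emeasure_orthogonal_image[OF T oV] by (simp only: img)
    show "emeasure lborel (box l u) \<le> emeasure lborel ?V"
      using emeasure_le_emeasure_orthogonal_image[OF orthogonal_transformation_inv[OF T] open_box, of l u] by (simp only: img2)
  qed
  then show "emeasure (distr lborel borel T) (box l u) = (\<Prod>b\<in>Basis. (u - l) \<bullet> b)"
    using lu meas by (simp add: emeasure_distr emeasure_lborel_box)
qed simp

section \<open>Second moments of the model domain\<close>

definition tail_norm :: "'n::finite \<Rightarrow> complex^'n \<Rightarrow> real" where
  "tail_norm i0 z = L2_set (\<lambda>i. cmod (z $ i)) (UNIV - {i0})"

definition std_disc_ball :: "'n::finite \<Rightarrow> real \<Rightarrow> real \<Rightarrow> (complex^'n) set" where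
  "std_disc_ball i0 r s = {z. cmod (z $ i0) < r \<and> tail_norm i0 z < s}"

text \<open>
  Scaling the two factors of the model domain independently is what makes its moments computable
  without integration: it multiplies volumes by a known factor.
\<close>

definition block_scale :: "'n::finite \<Rightarrow> real \<Rightarrow> real \<Rightarrow> complex^'n \<Rightarrow> complex^'n" where
  "block_scale i0 x y z = (\<chi> i. (if i = i0 then x else y) *\<^sub>R z $ i)"

lemma norm_power2_tail: "(norm z)\<^sup>2 = (cmod (z $ i0))\<^sup>2 + (tail_norm i0 z)\<^sup>2"
  unfolding tail_norm_def norm_vec_def L2_set_def
  by (simp add: sum_nonneg sum.remove[of UNIV i0])

lemma tail_norm_nonneg [simp]: "0 \<le> tail_norm i0 z"
  by (simp add: tail_norm_def)

lemma continuous_on_tail_norm: "continuous_on S (tail_norm i0)"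
  unfolding tail_norm_def L2_set_def by (intro continuous_intros)

lemma open_std_disc_ball: "open (std_disc_ball i0 r s)"
  unfolding std_disc_ball_def
  by (intro open_Collect_conj open_Collect_less continuous_on_tail_norm continuous_intros)

lemma std_disc_ball_norm_less:
  assumes "z \<in> std_disc_ball i0 r s"
  shows "(norm z)\<^sup>2 < r\<^sup>2 + s\<^sup>2"
  using assms unfolding std_disc_ball_def norm_power2_tail[of z i0]
  by (auto intro!: add_strict_mono power_strict_mono)

lemma bounded_std_disc_ball: "bounded (std_disc_ball i0 r s)"
  unfolding bounded_iff using std_disc_ball_norm_less real_less_rsqrt less_imp_le by blast

lemma emeasure_std_disc_ball_finite: "emeasure lborel (std_disc_ball i0 r s) < \<infinity>"
  by (rule emeasure_bounded_finite[OF bounded_std_disc_ball])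

lemma measure_std_disc_ball_pos:
  assumes "r > 0" "s > 0"
  shows "measure lborel (std_disc_ball (i0::'n::finite) r s) > 0"
proof -
  have "0 \<in> std_disc_ball i0 r s" using assms by (simp add: std_disc_ball_def tail_norm_def L2_set_def)
  then obtain e where e: "0 < e" "ball 0 e \<subseteq> std_disc_ball i0 r s"
    using open_std_disc_ball open_contains_ball by blast
  have "0 < measure lborel (ball (0::complex^'n) e)"
    using e(1) by (simp add: measure_def emeasure_ball unit_ball_vol_pos)
  also have "\<dots> \<le> measure lborel (std_disc_ball i0 r s)"
    using e(2) emeasure_std_disc_ball_finite[of i0 r s]
    by (intro measure_mono_fmeasurable) (auto simp: fmeasurable_def open_std_disc_ball)
  finally show ?thesis .
qed

lemma tail_norm_block_scale: "y > 0 \<Longrightarrow> tail_norm i0 (block_scale i0 x y z) = y * tail_norm i0 z"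
proof -
  assume y: "y > 0"
  have "tail_norm i0 (block_scale i0 x y z) = L2_set (\<lambda>i. y * cmod (z $ i)) (UNIV - {i0})"
    unfolding tail_norm_def block_scale_def using y by (intro L2_set_cong) auto
  then show ?thesis using y by (simp add: tail_norm_def L2_set_right_distrib)
qed

lemma integral_block_scale:
  fixes F :: "complex^'n::finite \<Rightarrow> real"
  assumes F: "F \<in> borel_measurable borel" and x: "x > 0" and y: "y > 0"
  shows "integral\<^sup>L lborel F
    = x ^ 2 * (y ^ 2) ^ (CARD('n) - 1) * integral\<^sup>L lborel (\<lambda>z. F (block_scale i0 x y z))"
proof -
  define c :: "complex^'n \<Rightarrow> real" where "c j = (if j \<in> {axis i0 1, axis i0 \<i>} then x else y)" for j
  have c0: "\<And>j. c j \<noteq> 0" using x y by (auto simp: c_def)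
  have S: "block_scale i0 x y z = 0 + (\<Sum>j\<in>Basis. (c j * (z \<bullet> j)) *\<^sub>R j)" for z
  proof (rule euclidean_eqI)
    fix b :: "complex^'n" assume b: "b \<in> Basis"
    then obtain i u where bi: "b = axis i u" "u \<in> Basis" by (auto simp: Basis_vec_def)
    have "(\<Sum>j\<in>Basis. (c j * (z \<bullet> j)) *\<^sub>R j) \<bullet> b = c b * (z \<bullet> b)"
      using b by (simp add: inner_sum_left inner_Basis if_distrib if_distribR sum.delta' cong: if_cong)
    moreover have "block_scale i0 x y z \<bullet> b = c b * (z \<bullet> b)"
      using bi by (auto simp: inner_axis block_scale_def c_def axis_eq_axis Basis_complex_def)
    ultimately show "block_scale i0 x y z \<bullet> b = (0 + (\<Sum>j\<in>Basis. (c j * (z \<bullet> j)) *\<^sub>R j)) \<bullet> b" by simp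
  qed
  have prod: "(\<Prod>j\<in>Basis. \<bar>c j\<bar>) = x ^ 2 * (y ^ 2) ^ (CARD('n) - 1)"
  proof -
    have "(\<Prod>j\<in>Basis. \<bar>c j\<bar>) = (\<Prod>j\<in>(\<Union>i\<in>(UNIV::'n set). {axis i 1, axis i \<i>}). \<bar>c j\<bar>)"
      by (rule prod.cong) (auto simp: Basis_vec_def Basis_complex_def)
    also have "\<dots> = (\<Prod>i\<in>UNIV. \<Prod>j\<in>{axis i 1, axis i \<i>}. \<bar>c j\<bar>)"
      by (rule prod.UNION_disjoint) (auto simp: axis_eq_axis)
    also have "\<dots> = (\<Prod>i\<in>(UNIV::'n set). if i = i0 then x ^ 2 else y ^ 2)"
      using x y by (intro prod.cong) (auto simp: c_def axis_eq_axis power2_eq_square)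
    also have "\<dots> = x ^ 2 * (\<Prod>i\<in>(UNIV::'n set) - {i0}. y ^ 2)"
      by (subst prod.remove[of _ i0]) (auto intro!: prod.cong)
    finally show ?thesis by (simp add: card_Diff_singleton)
  qed
  have meas: "block_scale i0 x y \<in> borel_measurable borel"
    unfolding block_scale_def by (intro borel_measurable_continuous_onI continuous_intros)
  have "lborel = density (distr lborel borel (block_scale i0 x y)) (\<lambda>_. \<Prod>j\<in>Basis. \<bar>c j\<bar>)"
    unfolding S using lborel_affine_euclidean[where c=c and t=0] c0 by blast
  then have "integral\<^sup>L lborel F = integral\<^sup>L (density (distr lborel borel (block_scale i0 x y)) (\<lambda>_. \<Prod>j\<in>Basis. \<bar>c j\<bar>)) F"
    by simp
  also have "\<dots> = (\<Prod>j\<in>Basis. \<bar>c j\<bar>) * integral\<^sup>L (distr lborel borel (block_scale i0 x y)) F"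
    using F by (subst integral_density) (auto intro!: prod_nonneg)
  also have "integral\<^sup>L (distr lborel borel (block_scale i0 x y)) F = integral\<^sup>L lborel (\<lambda>z. F (block_scale i0 x y z))"
    using F meas by (subst integral_distr) auto
  finally show ?thesis by (simp add: prod)
qed

lemma set_integrable_continuous_bounded:
  fixes f :: "'a::euclidean_space \<Rightarrow> 'b::euclidean_space"
  assumes "open P" "emeasure lborel P < \<infinity>" "continuous_on P f" "\<And>x. x \<in> P \<Longrightarrow> norm (f x) \<le> B"
  shows "set_integrable lborel P f"
  unfolding set_integrable_def
proof (rule Bochner_Integration.integrable_bound)
  show "integrable lborel (\<lambda>x. B * indicator P x :: real)"
    using assms by auto
  show "(\<lambda>x. indicator P x *\<^sub>R f x) \<in> borel_measurable lborel"
    using assms by (simp add: borel_measurable_continuous_on_indicator)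
  show "AE x in lborel. norm (indicator P x *\<^sub>R f x) \<le> norm (B * indicator P x)"
    using assms(4) by (auto simp: indicator_def intro!: AE_I2 order_trans[OF assms(4)])
qed

text \<open>
  Here \<open>V\<close> is the volume of a body, \<open>M\<close> the second moment of a coordinate block of complex dimension
  \<open>m\<close>, \<open>R\<close> the largest value of the integrand, and \<open>t\<close> the square of the factor by which that block
  is shrunk. The shell between the body and its shrunk copy has volume \<open>(1 - t\<^sup>m) V\<close> and moment \<open>(1 - t\<^sup>m\<^sup>+\<^sup>1) M\<close>, and on it the integrand lies between \<open>t R\<close>
  and \<open>R\<close>. Dividing by \<open>1 - t\<close> and letting \<open>t\<close> tend to 1 gives the exact moment.
\<close>

lemma moment_of_scaling_sandwich:
  fixes M V R :: real
  assumes lower: "\<And>t. 0 < t \<Longrightarrow> t < 1 \<Longrightarrow> t * R * (V - t ^ m * V) \<le> M - t ^ Suc m * M"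
    and upper: "\<And>t. 0 < t \<Longrightarrow> t < 1 \<Longrightarrow> M - t ^ Suc m * M \<le> R * (V - t ^ m * V)"
  shows "real (Suc m) * M = real m * R * V"
proof -
  have geo: "1 - t ^ k = (1 - t) * (\<Sum>i<k. t ^ i)" for t :: real and k
    by (simp add: one_diff_power_eq)
  have geo': "W - t ^ k * W = (1 - t) * ((\<Sum>i<k. t ^ i) * W)" for t W :: real and k
    unfolding mult.assoc[symmetric] geo[symmetric] by (simp add: left_diff_distrib)
  have lim: "((\<lambda>t::real. \<Sum>i<k. t ^ i) \<longlongrightarrow> real k) (at_left 1)" for k
  proof -
    have "((\<lambda>t::real. \<Sum>i<k. t ^ i) \<longlongrightarrow> (\<Sum>i<k. 1 ^ i)) (at_left 1)" by (intro tendsto_intros)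
    then show ?thesis by simp
  qed
  have ev: "\<forall>\<^sub>F t::real in at_left 1. 0 < t \<and> t < 1"
    using eventually_at_left[of 0 "1::real"] by (auto intro!: exI[of _ 0] simp: eventually_at_left[of 0])
  have l: "t * R * ((\<Sum>i<m. t ^ i) * V) \<le> (\<Sum>i<Suc m. t ^ i) * M" if "0 < t \<and> t < 1" for t
  proof -
    have "(1 - t) * (t * R * ((\<Sum>i<m. t ^ i) * V)) = t * R * (V - t ^ m * V)"
      unfolding geo' by (simp add: mult_ac)
    also have "\<dots> \<le> M - t ^ Suc m * M" using lower that by blast
    also have "\<dots> = (1 - t) * ((\<Sum>i<Suc m. t ^ i) * M)"
      unfolding geo' ..
    finally show ?thesis using that by simp
  qed
  have u: "(\<Sum>i<Suc m. t ^ i) * M \<le> R * ((\<Sum>i<m. t ^ i) * V)" if "0 < t \<and> t < 1" for t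
  proof -
    have "(1 - t) * ((\<Sum>i<Suc m. t ^ i) * M) = M - t ^ Suc m * M"
      unfolding geo' ..
    also have "\<dots> \<le> R * (V - t ^ m * V)" using upper that by blast
    also have "\<dots> = (1 - t) * (R * ((\<Sum>i<m. t ^ i) * V))"
      unfolding geo' by (simp add: mult_ac)
    finally show ?thesis using that by simp
  qed
  have lM: "((\<lambda>t::real. (\<Sum>i<Suc m. t ^ i) * M) \<longlongrightarrow> real (Suc m) * M) (at_left 1)"
    by (intro tendsto_mult lim tendsto_const)
  have lV: "((\<lambda>t::real. (\<Sum>i<m. t ^ i) * V) \<longlongrightarrow> real m * V) (at_left 1)"
    by (intro tendsto_mult lim tendsto_const)
  have "1 * R * (real m * V) \<le> real (Suc m) * M"
    by (rule tendsto_le[OF _ lM tendsto_mult[OF tendsto_mult[OF tendsto_ident_at tendsto_const] lV]])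
       (use ev l in \<open>auto elim!: eventually_mono simp del: sum.lessThan_Suc\<close>)
  moreover have "real (Suc m) * M \<le> R * (real m * V)"
    by (rule tendsto_le[OF _ tendsto_mult[OF tendsto_const lV] lM])
       (use ev u in \<open>auto elim!: eventually_mono simp del: sum.lessThan_Suc\<close>)
  ultimately show ?thesis by (simp add: algebra_simps)
qed

lemma set_integral_shell_bounds:
  fixes \<phi> :: "'a::euclidean_space \<Rightarrow> real"
  assumes P: "open P" "emeasure lborel P < \<infinity>" and Q: "open Q" "Q \<subseteq> P"
    and \<phi>: "continuous_on UNIV \<phi>" "\<And>x. x \<in> P \<Longrightarrow> 0 \<le> \<phi> x" "\<And>x. x \<in> P \<Longrightarrow> \<phi> x \<le> B"
    and low: "\<And>x. x \<in> P \<Longrightarrow> x \<notin> Q \<Longrightarrow> b \<le> \<phi> x"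
  shows "b * (measure lborel P - measure lborel Q) \<le> (LINT x:P|lborel. \<phi> x) - (LINT x:Q|lborel. \<phi> x)"
    and "(LINT x:P|lborel. \<phi> x) - (LINT x:Q|lborel. \<phi> x) \<le> B * (measure lborel P - measure lborel Q)"
proof -
  have Qfin: "emeasure lborel Q < \<infinity>"
    using P Q by (metis borel_open emeasure_mono le_less_trans sets_lborel)
  have iP: "set_integrable lborel P \<phi>"
    using P \<phi> by (intro set_integrable_continuous_bounded[of _ _ B]) (auto intro: continuous_on_subset)
  have iQ: "set_integrable lborel Q \<phi>"
    using Q Qfin \<phi> by (intro set_integrable_continuous_bounded[of _ _ B]) (auto intro: continuous_on_subset)
  have "(LINT x:P|lborel. \<phi> x) - (LINT x:Q|lborel. \<phi> x)
      = (LINT x|lborel. indicator P x *\<^sub>R \<phi> x - indicator Q x *\<^sub>R \<phi> x)"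
    using iP iQ unfolding set_lebesgue_integral_def set_integrable_def by (simp add: Bochner_Integration.integral_diff)
  note eq = this
  have const: "c * (measure lborel P - measure lborel Q)
      = (LINT x|lborel. c * indicator P x - c * indicator Q x)" for c :: real
    using P Q Qfin by (subst Bochner_Integration.integral_diff) (auto simp: algebra_simps)
  have iconst: "integrable lborel (\<lambda>x. c * indicator P x - c * indicator Q x)" for c :: real
    using P Q Qfin by (intro Bochner_Integration.integrable_diff integrable_mult_right) auto
  have i\<phi>: "integrable lborel (\<lambda>x. indicator P x *\<^sub>R \<phi> x - indicator Q x *\<^sub>R \<phi> x)"
    using iP iQ unfolding set_integrable_def by (rule Bochner_Integration.integrable_diff)
  show "b * (measure lborel P - measure lborel Q) \<le> (LINT x:P|lborel. \<phi> x) - (LINT x:Q|lborel. \<phi> x)"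
    unfolding eq const by (rule integral_mono[OF iconst i\<phi>]) (use Q low in \<open>auto simp: indicator_def\<close>)
  show "(LINT x:P|lborel. \<phi> x) - (LINT x:Q|lborel. \<phi> x) \<le> B * (measure lborel P - measure lborel Q)"
    unfolding eq const by (rule integral_mono[OF i\<phi> iconst]) (use Q \<phi>(3) in \<open>auto simp: indicator_def\<close>)
qed

lemma block_scale_std_disc_ball:
  assumes "x > 0" "y > 0"
  shows "block_scale i0 x y z \<in> std_disc_ball i0 (x * r) (y * s) \<longleftrightarrow> z \<in> std_disc_ball i0 r s"
  using assms by (simp add: std_disc_ball_def tail_norm_block_scale) (simp add: block_scale_def)

lemma set_integral_block_scale:
  fixes \<phi> :: "complex^'n::finite \<Rightarrow> real"
  assumes \<phi>: "continuous_on UNIV \<phi>" and x: "x > 0" and y: "y > 0"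
  shows "(LINT z:std_disc_ball i0 (x * r) (y * s)|lborel. \<phi> z)
    = x ^ 2 * (y ^ 2) ^ (CARD('n) - 1) * (LINT z:std_disc_ball i0 r s|lborel. \<phi> (block_scale i0 x y z))"
proof -
  have "(\<lambda>z. indicator (std_disc_ball i0 (x * r) (y * s)) z *\<^sub>R \<phi> z) \<in> borel_measurable borel"
    using \<phi> by (intro borel_measurable_continuous_on_indicator)
      (auto simp: open_std_disc_ball borel_open intro: continuous_on_subset)
  from integral_block_scale[OF this x y, of i0] show ?thesis
    unfolding set_lebesgue_integral_def indicator_def by (simp add: block_scale_std_disc_ball x y)
qed

lemma measure_std_disc_ball_scale:
  assumes x: "x > 0" and y: "y > 0"
  shows "measure lborel (std_disc_ball i0 (x * r) (y * s))
    = x ^ 2 * (y ^ 2) ^ (CARD('n) - 1) * measure lborel (std_disc_ball (i0::'n::finite) r s)"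
proof -
  have "(LINT z:S|lborel. 1) = measure lborel S" if "S = std_disc_ball i0 u v" for S :: "(complex^'n) set" and u v
    using emeasure_std_disc_ball_finite[of i0 u v] that
    by (simp add: set_lebesgue_integral_def open_std_disc_ball)
  with set_integral_block_scale[OF _ x y, of "\<lambda>_. 1" i0 r s] show ?thesis by simp
qed

lemma std_disc_ball_mono: "r \<le> r' \<Longrightarrow> s \<le> s' \<Longrightarrow> std_disc_ball i0 r s \<subseteq> std_disc_ball i0 r' s'"
  by (auto simp: std_disc_ball_def)

text \<open>
  Shrinking the disc factor only: the complex dimension of the scaled block is 1.
\<close>

lemma set_integral_head_moment:
  assumes r: "r > 0" and s: "s > 0"
  shows "(LINT z:std_disc_ball (i0::'n::finite) r s|lborel. (cmod (z $ i0))\<^sup>2)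
    = r\<^sup>2 / 2 * measure lborel (std_disc_ball i0 r s)" (is "?M = _ * ?V")
proof -
  let ?\<phi> = "\<lambda>z::complex^'n. (cmod (z $ i0))\<^sup>2"
  have cont: "continuous_on UNIV ?\<phi>" by (intro continuous_intros)
  have "t * r\<^sup>2 * (?V - t ^ 1 * ?V) \<le> ?M - t ^ Suc 1 * ?M \<and> ?M - t ^ Suc 1 * ?M \<le> r\<^sup>2 * (?V - t ^ 1 * ?V)"
    if t: "0 < t" "t < 1" for t
  proof -
    define x where "x = sqrt t"
    have x: "0 < x" "x < 1" "x\<^sup>2 = t" using t by (auto simp: x_def)
    have V: "measure lborel (std_disc_ball i0 (x * r) s) = t * ?V"
      using measure_std_disc_ball_scale[of x 1 i0 r s] x by simp
    have \<phi>_scale: "?\<phi> (block_scale i0 x 1 z) = t * ?\<phi> z" for z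
      using x by (simp add: block_scale_def norm_mult power_mult_distrib)
    have M: "(LINT z:std_disc_ball i0 (x * r) s|lborel. ?\<phi> z) = t ^ 2 * ?M"
      using set_integral_block_scale[OF cont, of x 1 i0 r s] x unfolding \<phi>_scale
      by (simp add: power2_eq_square)
    note bounds = set_integral_shell_bounds[OF open_std_disc_ball emeasure_std_disc_ball_finite
        open_std_disc_ball std_disc_ball_mono cont, of "x * r" r s s i0 "r\<^sup>2" "x\<^sup>2 * r\<^sup>2"]
    have 1: "x * r \<le> r" using x r by simp
    have 2: "?\<phi> z \<le> r\<^sup>2" if "z \<in> std_disc_ball i0 r s" for z
      using that by (auto simp: std_disc_ball_def intro!: power_mono)
    have 3: "x\<^sup>2 * r\<^sup>2 \<le> ?\<phi> z" if "z \<in> std_disc_ball i0 r s" "z \<notin> std_disc_ball i0 (x * r) s" for z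
      using that x r unfolding power_mult_distrib[symmetric]
      by (auto simp: std_disc_ball_def intro!: power_mono)
    show ?thesis
      using bounds(1)[OF 1 order_refl _ 2 3] bounds(2)[OF 1 order_refl _ 2 3]
      unfolding V M x(3) by (simp add: power2_eq_square)
  qed
  then have "real (Suc 1) * ?M = real 1 * r\<^sup>2 * ?V"
    by (intro moment_of_scaling_sandwich) blast+
  then show ?thesis by (simp add: field_simps)
qed

text \<open>
  Shrinking the ball factor only: the complex dimension of the scaled block is \<open>n - 1\<close>.
\<close>

lemma set_integral_tail_moment:
  assumes r: "r > 0" and s: "s > 0"
  shows "(LINT z:std_disc_ball (i0::'n::finite) r s|lborel. (tail_norm i0 z)\<^sup>2)
    = (real CARD('n) - 1) / real CARD('n) * s\<^sup>2 * measure lborel (std_disc_ball i0 r s)" (is "?M = _ * ?V")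
proof -
  define m where "m = CARD('n) - 1"
  have m: "CARD('n) = Suc m" by (simp add: m_def)
  let ?\<phi> = "\<lambda>z::complex^'n. (tail_norm i0 z)\<^sup>2"
  have cont: "continuous_on UNIV ?\<phi>" by (intro continuous_intros continuous_on_tail_norm)
  have "t * s\<^sup>2 * (?V - t ^ m * ?V) \<le> ?M - t ^ Suc m * ?M \<and> ?M - t ^ Suc m * ?M \<le> s\<^sup>2 * (?V - t ^ m * ?V)"
    if t: "0 < t" "t < 1" for t
  proof -
    define y where "y = sqrt t"
    have y: "0 < y" "y < 1" "y\<^sup>2 = t" using t by (auto simp: y_def)
    have V: "measure lborel (std_disc_ball i0 r (y * s)) = t ^ m * ?V"
      using measure_std_disc_ball_scale[of 1 y i0 r s] y by (simp add: m)
    have M: "(LINT z:std_disc_ball i0 r (y * s)|lborel. ?\<phi> z) = t ^ Suc m * ?M"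
      using set_integral_block_scale[OF cont, of 1 y i0 r s] y
      by (simp add: tail_norm_block_scale power_mult_distrib m)
    note bounds = set_integral_shell_bounds[OF open_std_disc_ball emeasure_std_disc_ball_finite
        open_std_disc_ball std_disc_ball_mono cont, of r r "y * s" s i0 "s\<^sup>2" "y\<^sup>2 * s\<^sup>2"]
    have 1: "y * s \<le> s" using y s by simp
    have 2: "?\<phi> z \<le> s\<^sup>2" if "z \<in> std_disc_ball i0 r s" for z
      using that by (auto simp: std_disc_ball_def intro!: power_mono)
    have 3: "y\<^sup>2 * s\<^sup>2 \<le> ?\<phi> z" if "z \<in> std_disc_ball i0 r s" "z \<notin> std_disc_ball i0 r (y * s)" for z
      using that y s unfolding power_mult_distrib[symmetric]
      by (auto simp: std_disc_ball_def intro!: power_mono)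
    show ?thesis
      using bounds(1)[OF order_refl 1 _ 2 3] bounds(2)[OF order_refl 1 _ 2 3]
      unfolding V M y(3) by simp
  qed
  then have "real (Suc m) * ?M = real m * s\<^sup>2 * ?V"
    by (intro moment_of_scaling_sandwich) blast+
  then show ?thesis by (simp add: m field_simps)
qed

section \<open>Mean values on balanced domains\<close>

lemma norm_vector_scalar_mult: "norm (c *s z) = cmod c * norm (z :: complex^'n::finite)"
  unfolding norm_vec_def by (simp add: norm_mult L2_set_right_distrib)

lemma linear_vector_scalar_mult: "linear (\<lambda>z. c *s (z :: complex^'n::finite))"
  by (rule linearI) (simp_all add: vec_eq_iff algebra_simps)

lemma orthogonal_transformation_phase:
  "cmod c = 1 \<Longrightarrow> orthogonal_transformation (\<lambda>z. c *s (z :: complex^'n::finite))"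
  by (simp add: orthogonal_transformation linear_vector_scalar_mult norm_vector_scalar_mult)

lemma continuous_on_vector_scalar_mult [continuous_intros]:
  assumes "continuous_on S f" "continuous_on S g"
  shows "continuous_on S (\<lambda>x. f x *s (g x :: complex^'n::finite))"
  unfolding vector_scalar_mult_def using assms by (intro continuous_intros)

lemma set_integral_orthogonal:
  fixes F :: "'a::euclidean_space \<Rightarrow> 'b::euclidean_space" and T :: "'a \<Rightarrow> 'a"
  assumes T: "orthogonal_transformation T" and P: "open P" and F: "continuous_on P F"
  shows "(LINT z:P|lborel. F z) = (LINT z:T -` P|lborel. F (T z))"
    and "set_integrable lborel P F \<longleftrightarrow> set_integrable lborel (T -` P) (\<lambda>z. F (T z))"
proof -
  have meas: "(\<lambda>z. indicator P z *\<^sub>R F z) \<in> borel_measurable borel"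
    using P F by (intro borel_measurable_continuous_on_indicator) auto
  have mT: "T \<in> borel_measurable borel"
    by (intro borel_measurable_continuous_onI linear_continuous_on)
      (simp add: T orthogonal_transformation_linear linear_conv_bounded_linear[THEN iffD1])
  have "(LINT z:P|lborel. F z) = (LINT z|distr lborel borel T. indicator P z *\<^sub>R F z)"
    by (simp add: lborel_distr_orthogonal[OF T] set_lebesgue_integral_def)
  also have "\<dots> = (LINT z|lborel. indicator P (T z) *\<^sub>R F (T z))"
    using mT meas by (subst integral_distr) auto
  finally show "(LINT z:P|lborel. F z) = (LINT z:T -` P|lborel. F (T z))"
    by (simp add: set_lebesgue_integral_def indicator_def)
  have "set_integrable lborel P F \<longleftrightarrow> integrable (distr lborel borel T) (\<lambda>z. indicator P z *\<^sub>R F z)"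
    by (simp add: lborel_distr_orthogonal[OF T] set_integrable_def)
  also have "\<dots> \<longleftrightarrow> integrable lborel (\<lambda>z. indicator P (T z) *\<^sub>R F (T z))"
    using mT meas by (subst integrable_distr_eq) auto
  finally show "set_integrable lborel P F \<longleftrightarrow> set_integrable lborel (T -` P) (\<lambda>z. F (T z))"
    by (simp add: set_integrable_def indicator_def)
qed

definition complex_balanced :: "(complex^'n) set \<Rightarrow> bool" where
  "complex_balanced P \<longleftrightarrow> (\<forall>z\<in>P. \<forall>c. cmod c \<le> 1 \<longrightarrow> c *s z \<in> P)"

lemma complex_balanced_phase_vimage:
  assumes "complex_balanced P" "cmod c = 1"
  shows "(\<lambda>z. c *s z) -` P = P"
proof -
  have "c \<noteq> 0" using assms(2) by auto
  then have inv: "z = inverse c *s (c *s z)" for z by (simp add: vec_eq_iff)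
  have ninv: "cmod (inverse c) \<le> 1" using assms(2) by (simp add: norm_inverse)
  have "z \<in> P" if "c *s z \<in> P" for z
  proof -
    have "inverse c *s (c *s z) \<in> P"
      using assms(1) that ninv unfolding complex_balanced_def by blast
    then show ?thesis by (simp only: inv[symmetric])
  qed
  moreover have "c *s z \<in> P" if "z \<in> P" for z
    using assms that unfolding complex_balanced_def by simp
  ultimately show ?thesis by auto
qed

lemma complex_balanced_std_disc_ball: "complex_balanced (std_disc_ball i0 r s)"
  unfolding complex_balanced_def
proof (intro ballI allI impI)
  fix z c assume z: "z \<in> std_disc_ball i0 r s" and c: "cmod c \<le> 1"
  have "tail_norm i0 (c *s z) = cmod c * tail_norm i0 z"
    by (simp add: tail_norm_def norm_mult L2_set_right_distrib)
  also have "\<dots> \<le> tail_norm i0 z" using c by (intro mult_left_le_one_le) auto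
  moreover have "cmod c * cmod (z $ i0) \<le> cmod (z $ i0)" using c by (intro mult_left_le_one_le) auto
  ultimately show "c *s z \<in> std_disc_ball i0 r s"
    using z by (auto simp: std_disc_ball_def norm_mult)
qed

lemma holomorphic_fun_continuous_on: "holomorphic_fun P g \<Longrightarrow> continuous_on P g"
  unfolding holomorphic_fun_def
  by (meson continuous_at_imp_continuous_on has_derivative_continuous)

lemma has_integral_circle_mean:
  assumes g: "holomorphic_fun P g" and P: "open P" "complex_balanced P" and z: "z \<in> P"
  shows "((\<lambda>t. g (cis t *s z)) has_integral (2 * of_real pi * g 0)) {0..2 * pi}"
proof -
  let ?u = "\<lambda>w. g (w *s z)"
  have holo: "?u holomorphic_on cball 0 1"
    unfolding holomorphic_on_def
  proof
    fix w :: complex assume "w \<in> cball 0 1"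
    then have "w *s z \<in> P" using P z by (auto simp: complex_balanced_def)
    then obtain D where D: "(g has_derivative D) (at (w *s z))" "\<And>c v. D (c *s v) = c * D v"
      using g by (auto simp: holomorphic_fun_def)
    have "((\<lambda>w. w *s z) has_derivative (\<lambda>w. w *s z)) (at w)"
      by (rule bounded_linear_imp_has_derivative, rule linear_conv_bounded_linear[THEN iffD1], rule linearI)
        (simp_all add: vec_eq_iff algebra_simps)
    from diff_chain_at[OF this D(1)] have "(?u has_derivative (\<lambda>h. D (h *s z))) (at w)" by (simp add: o_def)
    moreover have "(\<lambda>h. D (h *s z)) = (*) (D z)" by (auto simp: D(2) mult.commute)
    ultimately have "(?u has_field_derivative D z) (at w)" by (simp add: has_field_derivative_def)
    then show "?u field_differentiable at w within cball 0 1"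
      using field_differentiable_at_within field_differentiable_def by blast
  qed
  have "((\<lambda>w. ?u w / (w - 0)) has_contour_integral (2 * of_real pi * \<i> * ?u 0)) (circlepath 0 1)"
    by (rule Cauchy_integral_circlepath_simple[OF holo]) simp
  then have "((\<lambda>t. ?u (0 + 1 * cis t) / (0 + 1 * cis t - 0) * 1 * \<i> * cis t) has_integral (2 * of_real pi * \<i> * ?u 0)) {0..2 * pi}"
    unfolding circlepath_def by (subst (asm) has_contour_integral_part_circlepath_iff) auto
  then have "((\<lambda>t. \<i> * ?u (cis t)) has_integral (\<i> * (2 * of_real pi * ?u 0))) {0..2 * pi}"
    by (simp add: mult_ac)
  then have "((\<lambda>t. ?u (cis t)) has_integral (2 * of_real pi * ?u 0)) {0..2 * pi}"
    by (subst (asm) has_integral_mult_right_iff) auto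
  then show ?thesis by simp
qed

text \<open>
  The integral is unchanged when \<open>g\<close> is rotated by \<open>cis t\<close>. Averaging over \<open>t\<close> and exchanging the
  integrals leaves the mean of \<open>g\<close> over a circle through \<open>z\<close>, which is \<open>g 0\<close> by Cauchy's formula. This
  covers functions that are unbounded near the boundary, as components of square integrable sections
  may be.
\<close>

lemma set_integral_mean_value:
  fixes g :: "complex^'n::finite \<Rightarrow> complex"
  assumes g: "holomorphic_fun P g" and P: "open P" "complex_balanced P" "emeasure lborel P < \<infinity>"
    and int: "set_integrable lborel P g"
  shows "(LINT z:P|lborel. g z) = measure lborel P * g 0"
proof -
  have cg: "continuous_on P g" using g by (rule holomorphic_fun_continuous_on)
  have rot: "(LINT z:P|lborel. F z) = (LINT z:P|lborel. F (cis t *s z))"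
    and rot_int: "set_integrable lborel P F \<longleftrightarrow> set_integrable lborel P (\<lambda>z. F (cis t *s z))"
    if "continuous_on P F" for F :: "complex^'n \<Rightarrow> 'b::euclidean_space" and t
    using set_integral_orthogonal[OF orthogonal_transformation_phase P(1) that, of "cis t"]
      complex_balanced_phase_vimage[OF P(2), of "cis t"] by simp_all
  let ?I = "{0..2 * pi}"
  define f where "f = (\<lambda>(t, z). indicator (?I \<times> P) (t, z) *\<^sub>R g (cis t *s z))"
  have inP: "cis t *s z \<in> P" if "z \<in> P" for t z
    using P(2) that by (auto simp: complex_balanced_def)
  have f_eq: "f (t, z) = indicator ?I t *\<^sub>R indicator P z *\<^sub>R g (cis t *s z)" for t z
    by (simp add: f_def indicator_def)
  have "continuous_on (?I \<times> P) (\<lambda>x. g (cis (fst x) *s snd x))"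
    using inP by (intro continuous_on_compose2[OF cg] continuous_intros) auto
  moreover have "?I \<times> P \<in> sets borel"
    using P(1) by (auto intro!: borel_Times)
  ultimately have "(\<lambda>x. indicator (?I \<times> P) x *\<^sub>R g (cis (fst x) *s snd x)) \<in> borel_measurable borel"
    by (intro borel_measurable_continuous_on_indicator)
  then have meas: "f \<in> borel_measurable (lborel \<Otimes>\<^sub>M lborel)"
    by (simp add: f_def case_prod_beta' lborel_prod)
  have int_t: "integrable lborel (\<lambda>z. f (t, z))" for t
    using rot_int[OF cg, of t] int unfolding f_eq set_integrable_def by (intro integrable_scaleR_right) blast
  have norm_t: "(LINT z|lborel. norm (f (t, z))) = indicator ?I t * (LINT z:P|lborel. norm (g z))" for t
  proof -
    have "(LINT z|lborel. norm (f (t, z))) = (LINT z|lborel. indicator ?I t * (indicator P z * norm (g (cis t *s z))))"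
      by (simp add: f_eq mult.assoc)
    also have "\<dots> = indicator ?I t * (LINT z:P|lborel. norm (g (cis t *s z)))"
      by (simp add: set_lebesgue_integral_def mult.assoc)
    also have "(LINT z:P|lborel. norm (g (cis t *s z))) = (LINT z:P|lborel. norm (g z))"
      using rot[of "\<lambda>z. norm (g z)" t] cg by (simp add: continuous_on_norm)
    finally show ?thesis .
  qed
  have integrable_f: "integrable (lborel \<Otimes>\<^sub>M lborel) f"
  proof (rule lborel_pair.Fubini_integrable[OF meas])
    show "integrable lborel (\<lambda>t. LINT z|lborel. norm (f (t, z)))"
      unfolding norm_t by (intro integrable_mult_left) auto
  qed (use int_t in auto)
  have "(LINT z|lborel. (LINT t|lborel. f (t, z))) = (LINT t|lborel. (LINT z|lborel. f (t, z)))"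
    using integrable_f by (intro lborel_pair.Fubini_integral) (simp add: case_prod_beta')
  also have "(\<lambda>t. LINT z|lborel. f (t, z)) = (\<lambda>t. indicator ?I t *\<^sub>R (LINT z:P|lborel. g z))"
  proof
    fix t
    have "(LINT z|lborel. f (t, z)) = indicator ?I t *\<^sub>R (LINT z:P|lborel. g (cis t *s z))"
      by (cases "t \<in> ?I") (simp_all add: f_eq set_lebesgue_integral_def)
    then show "(LINT z|lborel. f (t, z)) = indicator ?I t *\<^sub>R (LINT z:P|lborel. g z)"
      using rot[OF cg, of t] by simp
  qed
  also have "(LINT t|lborel. indicator ?I t *\<^sub>R (LINT z:P|lborel. g z)) = 2 * pi * (LINT z:P|lborel. g z)"
    by (simp add: scaleR_conv_of_real)
  also have "(\<lambda>z. LINT t|lborel. f (t, z)) = (\<lambda>z. indicator P z *\<^sub>R (2 * pi * g 0))"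
  proof
    fix z
    show "(LINT t|lborel. f (t, z)) = indicator P z *\<^sub>R (2 * pi * g 0)"
    proof (cases "z \<in> P")
      case True
      have "continuous_on ?I (\<lambda>t. g (cis t *s z))"
        using inP[OF True] by (intro continuous_on_compose2[OF cg] continuous_intros) auto
      then have "set_integrable lborel ?I (\<lambda>t. g (cis t *s z))"
        by (intro borel_integrable_compact[folded set_integrable_def]) auto
      then have "(LINT t:?I|lborel. g (cis t *s z)) = 2 * pi * g 0"
        using has_integral_circle_mean[OF g P(1,2) True]
        by (simp add: set_borel_integral_eq_integral(2) integral_unique)
      with True show ?thesis by (simp add: f_eq set_lebesgue_integral_def)
    qed (simp add: f_eq)
  qed
  also have "(LINT z|lborel. indicator P z *\<^sub>R (2 * pi * g 0)) = 2 * pi * (measure lborel P * g 0)"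
    using P by (simp add: scaleR_conv_of_real)
  finally show ?thesis by simp
qed

section \<open>Taylor expansion to second order\<close>

definition second_derivative ::
  "('a::real_normed_vector \<Rightarrow> 'b::real_normed_vector) \<Rightarrow> 'a \<Rightarrow> 'a \<Rightarrow> 'a \<Rightarrow> 'b" where
  "second_derivative f a v w = frechet_derivative (\<lambda>x. frechet_derivative f (at x) v) (at a) w"

text \<open>
  The regularity behind the second-order expansion with a remainder in Peano's form.
\<close>

definition twice_differentiable_at :: "'a::real_normed_vector set \<Rightarrow> ('a \<Rightarrow> 'b::real_normed_vector) \<Rightarrow> 'a \<Rightarrow> bool" where
  "twice_differentiable_at U f a \<longleftrightarrow> open U \<and> a \<in> U \<and> (\<forall>x\<in>U. f differentiable (at x)) \<and>
     (\<forall>v. (\<lambda>x. frechet_derivative f (at x) v) differentiable (at a))"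

lemma smooth_fun_twice_differentiable:
  assumes "smooth_fun U f" "open U" "a \<in> U"
  shows "twice_differentiable_at U f a"
proof -
  have "Ck_on (Suc (Suc 0)) U f" using assms by (simp only: smooth_fun_def)
  then show ?thesis using assms by (simp add: twice_differentiable_at_def)
qed

lemma has_derivative_frechet: "f differentiable (at x) \<Longrightarrow> (f has_derivative frechet_derivative f (at x)) (at x)"
  by (simp add: frechet_derivative_works)

lemma second_derivative_has_derivative:
  assumes "twice_differentiable_at U f a"
  shows "((\<lambda>x. frechet_derivative f (at x) v) has_derivative second_derivative f a v) (at a)"
  using assms has_derivative_frechet unfolding twice_differentiable_at_def second_derivative_def by blast

lemma bilinear_second_derivative:
  assumes "twice_differentiable_at U f a"
  shows "bilinear (second_derivative f a)"
proof -
  have lin: "linear (frechet_derivative f (at x))" if "x \<in> U" for x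
    using assms that linear_frechet_derivative by (auto simp: twice_differentiable_at_def)
  have U: "open U" "a \<in> U" using assms by (auto simp: twice_differentiable_at_def)
  note hd = second_derivative_has_derivative[OF assms]
  have add: "second_derivative f a (v + v') = (\<lambda>w. second_derivative f a v w + second_derivative f a v' w)" for v v'
  proof (rule has_derivative_unique[OF hd])
    show "((\<lambda>x. frechet_derivative f (at x) (v + v')) has_derivative
        (\<lambda>w. second_derivative f a v w + second_derivative f a v' w)) (at a)"
      by (rule has_derivative_transform_within_open[OF has_derivative_add[OF hd hd] U])
        (use lin in \<open>simp add: linear_add\<close>)
  qed
  have scale: "second_derivative f a (c *\<^sub>R v) = (\<lambda>w. c *\<^sub>R second_derivative f a v w)" for c v
  proof (rule has_derivative_unique[OF hd])
    show "((\<lambda>x. frechet_derivative f (at x) (c *\<^sub>R v)) has_derivative (\<lambda>w. c *\<^sub>R second_derivative f a v w)) (at a)"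
      by (rule has_derivative_transform_within_open[OF has_derivative_scaleR_right[OF hd] U])
        (use lin in \<open>simp add: linear_scale\<close>)
  qed
  show ?thesis
    unfolding bilinear_def
    using has_derivative_linear[OF hd] add scale by (auto intro!: linearI)
qed

text \<open>
  The error is a function \<open>\<phi>\<close> on the segment from \<open>a\<close> to \<open>a + z\<close>. Its derivative \<open>\<psi>\<close> is the
  first-order error of the directional derivatives of \<open>f\<close>, which is small by differentiability at
  \<open>a\<close>; the mean value inequality gives the bound.
\<close>

lemma taylor_second_order:
  fixes f :: "'a::euclidean_space \<Rightarrow> 'b::real_normed_vector"
  assumes f: "twice_differentiable_at U f a" and e: "e > 0"
  shows "\<exists>d>0. \<forall>z. norm z < d \<longrightarrow>
    norm (f (a + z) - f a - frechet_derivative f (at a) z - (1/2) *\<^sub>R second_derivative f a z z) \<le> e * (norm z)\<^sup>2"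
proof -
  let ?D = "\<lambda>x. frechet_derivative f (at x)" and ?S = "second_derivative f a"
  define n where "n = real DIM('a)"
  have n: "n > 0" by (simp add: n_def)
  have U: "open U" "a \<in> U" using f by (auto simp: twice_differentiable_at_def)
  have df: "(f has_derivative ?D x) (at x)" if "x \<in> U" for x
    using f that has_derivative_frechet by (auto simp: twice_differentiable_at_def)
  obtain d0 where d0: "d0 > 0" "ball a d0 \<subseteq> U" using U open_contains_ball by blast
  have "\<exists>d>0. \<forall>y. norm y < d \<longrightarrow> norm (?D (a + y) b - ?D a b - ?S b y) \<le> e / n * norm y" for b
  proof -
    obtain d where d: "d > 0"
      "\<And>y. norm (y - a) < d \<Longrightarrow> norm (?D y b - ?D a b - ?S b (y - a)) \<le> e / n * norm (y - a)"
      using second_derivative_has_derivative[OF f, of b] e n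
      unfolding has_derivative_at_alt by (metis divide_pos_pos)
    then show ?thesis by (metis add_diff_cancel_left')
  qed
  then obtain \<delta> where \<delta>: "\<And>b. \<delta> b > 0"
    "\<And>b y. norm y < \<delta> b \<Longrightarrow> norm (?D (a + y) b - ?D a b - ?S b y) \<le> e / n * norm y" by metis
  define d where "d = Min (insert d0 (\<delta> ` Basis))"
  have d: "d > 0" "d \<le> d0" using d0 \<delta> by (auto simp: d_def)
  have d\<delta>: "d \<le> \<delta> b" if "b \<in> Basis" for b using that unfolding d_def by (intro Min_le) auto
  have bil: "bilinear ?S" using f by (rule bilinear_second_derivative)
  have key: "norm (f (a + z) - f a - ?D a z - (1/2) *\<^sub>R ?S z z) \<le> e * (norm z)\<^sup>2" if z: "norm z < d" for z
  proof -
    have near: "a + t *\<^sub>R z \<in> U" "norm (t *\<^sub>R z) \<le> norm z" "norm (t *\<^sub>R z) < d" if "t \<in> {0..1}" for t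
    proof -
      show *: "norm (t *\<^sub>R z) \<le> norm z" using that by (simp add: mult_left_le_one_le)
      then show "norm (t *\<^sub>R z) < d" using z by simp
      then show "a + t *\<^sub>R z \<in> U" using d0 d by (auto simp: dist_norm subset_eq)
    qed
    define \<phi> where "\<phi> t = f (a + t *\<^sub>R z) - f a - t *\<^sub>R ?D a z - (t\<^sup>2 / 2) *\<^sub>R ?S z z" for t
    define \<psi> where "\<psi> t = ?D (a + t *\<^sub>R z) z - ?D a z - t *\<^sub>R ?S z z" for t
    have der: "(\<phi> has_derivative (\<lambda>h. h *\<^sub>R \<psi> t)) (at t within {0..1})" if t: "t \<in> {0..1}" for t
    proof -
      have "((\<lambda>t. a + t *\<^sub>R z) has_derivative (\<lambda>h. h *\<^sub>R z)) (at t)"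
        by (auto intro!: derivative_eq_intros)
      from diff_chain_at[OF this df[OF near(1)[OF t]]]
      have "((\<lambda>t. f (a + t *\<^sub>R z)) has_derivative (\<lambda>h. ?D (a + t *\<^sub>R z) (h *\<^sub>R z))) (at t)"
        by (simp add: o_def)
      moreover have "(\<lambda>h. ?D (a + t *\<^sub>R z) (h *\<^sub>R z)) = (\<lambda>h. h *\<^sub>R ?D (a + t *\<^sub>R z) z)"
        using linear_scale[OF has_derivative_linear[OF df[OF near(1)[OF t]]]] by auto
      ultimately have 1: "((\<lambda>t. f (a + t *\<^sub>R z)) has_derivative (\<lambda>h. h *\<^sub>R ?D (a + t *\<^sub>R z) z)) (at t)" by simp
      have 2: "((\<lambda>t::real. t\<^sup>2 / 2) has_derivative (\<lambda>h. h * t)) (at t)"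
        by (auto intro!: derivative_eq_intros)
      have "(\<phi> has_derivative (\<lambda>h. h *\<^sub>R ?D (a + t *\<^sub>R z) z - 0 - h *\<^sub>R ?D a z - (h * t) *\<^sub>R ?S z z)) (at t)"
        unfolding \<phi>_def
        by (intro has_derivative_diff 1 has_derivative_const has_derivative_scaleR_left[OF 2]
            has_derivative_scaleR_left[OF has_derivative_ident])
      then have "(\<phi> has_derivative (\<lambda>h. h *\<^sub>R \<psi> t)) (at t)"
        by (simp add: \<psi>_def algebra_simps)
      then show ?thesis by (rule has_derivative_at_withinI)
    qed
    have bound: "norm (\<psi> t) \<le> e * (norm z)\<^sup>2" if t: "t \<in> {0..1}" for t
    proof -
      let ?y = "t *\<^sub>R z"
      have expand: "L z = (\<Sum>b\<in>Basis. (z \<bullet> b) *\<^sub>R L b)" if "linear L" for L :: "'a \<Rightarrow> 'b"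
        using linear_sum[OF that, of "\<lambda>b. (z \<bullet> b) *\<^sub>R b" Basis] linear_scale[OF that]
        by (simp add: euclidean_representation)
      have linD: "linear (?D x)" if "x \<in> U" for x using df[OF that] has_derivative_linear by blast
      have lin: "linear (\<lambda>v. ?D (a + ?y) v - ?D a v - ?S v ?y)"
        using linD[OF near(1)[OF t]] linD[OF U(2)] bil
        by (intro linear_compose_sub) (auto simp: bilinear_def)
      have "\<psi> t = ?D (a + ?y) z - ?D a z - ?S z ?y"
        using bil by (simp add: \<psi>_def bilinear_rmul)
      also have "\<dots> = (\<Sum>b\<in>Basis. (z \<bullet> b) *\<^sub>R (?D (a + ?y) b - ?D a b - ?S b ?y))"
        by (rule expand[OF lin])
      also have "norm \<dots> \<le> (\<Sum>b\<in>(Basis::'a set). norm z * (e / n * norm z))"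
      proof (rule sum_norm_le)
        fix b :: 'a assume b: "b \<in> Basis"
        have "norm (?D (a + ?y) b - ?D a b - ?S b ?y) \<le> e / n * norm ?y"
          using near(3)[OF t] d\<delta>[OF b] by (intro \<delta>) auto
        also have "\<dots> \<le> e / n * norm z" using near(2)[OF t] e n by (intro mult_left_mono) auto
        finally show "norm ((z \<bullet> b) *\<^sub>R (?D (a + ?y) b - ?D a b - ?S b ?y)) \<le> norm z * (e / n * norm z)"
          using Basis_le_norm[OF b, of z] e n by (simp only: norm_scaleR real_norm_def) (intro mult_mono, auto)
      qed
      also have "\<dots> = e * (norm z)\<^sup>2" using n by (simp add: n_def power2_eq_square)
      finally show ?thesis .
    qed
    have "norm (\<phi> 1 - \<phi> 0) \<le> e * (norm z)\<^sup>2 * norm (1 - 0 :: real)"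
    proof (rule differentiable_bound[of "{0..1}" \<phi>])
      show "onorm (\<lambda>h. h *\<^sub>R \<psi> t) \<le> e * (norm z)\<^sup>2" if "t \<in> {0..1}" for t
        using bound[OF that] e by (intro onorm_le) (auto simp: mult.commute intro: mult_left_mono)
    qed (use der in auto)
    then show ?thesis by (simp add: \<phi>_def)
  qed
  then show ?thesis using d(1) by blast
qed

section \<open>Wirtinger derivatives\<close>

lemma linear_expand_axis:
  fixes D :: "complex^'n::finite \<Rightarrow> complex"
  assumes "linear D"
  shows "D v = (\<Sum>j\<in>UNIV. Re (v $ j) *\<^sub>R D (axis j 1) + Im (v $ j) *\<^sub>R D (axis j \<i>))"
proof -
  have "v = (\<Sum>j\<in>UNIV. Re (v $ j) *\<^sub>R axis j 1 + Im (v $ j) *\<^sub>R axis j \<i>)"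
  proof (rule vec_eq_iff[THEN iffD2], rule allI)
    fix i
    have "(\<Sum>j\<in>UNIV. Re (v $ j) *\<^sub>R axis j 1 + Im (v $ j) *\<^sub>R axis j \<i>) $ i
      = (\<Sum>j\<in>UNIV. if j = i then Re (v $ i) *\<^sub>R 1 + Im (v $ i) *\<^sub>R \<i> else 0)"
      unfolding sum_component by (intro sum.cong) (auto simp: axis_def)
    then show "v $ i = (\<Sum>j\<in>UNIV. Re (v $ j) *\<^sub>R axis j 1 + Im (v $ j) *\<^sub>R axis j \<i>) $ i"
      by (simp add: complex_eq_iff)
  qed
  then have "D v = D (\<Sum>j\<in>UNIV. Re (v $ j) *\<^sub>R axis j 1 + Im (v $ j) *\<^sub>R axis j \<i>)" by simp
  also have "\<dots> = (\<Sum>j\<in>UNIV. Re (v $ j) *\<^sub>R D (axis j 1) + Im (v $ j) *\<^sub>R D (axis j \<i>))"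
    by (simp add: linear_sum[OF assms] linear_add[OF assms] linear_scale[OF assms])
  finally show ?thesis .
qed

text \<open>
  The complex linear part of a real linear map, expanded in coordinates. This removes coordinates
  from all sums over Wirtinger derivatives.
\<close>

lemma sum_wirtinger_linear:
  fixes D :: "complex^'n::finite \<Rightarrow> complex"
  assumes "linear D"
  shows "(\<Sum>j\<in>UNIV. v $ j * ((D (axis j 1) - \<i> * D (axis j \<i>)) / 2)) = (D v - \<i> * D (\<i> *s v)) / 2"
  unfolding linear_expand_axis[OF assms, of v] linear_expand_axis[OF assms, of "\<i> *s v"]
    sum_distrib_left sum_subtractf[symmetric] sum_divide_distrib
  by (intro sum.cong) (auto simp: complex_eq_iff field_simps)

lemma sum_dzbar:
  fixes f :: "complex^'n::finite \<Rightarrow> complex"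
  assumes "f differentiable (at x)"
  shows "(\<Sum>j\<in>UNIV. cnj (v $ j) * dzbar j f x)
    = (frechet_derivative f (at x) v + \<i> * frechet_derivative f (at x) (\<i> *s v)) / 2"
  unfolding linear_expand_axis[OF linear_frechet_derivative[OF assms], of v]
    linear_expand_axis[OF linear_frechet_derivative[OF assms], of "\<i> *s v"]
    sum_distrib_left sum.distrib[symmetric] sum_divide_distrib dzbar_def
  by (intro sum.cong) (auto simp: complex_eq_iff field_simps)

section \<open>Sesquilinear forms\<close>

text \<open>
  The inner product of \<open>u\<close> and \<open>v\<close> for a metric with Gram matrix \<open>M\<close>, in the convention that
  metrics are linear in the first argument.
\<close>

definition mform :: "complex^'k::finite^'k \<Rightarrow> complex^'k \<Rightarrow> complex^'k \<Rightarrow> complex" where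
  "mform M u v = (\<Sum>\<alpha>\<in>UNIV. cnj (v $ \<alpha>) * (M *v u) $ \<alpha>)"

lemma mform_sum: "mform M u v = (\<Sum>\<alpha>\<in>UNIV. \<Sum>\<beta>\<in>UNIV. M $ \<alpha> $ \<beta> * (u $ \<beta> * cnj (v $ \<alpha>)))"
  by (simp add: mform_def matrix_vector_mult_def sum_distrib_left mult_ac)

lemma mform_add_left: "mform M (u + u') v = mform M u v + mform M u' v"
  by (simp add: mform_def matrix_vector_right_distrib algebra_simps sum.distrib)

lemma mform_add_right: "mform M u (v + v') = mform M u v + mform M u v'"
  by (simp add: mform_def algebra_simps sum.distrib)

lemma mform_scale_left: "mform M (c *s u) v = c * mform M u v"
  by (simp add: mform_def vector_scalar_commute sum_distrib_left mult_ac)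

lemma mform_scale_right: "mform M u (c *s v) = cnj c * mform M u v"
  by (simp add: mform_def sum_distrib_left mult_ac)

lemma mform_zero [simp]: "mform M 0 v = 0" "mform M u 0 = 0"
  by (simp_all add: mform_def)

lemma mform_minus_left: "mform M (- u) v = - mform M u v"
  using mform_scale_left[of M "-1" u v] by (simp add: vector_sneg_minus1[symmetric])

lemma mform_diff_left: "mform M (u - u') v = mform M u v - mform M u' v"
  by (simp only: diff_conv_add_uminus mform_add_left mform_minus_left)

lemma mform_matrix_diff: "mform (M - N) u v = mform M u v - mform N u v"
  by (simp add: mform_sum left_diff_distrib sum_subtractf)

lemma mform_matrix_add: "mform (M + N) u v = mform M u v + mform N u v"
  by (simp add: mform_sum distrib_right sum.distrib)

lemma mform_matrix_scaleR: "mform (r *\<^sub>R M) u v = r * mform M u v"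
  by (simp add: mform_sum sum_distrib_left scaleR_conv_of_real[of r "_::complex"] mult.assoc)

lemma mform_sum_left: "mform M (\<Sum>j\<in>A. f j) v = (\<Sum>j\<in>A. mform M (f j) v)"
  by (induction A rule: infinite_finite_induct) (simp_all add: mform_add_left)

lemma mform_mult: "mform (M ** N) u v = mform M (N *v u) v"
  by (simp add: mform_def matrix_vector_mul_assoc)

lemma mform_hermitian:
  assumes "\<And>\<alpha> \<beta>. M $ \<beta> $ \<alpha> = cnj (M $ \<alpha> $ \<beta>)"
  shows "mform M v u = cnj (mform M u v)"
proof -
  have "cnj (mform M u v) = (\<Sum>\<alpha>\<in>UNIV. \<Sum>\<beta>\<in>UNIV. M $ \<beta> $ \<alpha> * (v $ \<alpha> * cnj (u $ \<beta>)))"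
    by (simp add: mform_sum assms[symmetric] mult_ac)
  also have "\<dots> = mform M v u" unfolding mform_sum by (rule sum.swap)
  finally show ?thesis by simp
qed

definition entry_sum :: "complex^'k::finite^'k \<Rightarrow> real" where
  "entry_sum M = (\<Sum>\<alpha>\<in>UNIV. \<Sum>\<beta>\<in>UNIV. cmod (M $ \<alpha> $ \<beta>))"

lemma entry_sum_nonneg: "0 \<le> entry_sum M"
  by (simp add: entry_sum_def sum_nonneg)

lemma norm_mform_le: "cmod (mform M u v) \<le> entry_sum M * norm u * norm v"
proof -
  have "cmod (mform M u v) \<le> (\<Sum>\<alpha>\<in>UNIV. \<Sum>\<beta>\<in>UNIV. cmod (M $ \<alpha> $ \<beta>) * (norm u * norm v))"
    unfolding mform_sum
    by (intro sum_norm_le) (auto simp: norm_mult intro!: mult_left_mono mult_mono Finite_Cartesian_Product.norm_nth_le)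
  then show ?thesis by (simp add: entry_sum_def sum_distrib_right mult.assoc)
qed

lemma continuous_on_mform [continuous_intros]:
  assumes "continuous_on S f" "continuous_on S g" "\<And>\<alpha> \<beta>. continuous_on S (\<lambda>x. M x $ \<alpha> $ \<beta>)"
  shows "continuous_on S (\<lambda>x. mform (M x) (f x) (g x))"
proof -
  have "continuous_on S (\<lambda>x. f x $ \<beta>)" "continuous_on S (\<lambda>x. g x $ \<alpha>)" for \<alpha> \<beta>
    using assms by (auto intro!: continuous_intros)
  then show ?thesis
    unfolding mform_sum
    by (intro continuous_on_sum continuous_on_mult continuous_on_cnj assms(3))
qed

lemma matrix_inv_works:
  fixes A :: "complex^'k::finite^'k"
  assumes "\<And>u. A *v u = 0 \<Longrightarrow> u = 0"
  shows "matrix_inv A ** A = mat 1" "A ** matrix_inv A = mat 1" "det A \<noteq> 0"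
proof -
  have inv: "invertible A"
    using assms matrix_left_invertible_ker[of A] invertible_left_inverse[of A] by blast
  then obtain A' where "A ** A' = mat 1 \<and> A' ** A = mat 1" by (auto simp: invertible_def)
  from someI[of "\<lambda>A'. A ** A' = mat 1 \<and> A' ** A = mat 1", OF this]
  show "matrix_inv A ** A = mat 1" "A ** matrix_inv A = mat 1" by (simp_all add: matrix_inv_def)
  show "det A \<noteq> 0" using inv invertible_det_nz by blast
qed

lemma differentiable_det:
  fixes M :: "'a::real_normed_vector \<Rightarrow> complex^'k::finite^'k"
  assumes "\<And>i j. (\<lambda>x. M x $ i $ j) differentiable (at x)"
  shows "(\<lambda>x. det (M x)) differentiable (at x)"
proof -
  have "\<exists>D. ((\<lambda>x. M x $ i $ j) has_derivative D) (at x)" for i j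
    using assms by (auto simp: differentiable_def)
  then obtain D where D: "\<And>i j. ((\<lambda>x. M x $ i $ j) has_derivative D i j) (at x)" by metis
  have "(\<lambda>x. \<Prod>i\<in>UNIV. M x $ i $ p i) differentiable (at x)" for p
    unfolding differentiable_def using D by (intro exI) (rule has_derivative_prod)
  then show ?thesis unfolding det_def by (intro differentiable_sum differentiable_mult) auto
qed

text \<open>
  Cramer's rule expresses the solution of a linear system as a quotient of determinants. It yields
  differentiability of the connection form, which involves an inverse matrix.
\<close>

lemma differentiable_solution:
  fixes A :: "'a::real_normed_vector \<Rightarrow> complex^'k::finite^'k"
  assumes U: "open U" "x \<in> U"
    and A: "\<And>i j. (\<lambda>x. A x $ i $ j) differentiable (at x)"
    and b: "\<And>i. (\<lambda>x. b x $ i) differentiable (at x)"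
    and nz: "\<And>x. x \<in> U \<Longrightarrow> det (A x) \<noteq> 0" and sol: "\<And>x. x \<in> U \<Longrightarrow> A x *v y x = b x"
  shows "(\<lambda>x. y x $ k) differentiable (at x)"
proof -
  have eq: "det (\<chi> i j. if j = k then b x $ i else A x $ i $ j) / det (A x) = y x $ k" if "x \<in> U" for x
    using cramer[OF nz[OF that], of "y x" "b x"] sol[OF that] by (simp add: vec_eq_iff)
  have "(\<lambda>x. det (\<chi> i j. if j = k then b x $ i else A x $ i $ j) / det (A x)) differentiable (at x)"
  proof (rule differentiable_divide)
    show "(\<lambda>x. det (\<chi> i j. if j = k then b x $ i else A x $ i $ j)) differentiable (at x)"
    proof (rule differentiable_det)
      fix i j show "(\<lambda>x. (\<chi> i j. if j = k then b x $ i else A x $ i $ j) $ i $ j) differentiable (at x)"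
        using A b by (cases "j = k") auto
    qed
  qed (use nz U differentiable_det[OF A] in auto)
  then obtain D where D: "((\<lambda>x. det (\<chi> i j. if j = k then b x $ i else A x $ i $ j) / det (A x)) has_derivative D) (at x)"
    by (auto simp: differentiable_def)
  have "((\<lambda>x. y x $ k) has_derivative D) (at x)"
    by (rule has_derivative_transform_within_open[OF D U]) (rule eq)
  then show ?thesis by (auto simp: differentiable_def)
qed

lemma i_i_scale: "\<i> *s (\<i> *s (v::complex^'m::finite)) = - v"
  by (simp add: vec_eq_iff)

lemma matrix_vector_entrywise_scale:
  assumes "\<And>\<alpha> \<beta>. M $ \<alpha> $ \<beta> = c * (N::complex^'m::finite^'l::finite) $ \<alpha> $ \<beta>"
  shows "M *v u = c *s (N *v u)"
  using assms by (simp add: matrix_vector_mult_def vec_eq_iff sum_distrib_left mult_ac)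

lemma scaleR_eq_vector_scalar: "r *\<^sub>R (v::complex^'m::finite) = of_real r *s v"
  by (simp add: vec_eq_iff) (simp add: scaleR_conv_of_real)

section \<open>Germs of Hermitian metrics\<close>

text \<open>
  The data that the local analysis uses: a field of positive Hermitian matrices that is twice
  differentiable at \<open>a\<close>. All derivatives \<open>dG\<close>, \<open>d2G\<close>, and the map \<open>conn\<close> below are taken at \<open>a\<close>.
\<close>

locale hermitian_germ =
  fixes U :: "(complex^'n::finite) set" and G :: "complex^'n \<Rightarrow> complex^'k::finite^'k" and a :: "complex^'n"
  assumes twice: "\<And>\<alpha> \<beta>. twice_differentiable_at U (\<lambda>x. G x $ \<alpha> $ \<beta>) a"
    and herm: "\<And>x \<alpha> \<beta>. x \<in> U \<Longrightarrow> G x $ \<beta> $ \<alpha> = cnj (G x $ \<alpha> $ \<beta>)"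
    and pos: "\<And>x u. x \<in> U \<Longrightarrow> u \<noteq> 0 \<Longrightarrow> 0 < Re (mform (G x) u u)"
begin

lemma open_U: "open U" and a_in_U: "a \<in> U"
  using twice[unfolded twice_differentiable_at_def] by blast+

lemma diff_G: "x \<in> U \<Longrightarrow> (\<lambda>x. G x $ \<alpha> $ \<beta>) differentiable (at x)"
  using twice[unfolded twice_differentiable_at_def] by blast

lemma cont_G: "continuous_on U (\<lambda>x. G x $ \<alpha> $ \<beta>)"
  by (rule continuous_at_imp_continuous_on) (blast intro: differentiable_imp_continuous_within diff_G)

abbreviation dentry :: "complex^'n \<Rightarrow> complex^'n \<Rightarrow> 'k \<Rightarrow> 'k \<Rightarrow> complex" where
  "dentry x v \<alpha> \<beta> \<equiv> frechet_derivative (\<lambda>x. G x $ \<alpha> $ \<beta>) (at x) v"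

definition dG :: "complex^'n \<Rightarrow> complex^'k^'k" where
  "dG v = (\<chi> \<alpha> \<beta>. dentry a v \<alpha> \<beta>)"

definition d2G :: "complex^'n \<Rightarrow> complex^'n \<Rightarrow> complex^'k^'k" where
  "d2G v w = (\<chi> \<alpha> \<beta>. second_derivative (\<lambda>x. G x $ \<alpha> $ \<beta>) a v w)"

definition partialG :: "complex^'n \<Rightarrow> complex^'n \<Rightarrow> complex^'k^'k" where
  "partialG x v = (\<chi> \<alpha> \<beta>. (dentry x v \<alpha> \<beta> - \<i> * dentry x (\<i> *s v) \<alpha> \<beta>) / 2)"

text \<open>
  The connection form \<open>G\<^sup>-\<^sup>1 \<partial>G\<close> at \<open>a\<close>, evaluated on \<open>v\<close> and applied to \<open>u\<close>.
\<close>

definition conn :: "complex^'n \<Rightarrow> complex^'k \<Rightarrow> complex^'k" where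
  "conn v u = matrix_inv (G a) *v (partialG a v *v u)"

lemma has_derivative_G: "x \<in> U \<Longrightarrow> ((\<lambda>x. G x $ \<alpha> $ \<beta>) has_derivative (\<lambda>v. dentry x v \<alpha> \<beta>)) (at x)"
  using has_derivative_frechet[OF diff_G] by simp

lemma linear_dentry: "x \<in> U \<Longrightarrow> linear (\<lambda>v. dentry x v \<alpha> \<beta>)"
  using has_derivative_G has_derivative_linear by blast

lemma dentry_hermitian: "x \<in> U \<Longrightarrow> dentry x v \<beta> \<alpha> = cnj (dentry x v \<alpha> \<beta>)"
proof -
  assume x: "x \<in> U"
  have "((\<lambda>x. G x $ \<beta> $ \<alpha>) has_derivative (\<lambda>v. cnj (dentry x v \<alpha> \<beta>))) (at x)"
    by (rule has_derivative_transform_within_open[OF has_derivative_cnj[OF has_derivative_G[OF x]] open_U x])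
      (rule herm[symmetric])
  from fun_cong[OF has_derivative_unique[OF has_derivative_G[OF x] this]] show ?thesis .
qed

lemma d2G_hermitian: "d2G v w $ \<beta> $ \<alpha> = cnj (d2G v w $ \<alpha> $ \<beta>)"
proof -
  have "((\<lambda>x. dentry x v \<beta> \<alpha>) has_derivative (\<lambda>w. cnj (second_derivative (\<lambda>x. G x $ \<alpha> $ \<beta>) a v w))) (at a)"
    by (rule has_derivative_transform_within_open[OF
          has_derivative_cnj[OF second_derivative_has_derivative[OF twice]] open_U a_in_U])
      (rule dentry_hermitian[symmetric])
  from fun_cong[OF has_derivative_unique[OF second_derivative_has_derivative[OF twice] this], of w]
  show ?thesis by (simp add: d2G_def)
qed

lemma det_G_nz: "x \<in> U \<Longrightarrow> det (G x) \<noteq> 0"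
  and inv_G: "x \<in> U \<Longrightarrow> G x ** matrix_inv (G x) = mat 1"
proof -
  have "u = 0" if x: "x \<in> U" and "G x *v u = 0" for x u
  proof (rule ccontr)
    assume "u \<noteq> 0"
    from pos[OF x this] that(2) show False by (simp add: mform_def)
  qed
  then show "x \<in> U \<Longrightarrow> det (G x) \<noteq> 0" "x \<in> U \<Longrightarrow> G x ** matrix_inv (G x) = mat 1"
    using matrix_inv_works by blast+
qed

lemma mform_conn: "mform (G a) (conn v u) w = mform (partialG a v) u w"
  unfolding conn_def
  by (simp only: mform_mult[symmetric] matrix_mul_assoc inv_G[OF a_in_U] matrix_mul_lid matrix_vector_mul_assoc)

lemma mform_G_hermitian: "x \<in> U \<Longrightarrow> mform (G x) v u = cnj (mform (G x) u v)"
  by (rule mform_hermitian) (rule herm)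

lemma partialG_add: "x \<in> U \<Longrightarrow> partialG x (v + w) = partialG x v + partialG x w"
  by (simp add: partialG_def vec_eq_iff linear_add[OF linear_dentry] vector_add_ldistrib field_simps)

lemma partialG_i: "x \<in> U \<Longrightarrow> partialG x (\<i> *s v) $ \<alpha> $ \<beta> = \<i> * partialG x v $ \<alpha> $ \<beta>"
  by (simp add: partialG_def i_i_scale linear_neg[OF linear_dentry] algebra_simps)

lemma partialG_scale: "x \<in> U \<Longrightarrow> partialG x (c *s v) $ \<alpha> $ \<beta> = c * partialG x v $ \<alpha> $ \<beta>"
proof -
  assume x: "x \<in> U"
  have real: "partialG x (r *\<^sub>R w) $ \<alpha> $ \<beta> = r * partialG x w $ \<alpha> $ \<beta>" for r w
  proof -
    have "\<i> *s (r *\<^sub>R w) = r *\<^sub>R (\<i> *s w)" by (simp add: vec_eq_iff)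
    then show ?thesis
      by (simp add: partialG_def linear_scale[OF linear_dentry[OF x]] del: vector_scaleR_component)
        (simp add: scaleR_conv_of_real algebra_simps)
  qed
  have "c *s v = Re c *\<^sub>R v + Im c *\<^sub>R (\<i> *s v)"
    by (simp add: vec_eq_iff complex_eq_iff)
  then have "partialG x (c *s v) $ \<alpha> $ \<beta> = Re c * partialG x v $ \<alpha> $ \<beta> + Im c * (\<i> * partialG x v $ \<alpha> $ \<beta>)"
    by (simp add: partialG_add[OF x] real partialG_i[OF x])
  also have "\<dots> = c * partialG x v $ \<alpha> $ \<beta>" by (simp add: complex_eq_iff)
  finally show ?thesis .
qed

lemma conn_add_left: "conn (v + w) u = conn v u + conn w u"
  by (simp add: conn_def partialG_add[OF a_in_U] matrix_vector_mult_add_rdistrib matrix_vector_right_distrib)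

lemma conn_add_right: "conn v (u + w) = conn v u + conn v w"
  by (simp add: conn_def matrix_vector_right_distrib)

lemma conn_scale_left: "conn (c *s v) u = c *s conn v u"
  unfolding conn_def
  by (simp add: matrix_vector_entrywise_scale[OF partialG_scale[OF a_in_U]] vector_scalar_commute)

lemma conn_scale_right: "conn v (c *s u) = c *s conn v u"
  by (simp add: conn_def vector_scalar_commute)

lemma bilinear_conn: "bilinear conn"
  unfolding bilinear_def
  by (auto intro!: linearI simp: conn_add_left conn_add_right scaleR_eq_vector_scalar conn_scale_left conn_scale_right)

text \<open>
  As \<open>G\<close> is Hermitian, its antiholomorphic derivative is the adjoint of the holomorphic one.
\<close>

lemma mform_dG: "mform (dG v) u w = mform (partialG a v) u w + cnj (mform (partialG a v) w u)"
proof -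
  have *: "dG v $ \<alpha> $ \<beta> = partialG a v $ \<alpha> $ \<beta> + cnj (partialG a v $ \<beta> $ \<alpha>)" for \<alpha> \<beta>
    by (simp add: dG_def partialG_def dentry_hermitian[OF a_in_U, where \<alpha>=\<alpha> and \<beta>=\<beta>] field_simps)
  have "cnj (mform (partialG a v) w u) = (\<Sum>\<beta>\<in>UNIV. \<Sum>\<alpha>\<in>UNIV. cnj (partialG a v $ \<beta> $ \<alpha>) * (u $ \<beta> * cnj (w $ \<alpha>)))"
    by (simp add: mform_sum mult_ac)
  also have "\<dots> = (\<Sum>\<alpha>\<in>UNIV. \<Sum>\<beta>\<in>UNIV. cnj (partialG a v $ \<beta> $ \<alpha>) * (u $ \<beta> * cnj (w $ \<alpha>)))"
    by (rule sum.swap)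
  finally show ?thesis by (simp add: mform_sum * sum.distrib distrib_right)
qed

end

section \<open>The curvature as a second derivative\<close>

context hermitian_germ
begin

definition chern_form :: "'n \<Rightarrow> complex^'n \<Rightarrow> complex^'k^'k" where
  "chern_form j x = matrix_inv (G x) ** (\<chi> \<alpha> \<beta>. dz j (\<lambda>y. G y $ \<alpha> $ \<beta>) x)"

definition curv :: "complex^'n \<Rightarrow> complex^'k^'k" where
  "curv v = (\<chi> \<alpha> \<beta>. \<Sum>j\<in>UNIV. \<Sum>k\<in>UNIV. - dzbar k (\<lambda>y. chern_form j y $ \<alpha> $ \<beta>) a * v $ j * cnj (v $ k))"

definition dchern :: "'n \<Rightarrow> complex^'n \<Rightarrow> complex^'k^'k" where
  "dchern j w = (\<chi> \<alpha> \<beta>. frechet_derivative (\<lambda>x. chern_form j x $ \<alpha> $ \<beta>) (at a) w)"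

lemma i_axis: "\<i> *s axis j 1 = axis j \<i>"
  by (simp add: vec_eq_iff axis_def)

lemma dz_eq_partialG: "dz j (\<lambda>y. G y $ \<alpha> $ \<beta>) x = partialG x (axis j 1) $ \<alpha> $ \<beta>"
  by (simp add: dz_def partialG_def i_axis)

lemma chern_form_eq: "chern_form j x = matrix_inv (G x) ** partialG x (axis j 1)"
  by (simp add: chern_form_def dz_eq_partialG)

lemma G_chern_form: "x \<in> U \<Longrightarrow> G x ** chern_form j x = partialG x (axis j 1)"
  by (simp add: chern_form_eq matrix_mul_assoc inv_G)

lemma partialG_has_derivative:
  "((\<lambda>x. partialG x v $ \<alpha> $ \<beta>) has_derivative
     (\<lambda>w. (d2G v w $ \<alpha> $ \<beta> - \<i> * d2G (\<i> *s v) w $ \<alpha> $ \<beta>) / 2)) (at a)"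
  unfolding partialG_def d2G_def
  by (simp only: vec_lambda_beta divide_inverse)
    (intro has_derivative_mult_left has_derivative_diff has_derivative_mult_right
      second_derivative_has_derivative[OF twice])

lemma chern_form_has_derivative:
  "((\<lambda>x. chern_form j x $ \<alpha> $ \<beta>) has_derivative (\<lambda>w. dchern j w $ \<alpha> $ \<beta>)) (at a)"
proof -
  have "(\<lambda>x. (\<chi> \<gamma>. chern_form j x $ \<gamma> $ \<beta>) $ \<alpha>) differentiable (at a)"
  proof (rule differentiable_solution[OF open_U a_in_U])
    show "(\<lambda>x. G x $ i $ l) differentiable (at a)" for i l
      by (rule diff_G[OF a_in_U])
    show "(\<lambda>x. (\<chi> \<gamma>. partialG x (axis j 1) $ \<gamma> $ \<beta>) $ i) differentiable (at a)" for i
      using partialG_has_derivative by (auto simp: differentiable_def)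
    show "G x *v (\<chi> \<gamma>. chern_form j x $ \<gamma> $ \<beta>) = (\<chi> \<gamma>. partialG x (axis j 1) $ \<gamma> $ \<beta>)" if "x \<in> U" for x
      unfolding G_chern_form[OF that, symmetric]
      by (simp add: vec_eq_iff matrix_vector_mult_def matrix_matrix_mult_def)
  qed (rule det_G_nz)
  then show ?thesis using has_derivative_frechet by (simp add: dchern_def)
qed

text \<open>
  The product rule for \<open>G \<theta> = \<partial>G\<close>, where \<open>\<theta>\<close> is the connection form. It determines the
  derivative of \<open>\<theta>\<close> at \<open>a\<close>.
\<close>

lemma dchern_equation:
  "dG w ** chern_form j a + G a ** dchern j w
    = (\<chi> \<alpha> \<beta>. (d2G (axis j 1) w $ \<alpha> $ \<beta> - \<i> * d2G (axis j \<i>) w $ \<alpha> $ \<beta>) / 2)"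
proof -
  have "(dG w ** chern_form j a + G a ** dchern j w) $ \<alpha> $ \<beta>
    = (d2G (axis j 1) w $ \<alpha> $ \<beta> - \<i> * d2G (axis j \<i>) w $ \<alpha> $ \<beta>) / 2" for \<alpha> \<beta>
  proof -
    have "((\<lambda>x. \<Sum>\<gamma>\<in>UNIV. G x $ \<alpha> $ \<gamma> * chern_form j x $ \<gamma> $ \<beta>) has_derivative
        (\<lambda>w. \<Sum>\<gamma>\<in>UNIV. G a $ \<alpha> $ \<gamma> * dchern j w $ \<gamma> $ \<beta> + dentry a w \<alpha> \<gamma> * chern_form j a $ \<gamma> $ \<beta>)) (at a)"
      by (intro has_derivative_sum has_derivative_mult has_derivative_G[OF a_in_U] chern_form_has_derivative)
    then have "((\<lambda>x. partialG x (axis j 1) $ \<alpha> $ \<beta>) has_derivative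
        (\<lambda>w. \<Sum>\<gamma>\<in>UNIV. G a $ \<alpha> $ \<gamma> * dchern j w $ \<gamma> $ \<beta> + dentry a w \<alpha> \<gamma> * chern_form j a $ \<gamma> $ \<beta>)) (at a)"
      by (rule has_derivative_transform_within_open[OF _ open_U a_in_U])
        (simp add: G_chern_form[symmetric] matrix_matrix_mult_def)
    from fun_cong[OF has_derivative_unique[OF this partialG_has_derivative], of w]
    show ?thesis
      by (simp add: matrix_matrix_mult_def dG_def sum.distrib i_axis add.commute)
  qed
  then show ?thesis by (simp add: vec_eq_iff)
qed

lemma bilinear_d2G_entry: "bilinear (\<lambda>v w. d2G v w $ \<alpha> $ \<beta>)"
  using bilinear_second_derivative[OF twice, of \<alpha> \<beta>] by (simp add: d2G_def)

lemma linear_mform_d2G: "linear (\<lambda>v. mform (d2G v w) u u')"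
proof -
  have "linear (\<lambda>v. d2G v w $ \<alpha> $ \<beta>)" for \<alpha> \<beta>
    using bilinear_d2G_entry by (auto simp: bilinear_def)
  note l = linear_add[OF this] linear_scale[OF this]
  show ?thesis
    by (rule linearI) (simp_all add: mform_sum l distrib_right sum.distrib scaleR_right.sum[symmetric])
qed

lemma sum_conn_axis: "(\<Sum>j\<in>UNIV. v $ j *s conn (axis j 1) u) = conn v u"
proof -
  have lin: "linear (\<lambda>v. conn v u)" using bilinear_conn by (simp add: bilinear_def)
  have "conn v u = conn (\<Sum>j\<in>UNIV. v $ j *s axis j 1) u" by (simp add: basis_expansion)
  also have "\<dots> = (\<Sum>j\<in>UNIV. v $ j *s conn (axis j 1) u)"
    by (simp add: linear_sum[OF lin] conn_scale_left)
  finally show ?thesis by simp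
qed

lemma mform_sum_dchern:
  "(\<Sum>j\<in>UNIV. v $ j * mform (G a) (dchern j w *v \<xi>) \<xi>)
    = (mform (d2G v w) \<xi> \<xi> - \<i> * mform (d2G (\<i> *s v) w) \<xi> \<xi>) / 2 - mform (dG w) (conn v \<xi>) \<xi>"
proof -
  have "mform (G a) (dchern j w *v \<xi>) \<xi>
      = (mform (d2G (axis j 1) w) \<xi> \<xi> - \<i> * mform (d2G (axis j \<i>) w) \<xi> \<xi>) / 2 - mform (dG w) (conn (axis j 1) \<xi>) \<xi>" for j
  proof -
    have "mform (dG w) (conn (axis j 1) \<xi>) \<xi> + mform (G a) (dchern j w *v \<xi>) \<xi>
       = mform (dG w ** chern_form j a + G a ** dchern j w) \<xi> \<xi>"
      by (simp add: mform_matrix_add mform_mult chern_form_eq conn_def matrix_vector_mul_assoc)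
    also have "\<dots> = (mform (d2G (axis j 1) w) \<xi> \<xi> - \<i> * mform (d2G (axis j \<i>) w) \<xi> \<xi>) / 2"
      unfolding dchern_equation
      by (simp add: mform_sum sum_distrib_left sum_subtractf[symmetric] sum_divide_distrib)
        (intro sum.cong refl, simp add: field_simps)
    finally show ?thesis by (simp add: algebra_simps)
  qed
  then have "(\<Sum>j\<in>UNIV. v $ j * mform (G a) (dchern j w *v \<xi>) \<xi>)
     = (\<Sum>j\<in>UNIV. v $ j * ((mform (d2G (axis j 1) w) \<xi> \<xi> - \<i> * mform (d2G (axis j \<i>) w) \<xi> \<xi>) / 2))
       - (\<Sum>j\<in>UNIV. v $ j * mform (dG w) (conn (axis j 1) \<xi>) \<xi>)"
    by (simp add: right_diff_distrib sum_subtractf)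
  also have "(\<Sum>j\<in>UNIV. v $ j * mform (dG w) (conn (axis j 1) \<xi>) \<xi>) = mform (dG w) (conn v \<xi>) \<xi>"
    by (simp add: sum_conn_axis[of v, symmetric] mform_sum_left mform_scale_left)
  also note sum_wirtinger_linear[OF linear_mform_d2G]
  finally show ?thesis .
qed

lemma curv_entry:
  "curv v $ \<alpha> $ \<beta> = (\<Sum>j\<in>UNIV. v $ j * (- 1 / 2) * (dchern j v $ \<alpha> $ \<beta> + \<i> * dchern j (\<i> *s v) $ \<alpha> $ \<beta>))"
proof -
  have "(\<lambda>x. chern_form j x $ \<alpha> $ \<beta>) differentiable (at a)" for j
    using chern_form_has_derivative by (auto simp: differentiable_def)
  note * = sum_dzbar[OF this, of v]
  have "curv v $ \<alpha> $ \<beta> = (\<Sum>j\<in>UNIV. v $ j * (- (\<Sum>k\<in>UNIV. cnj (v $ k) * dzbar k (\<lambda>y. chern_form j y $ \<alpha> $ \<beta>) a)))"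
    by (simp add: curv_def sum_distrib_left sum_negf[symmetric] mult_ac)
  then show ?thesis unfolding * by (simp add: dchern_def)
qed

text \<open>
  Of the four terms that come from \<open>\<partial>\<^bsub>v\<^esub>\<close> and its conjugate applied to \<open>G\<close>, the two mixed ones
  carry a factor \<open>\<i>\<close> in front of a real number, because second derivatives of a Hermitian matrix
  field are Hermitian; they drop out of the real part. The first-order terms combine to the squared
  norm of \<open>conn v \<xi>\<close>.
\<close>

lemma curvature_identity:
  "Re (mform (G a) (curv v *v \<xi>) \<xi>) = Re (mform (G a) (conn v \<xi>) (conn v \<xi>))
     - (Re (mform (d2G v v) \<xi> \<xi>) + Re (mform (d2G (\<i> *s v) (\<i> *s v)) \<xi> \<xi>)) / 4"
proof -
  define S where "S w = (\<Sum>j\<in>UNIV. v $ j * mform (G a) (dchern j w *v \<xi>) \<xi>)" for w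
  define y where "y = conn v \<xi>"
  have "curv v *v \<xi> = (\<Sum>j\<in>UNIV. (v $ j * (- 1 / 2)) *s (dchern j v *v \<xi> + \<i> *s (dchern j (\<i> *s v) *v \<xi>)))"
  proof (rule vec_eq_iff[THEN iffD2], rule allI)
    fix \<alpha>
    have row: "(\<Sum>\<beta>\<in>UNIV. (A $ \<alpha> $ \<beta> + \<i> * B $ \<alpha> $ \<beta>) * \<xi> $ \<beta>) = (A *v \<xi> + \<i> *s (B *v \<xi>)) $ \<alpha>"
      for A B :: "complex^'k^'k"
      by (simp add: matrix_vector_mult_def sum_distrib_left sum.distrib distrib_right mult.assoc)
    have "(curv v *v \<xi>) $ \<alpha> = (\<Sum>\<beta>\<in>UNIV. \<Sum>j\<in>UNIV. v $ j * (- 1 / 2) * ((dchern j v $ \<alpha> $ \<beta> + \<i> * dchern j (\<i> *s v) $ \<alpha> $ \<beta>) * \<xi> $ \<beta>))"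
      unfolding matrix_vector_mult_def curv_entry by (simp only: vec_lambda_beta sum_distrib_right mult.assoc)
    also have "\<dots> = (\<Sum>j\<in>UNIV. \<Sum>\<beta>\<in>UNIV. v $ j * (- 1 / 2) * ((dchern j v $ \<alpha> $ \<beta> + \<i> * dchern j (\<i> *s v) $ \<alpha> $ \<beta>) * \<xi> $ \<beta>))"
      by (rule sum.swap)
    also have "\<dots> = (\<Sum>j\<in>UNIV. (v $ j * (- 1 / 2)) *s (dchern j v *v \<xi> + \<i> *s (dchern j (\<i> *s v) *v \<xi>))) $ \<alpha>"
      unfolding sum_component sum_distrib_left[symmetric] row by (simp only: vector_smult_component)
    finally show "(curv v *v \<xi>) $ \<alpha> = (\<Sum>j\<in>UNIV. (v $ j * (- 1 / 2)) *s (dchern j v *v \<xi> + \<i> *s (dchern j (\<i> *s v) *v \<xi>))) $ \<alpha>" .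
  qed
  then have "mform (G a) (curv v *v \<xi>) \<xi> = (\<Sum>j\<in>UNIV. v $ j * (- 1 / 2) * (mform (G a) (dchern j v *v \<xi>) \<xi> + \<i> * mform (G a) (dchern j (\<i> *s v) *v \<xi>) \<xi>))"
    by (simp only: mform_sum_left mform_scale_left mform_add_left)
  also have "\<dots> = - (S v + \<i> * S (\<i> *s v)) / 2"
    unfolding S_def sum_distrib_left sum.distrib[symmetric] sum_negf[symmetric] sum_divide_distrib
    by (intro sum.cong refl) (simp add: field_simps)
  finally have *: "mform (G a) (curv v *v \<xi>) \<xi> = - (S v + \<i> * S (\<i> *s v)) / 2" .
  have real: "Im (mform (d2G u w) \<xi> \<xi>) = 0" for u w
  proof -
    have "mform (d2G u w) \<xi> \<xi> = cnj (mform (d2G u w) \<xi> \<xi>)"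
      by (rule mform_hermitian) (rule d2G_hermitian)
    then show ?thesis by (metis cnj.simps(2) add.inverse_neutral neg_equal_zero)
  qed
  have P: "mform (partialG a (\<i> *s v)) u w = \<i> * mform (partialG a v) u w" for u w
    by (simp add: mform_sum partialG_i[OF a_in_U] sum_distrib_left mult.assoc)
  have "mform (partialG a v) \<xi> y = mform (G a) y y" by (simp add: y_def mform_conn)
  then have "mform (dG v) y \<xi> + \<i> * mform (dG (\<i> *s v)) y \<xi> = 2 * cnj (mform (G a) y y)"
    by (simp add: mform_dG P complex_eq_iff)
  then have Re_y: "Re (mform (dG v) y \<xi> + \<i> * mform (dG (\<i> *s v)) y \<xi>) = 2 * Re (mform (G a) y y)" by simp
  show ?thesis
    using Re_y real[of "\<i> *s v" v] real[of v "\<i> *s v"]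
    unfolding * S_def mform_sum_dchern y_def[symmetric] by (simp add: field_simps)
qed

end

section \<open>Comparison with the flat metric at a point\<close>

context hermitian_germ
begin

lemma taylor_G:
  assumes "e > 0"
  shows "\<forall>\<^sub>F z in nhds 0. entry_sum (G (a + z) - G a - dG z - (1/2) *\<^sub>R d2G z z) \<le> e * (norm z)\<^sup>2"
proof -
  \<comment> \<open>The number of matrix entries, over which the error is distributed.\<close>
  define N where "N = real CARD('k) * real CARD('k)"
  have N: "N > 0" by (simp add: N_def)
  let ?R = "\<lambda>z. G (a + z) - G a - dG z - (1/2) *\<^sub>R d2G z z"
  have "\<forall>\<^sub>F z in nhds 0. cmod (?R z $ \<alpha> $ \<beta>) \<le> e / N * (norm z)\<^sup>2" for \<alpha> \<beta>
    using taylor_second_order[OF twice[of \<alpha> \<beta>], of "e / N"] assms N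
    by (simp add: dG_def d2G_def eventually_nhds_metric dist_norm)
  then have "\<forall>\<^sub>F z in nhds 0. \<forall>\<alpha> \<beta>. cmod (?R z $ \<alpha> $ \<beta>) \<le> e / N * (norm z)\<^sup>2"
    by (intro eventually_all_finite)
  then show ?thesis
  proof (rule eventually_mono)
    fix z assume *: "\<forall>\<alpha> \<beta>. cmod (?R z $ \<alpha> $ \<beta>) \<le> e / N * (norm z)\<^sup>2"
    have "entry_sum (?R z) \<le> (\<Sum>\<alpha>\<in>(UNIV::'k set). \<Sum>\<beta>\<in>(UNIV::'k set). e / N * (norm z)\<^sup>2)"
      unfolding entry_sum_def by (intro sum_mono *[rule_format])
    also have "\<dots> = e * (norm z)\<^sup>2" using N by (simp add: N_def field_simps)
    finally show "entry_sum (?R z) \<le> e * (norm z)\<^sup>2" .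
  qed
qed

lemma coercive: "\<exists>m>0. \<forall>u. m * (norm u)\<^sup>2 \<le> Re (mform (G a) u u)"
proof -
  let ?N = "\<lambda>u. Re (mform (G a) u u)"
  have "continuous_on (sphere 0 1) ?N" by (intro continuous_intros)
  moreover have "axis undefined 1 \<in> sphere (0::complex^'k) 1" by simp
  ultimately have "\<exists>u0\<in>sphere 0 1. \<forall>u\<in>sphere 0 1. ?N u0 \<le> ?N u"
    by (intro continuous_attains_inf compact_sphere) (blast+)
  then obtain u0 where u0: "u0 \<in> sphere 0 1" "\<And>u. u \<in> sphere 0 1 \<Longrightarrow> ?N u0 \<le> ?N u" by blast
  have "?N u0 > 0" using u0(1) by (intro pos[OF a_in_U]) auto
  moreover have "?N u0 * (norm u)\<^sup>2 \<le> ?N u" for u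
  proof (cases "u = 0")
    case False
    define w where "w = inverse (norm u) *\<^sub>R u"
    have w: "norm w = 1" using False by (simp add: w_def)
    have u: "u = of_real (norm u) *s w"
      using False by (simp add: w_def scaleR_eq_vector_scalar[symmetric])
    have "?N u = (norm u)\<^sup>2 * ?N w"
      by (subst (1 2) u) (simp add: mform_scale_left mform_scale_right power2_eq_square)
    moreover have "(norm u)\<^sup>2 * ?N u0 \<le> (norm u)\<^sup>2 * ?N w" using u0(2)[of w] w by (intro mult_left_mono) auto
    ultimately show ?thesis by (simp add: mult.commute)
  qed simp
  ultimately show ?thesis by blast
qed

text \<open>
  Half of the coercivity constant survives by continuity. This is what turns square integrability
  with respect to \<open>h\<close> into integrability of the components of a section.
\<close>

lemma coercive_nearby:
  assumes m: "m > 0" "\<And>u. m * (norm u)\<^sup>2 \<le> Re (mform (G a) u u)"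
  shows "\<forall>\<^sub>F z in nhds 0. \<forall>u. m / 2 * (norm u)\<^sup>2 \<le> Re (mform (G (a + z)) u u)"
proof -
  have "((\<lambda>z. G (a + z) $ \<alpha> $ \<beta>) \<longlongrightarrow> G a $ \<alpha> $ \<beta>) (nhds 0)" for \<alpha> \<beta>
  proof (rule isCont_tendsto_compose[of a "\<lambda>x. G x $ \<alpha> $ \<beta>" "\<lambda>z. a + z"])
    show "isCont (\<lambda>x. G x $ \<alpha> $ \<beta>) a"
      using diff_G[OF a_in_U] by (rule differentiable_imp_continuous_within)
    show "((\<lambda>z. a + z) \<longlongrightarrow> a) (nhds 0)"
      using tendsto_add[OF tendsto_const[of a] filterlim_ident[of "nhds 0"]] by simp
  qed
  then have "((\<lambda>z. entry_sum (G (a + z) - G a)) \<longlongrightarrow> (\<Sum>\<alpha>\<in>(UNIV::'k set). \<Sum>\<beta>\<in>(UNIV::'k set). cmod (G a $ \<alpha> $ \<beta> - G a $ \<alpha> $ \<beta>))) (nhds 0)"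
    unfolding entry_sum_def vector_minus_component
    by (intro tendsto_sum tendsto_norm tendsto_diff tendsto_const)
  then have "\<forall>\<^sub>F z in nhds 0. entry_sum (G (a + z) - G a) < m / 2"
    using m(1) by (intro order_tendstoD(2)) auto
  then show ?thesis
  proof (rule eventually_mono, intro allI)
    fix z u assume z: "entry_sum (G (a + z) - G a) < m / 2"
    have "cmod (mform (G (a + z) - G a) u u) \<le> entry_sum (G (a + z) - G a) * (norm u)\<^sup>2"
      using norm_mform_le[of "G (a + z) - G a" u u] by (simp add: power2_eq_square mult.assoc)
    also have "\<dots> \<le> m / 2 * (norm u)\<^sup>2" using z by (intro mult_right_mono) auto
    finally have "- (m / 2 * (norm u)\<^sup>2) \<le> Re (mform (G (a + z) - G a) u u)"
      using abs_Re_le_cmod[of "mform (G (a + z) - G a) u u"] by linarith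
    then show "m / 2 * (norm u)\<^sup>2 \<le> Re (mform (G (a + z)) u u)"
      using m(2)[of u] by (simp add: mform_matrix_diff)
  qed
qed

lemma d2G_bound: "\<exists>K\<ge>0. \<forall>z. entry_sum (d2G z z) \<le> K * (norm z)\<^sup>2"
proof -
  have "\<exists>K. \<forall>v w. cmod (d2G v w $ \<alpha> $ \<beta>) \<le> K * norm v * norm w" for \<alpha> \<beta>
    using bilinear_bounded[OF bilinear_d2G_entry] by blast
  then obtain K where K: "\<And>\<alpha> \<beta> v w. cmod (d2G v w $ \<alpha> $ \<beta>) \<le> K \<alpha> \<beta> * norm v * norm w" by metis
  have "entry_sum (d2G z z) \<le> (\<Sum>\<alpha>\<in>UNIV. \<Sum>\<beta>\<in>UNIV. \<bar>K \<alpha> \<beta>\<bar>) * (norm z)\<^sup>2" for z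
    unfolding entry_sum_def sum_distrib_right
  proof (intro sum_mono)
    fix \<alpha> \<beta>
    have "cmod (d2G z z $ \<alpha> $ \<beta>) \<le> K \<alpha> \<beta> * (norm z)\<^sup>2" using K[of z z \<alpha> \<beta>] by (simp add: power2_eq_square mult.assoc)
    also have "\<dots> \<le> \<bar>K \<alpha> \<beta>\<bar> * (norm z)\<^sup>2" by (intro mult_right_mono) auto
    finally show "cmod (d2G z z $ \<alpha> $ \<beta>) \<le> \<bar>K \<alpha> \<beta>\<bar> * (norm z)\<^sup>2" .
  qed
  moreover have "0 \<le> (\<Sum>\<alpha>\<in>(UNIV::'k set). \<Sum>\<beta>\<in>(UNIV::'k set). \<bar>K \<alpha> \<beta>\<bar>)" by (simp add: sum_nonneg)
  ultimately show ?thesis by blast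
qed

text \<open>
  Minus the second-order part of \<open>G(a + z)(u, u) - G(a)(u + conn z u, u + conn z u)\<close> for the constant
  vector \<open>u = \<xi>\<close>.
\<close>

definition second_order_loss :: "complex^'k \<Rightarrow> complex^'n \<Rightarrow> real" where
  "second_order_loss \<xi> z = Re (mform (G a) (conn z \<xi>) (conn z \<xi>)) - Re (mform (d2G z z) \<xi> \<xi>) / 2"

text \<open>
  Rotation by \<open>\<i>\<close> reverses the sign of the part of \<open>d2G z z\<close> that is not of type (1,1). Only the
  curvature is left in the sum.
\<close>

lemma second_order_loss_rotate:
  "second_order_loss \<xi> z + second_order_loss \<xi> (\<i> *s z) = 2 * Re (mform (G a) (curv z *v \<xi>) \<xi>)"
  unfolding curvature_identity second_order_loss_def
  by (simp add: conn_scale_left mform_scale_left mform_scale_right field_simps)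

text \<open>
  The error made when the metric at \<open>a + z\<close> is replaced by the flat metric after the change of frame
  \<open>u \<mapsto> u + conn z u\<close>. It is kept as a sesquilinear form, since the cross terms in \<open>u = \<xi> + \<eta>\<close> have to
  be estimated.
\<close>

definition metric_error :: "complex^'n \<Rightarrow> complex^'k \<Rightarrow> complex^'k \<Rightarrow> complex" where
  "metric_error z u v = mform (G (a + z)) u v - mform (G a) (u + conn z u) (v + conn z v)"

lemma metric_error_add:
  "metric_error z (u + u') (u + u') = metric_error z u u + metric_error z u u' + metric_error z u' u + metric_error z u' u'"
  by (simp add: metric_error_def mform_add_left mform_add_right conn_add_right algebra_simps)

lemma metric_error_expand:
  "metric_error z u v = mform (G (a + z) - G a - dG z - (1/2) *\<^sub>R d2G z z) u v
     + mform (d2G z z) u v / 2 - mform (G a) (conn z u) (conn z v)"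
proof -
  have 1: "mform (G a) u (conn z v) = cnj (mform (partialG a z) v u)"
    by (subst mform_G_hermitian[OF a_in_U]) (simp add: mform_conn)
  have "mform (G a) (u + conn z u) (v + conn z v)
      = mform (G a) u v + mform (dG z) u v + mform (G a) (conn z u) (conn z v)"
    by (simp add: mform_add_left mform_add_right mform_dG mform_conn 1)
  then show ?thesis
    by (simp add: metric_error_def mform_matrix_diff mform_matrix_scaleR)
qed

text \<open>
  The change of frame removes the first-order terms of \<open>G\<close>, hence the error is quadratic in \<open>z\<close>.
\<close>

lemma metric_error_bounds:
  assumes "e > 0"
  shows "\<exists>C>0. \<forall>\<^sub>F z in nhds 0. \<forall>\<xi> \<eta>. \<bar>Re (metric_error z (\<xi> + \<eta>) (\<xi> + \<eta>)) + second_order_loss \<xi> z\<bar>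
    \<le> e * (norm z)\<^sup>2 * (norm \<xi>)\<^sup>2 + C * (norm z)\<^sup>2 * (2 * norm \<xi> * norm \<eta> + (norm \<eta>)\<^sup>2)"
proof -
  obtain b where b: "b > 0" "\<And>v u. norm (conn v u) \<le> b * norm v * norm u"
    using bilinear_bounded_pos[OF bilinear_conn] by blast
  obtain K where K: "K \<ge> 0" "\<And>z. entry_sum (d2G z z) \<le> K * (norm z)\<^sup>2" using d2G_bound by blast
  define M where "M = entry_sum (G a)"
  have M: "M \<ge> 0" by (simp add: M_def entry_sum_nonneg)
  define C where "C = e + K / 2 + M * b\<^sup>2"
  have "C > 0" using assms K(1) M by (simp add: C_def add_pos_nonneg)
  moreover have "\<forall>\<^sub>F z in nhds 0. \<forall>\<xi> \<eta>. \<bar>Re (metric_error z (\<xi> + \<eta>) (\<xi> + \<eta>)) + second_order_loss \<xi> z\<bar>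
    \<le> e * (norm z)\<^sup>2 * (norm \<xi>)\<^sup>2 + C * (norm z)\<^sup>2 * (2 * norm \<xi> * norm \<eta> + (norm \<eta>)\<^sup>2)"
    using taylor_G[OF assms]
  proof (rule eventually_mono, intro allI)
    fix z \<xi> \<eta>
    let ?R = "G (a + z) - G a - dG z - (1/2) *\<^sub>R d2G z z"
    assume R: "entry_sum ?R \<le> e * (norm z)\<^sup>2"
    have R': "cmod (mform ?R u v) \<le> e * (norm z)\<^sup>2 * norm u * norm v" for u v
      using norm_mform_le[of ?R u v] R
      by (meson dual_order.trans mult_right_mono norm_ge_zero)
    have D': "cmod (mform (d2G z z) u v / 2) \<le> K / 2 * (norm z)\<^sup>2 * norm u * norm v" for u v
    proof -
      have "cmod (mform (d2G z z) u v) \<le> K * (norm z)\<^sup>2 * norm u * norm v"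
        using norm_mform_le[of "d2G z z" u v] K(2)[of z]
        by (meson dual_order.trans mult_right_mono norm_ge_zero)
      then show ?thesis by (simp add: norm_divide)
    qed
    have B': "cmod (mform (G a) (conn z u) (conn z v)) \<le> M * b\<^sup>2 * (norm z)\<^sup>2 * norm u * norm v" for u v
    proof -
      have "cmod (mform (G a) (conn z u) (conn z v)) \<le> M * (norm (conn z u) * norm (conn z v))"
        using norm_mform_le[of "G a" "conn z u" "conn z v"] by (simp add: M_def mult.assoc)
      also have "\<dots> \<le> M * ((b * norm z * norm u) * (b * norm z * norm v))"
        using M b by (intro mult_left_mono mult_mono) auto
      finally show ?thesis by (simp add: power2_eq_square mult_ac)
    qed
    have E: "cmod (metric_error z u v) \<le> C * (norm z)\<^sup>2 * norm u * norm v" for u v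
    proof -
      have "cmod (metric_error z u v) \<le> cmod (mform ?R u v) + cmod (mform (d2G z z) u v / 2) + cmod (mform (G a) (conn z u) (conn z v))"
        unfolding metric_error_expand by (meson add_mono_thms_linordered_semiring(3) norm_triangle_ineq norm_triangle_ineq4 order_trans)
      also have "\<dots> \<le> e * (norm z)\<^sup>2 * norm u * norm v + K / 2 * (norm z)\<^sup>2 * norm u * norm v + M * b\<^sup>2 * (norm z)\<^sup>2 * norm u * norm v"
        by (intro add_mono R' D' B')
      finally show ?thesis by (simp add: C_def algebra_simps)
    qed
    have "\<bar>Re (metric_error z \<xi> \<xi>) + second_order_loss \<xi> z\<bar> \<le> e * (norm z)\<^sup>2 * (norm \<xi>)\<^sup>2"
    proof -
      have "Re (metric_error z \<xi> \<xi>) + second_order_loss \<xi> z = Re (mform ?R \<xi> \<xi>)"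
        by (simp add: metric_error_expand second_order_loss_def)
      with R'[of \<xi> \<xi>] abs_Re_le_cmod[of "mform ?R \<xi> \<xi>"] show ?thesis by (simp add: power2_eq_square mult.assoc)
    qed
    moreover have cross: "\<bar>Re (metric_error z u v)\<bar> \<le> C * (norm z)\<^sup>2 * norm u * norm v" for u v
      using E[of u v] abs_Re_le_cmod[of "metric_error z u v"] by linarith
    ultimately have "\<bar>Re (metric_error z (\<xi> + \<eta>) (\<xi> + \<eta>)) + second_order_loss \<xi> z\<bar>
      \<le> e * (norm z)\<^sup>2 * (norm \<xi>)\<^sup>2 + C * (norm z)\<^sup>2 * norm \<xi> * norm \<eta>
        + C * (norm z)\<^sup>2 * norm \<eta> * norm \<xi> + C * (norm z)\<^sup>2 * norm \<eta> * norm \<eta>"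
      using cross[of \<xi> \<eta>] cross[of \<eta> \<xi>] cross[of \<eta> \<eta>]
      unfolding metric_error_add plus_complex.simps by linarith
    then show "\<bar>Re (metric_error z (\<xi> + \<eta>) (\<xi> + \<eta>)) + second_order_loss \<xi> z\<bar>
      \<le> e * (norm z)\<^sup>2 * (norm \<xi>)\<^sup>2 + C * (norm z)\<^sup>2 * (2 * norm \<xi> * norm \<eta> + (norm \<eta>)\<^sup>2)"
      by (simp add: algebra_simps power2_eq_square)
  qed
  ultimately show ?thesis by blast
qed

lemma conn_diff_right: "conn z (u - w) = conn z u - conn z w"
  using conn_add_right[of z "u - w" w] by simp

text \<open>
  The squared norm of \<open>\<gamma>\<close> appears with a positive sign; it is the only term that can compensate for a large
  deviation of the section from \<open>\<xi>\<close>.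
\<close>

lemma metric_split:
  fixes u \<xi> z
  defines "\<gamma> \<equiv> u + conn z u - \<xi>"
  shows "Re (mform (G (a + z)) u u) = Re (mform (G a) \<xi> \<xi>) + 2 * Re (mform (G a) \<gamma> \<xi>)
     + Re (mform (G a) \<gamma> \<gamma>) + Re (metric_error z u u)"
proof -
  have "u + conn z u = \<xi> + \<gamma>" by (simp add: \<gamma>_def)
  then have "mform (G (a + z)) u u = mform (G a) (\<xi> + \<gamma>) (\<xi> + \<gamma>) + metric_error z u u"
    by (simp add: metric_error_def)
  moreover have "Re (mform (G a) \<xi> \<gamma>) = Re (mform (G a) \<gamma> \<xi>)"
    by (subst mform_G_hermitian[OF a_in_U]) simp
  ultimately show ?thesis by (simp add: mform_add_left mform_add_right)
qed

lemma young_bound: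
  fixes X Y t :: real
  assumes "t > 0"
  shows "2 * X * Y \<le> t * X\<^sup>2 + Y\<^sup>2 / t"
proof -
  have "0 \<le> (t * X - Y)\<^sup>2 / t" using assms by simp
  also have "\<dots> = t * X\<^sup>2 + Y\<^sup>2 / t - 2 * X * Y"
    using assms by (simp add: power2_diff power2_eq_square field_simps)
  finally show ?thesis by simp
qed

lemma eventually_nhds_norm_small:
  assumes "isCont f 0" "f 0 < (c::real)"
  shows "\<forall>\<^sub>F z in nhds (0::'z::real_normed_vector). f (norm z) \<le> c"
proof -
  have "((\<lambda>z::'z. f (norm z)) \<longlongrightarrow> f (norm (0::'z))) (nhds 0)"
    using isCont_tendsto_compose[of "norm (0::'z)" f norm "nhds 0"] assms(1)
      tendsto_norm[OF filterlim_ident[of "nhds (0::'z)"]] by simp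
  then have "\<forall>\<^sub>F z in nhds (0::'z). f (norm z) < c"
    using assms(2) by (intro order_tendstoD(2)) auto
  then show ?thesis by (rule eventually_mono) simp
qed

text \<open>
  Put \<open>\<eta> = u - \<xi>\<close> and \<open>\<gamma> = u + conn z u - \<xi>\<close>, so that \<open>|\<eta>| \<le> 2 |\<gamma>| + O(|z|) |\<xi>|\<close>. The cross
  terms of size \<open>|z|\<^sup>2 |\<xi>| |\<eta>|\<close> are split by Young's inequality into a small multiple of
  \<open>|z|\<^sup>2 |\<xi>|\<^sup>2\<close> and a multiple of \<open>|z|\<^sup>2 |\<eta>|\<^sup>2\<close>; for small \<open>z\<close> the latter is absorbed by
  \<open>G(a)(\<gamma>, \<gamma>)\<close>. The estimate is uniform in \<open>u\<close>, however large.
\<close>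

lemma pointwise_lower:
  assumes \<mu>: "\<mu> > 0"
  shows "\<forall>\<^sub>F z in nhds 0. \<forall>u \<xi>. Re (mform (G a) \<xi> \<xi>) + 2 * Re (mform (G a) (u + conn z u - \<xi>) \<xi>)
      - second_order_loss \<xi> z - \<mu> * (norm z)\<^sup>2 * (norm \<xi>)\<^sup>2 \<le> Re (mform (G (a + z)) u u)"
proof -
  define e where "e = \<mu> / 3"
  have e: "e > 0" using \<mu> by (simp add: e_def)
  obtain C where C: "C > 0" and err: "\<forall>\<^sub>F z in nhds 0. \<forall>\<xi> \<eta>. \<bar>Re (metric_error z (\<xi> + \<eta>) (\<xi> + \<eta>)) + second_order_loss \<xi> z\<bar>
     \<le> e * (norm z)\<^sup>2 * (norm \<xi>)\<^sup>2 + C * (norm z)\<^sup>2 * (2 * norm \<xi> * norm \<eta> + (norm \<eta>)\<^sup>2)"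
    using metric_error_bounds[OF e] by blast
  obtain b where b: "b > 0" "\<And>v u. norm (conn v u) \<le> b * norm v * norm u"
    using bilinear_bounded_pos[OF bilinear_conn] by blast
  obtain m where m: "m > 0" "\<And>u. m * (norm u)\<^sup>2 \<le> Re (mform (G a) u u)" using coercive by blast
  \<comment> \<open>The weight in Young's inequality, chosen so that its first half costs exactly \<open>e |z|\<^sup>2 |\<xi>|\<^sup>2\<close>.\<close>
  define t where "t = e / C"
  have t: "t > 0" "C * t = e" using e C by (auto simp: t_def)
  define L where "L = C * (1 + 1 / t)"
  have L: "L > 0" using C t by (simp add: L_def add_pos_pos)
  have "\<forall>\<^sub>F z in nhds (0::complex^'n). 8 * L * (norm z)\<^sup>2 \<le> m"
    by (rule eventually_nhds_norm_small[of "\<lambda>s. 8 * L * s\<^sup>2"]) (use m in auto)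
  moreover have "\<forall>\<^sub>F z in nhds (0::complex^'n). 8 * L * b\<^sup>2 * (norm z)\<^sup>2 \<le> e"
    by (rule eventually_nhds_norm_small[of "\<lambda>s. 8 * L * b\<^sup>2 * s\<^sup>2"]) (use e in auto)
  moreover have "\<forall>\<^sub>F z in nhds (0::complex^'n). b * norm z \<le> 1 / 2"
    by (rule eventually_nhds_norm_small[of "\<lambda>s. b * s"]) auto
  ultimately show ?thesis using err
  proof eventually_elim
    case (elim z)
    show ?case
    proof (intro allI)
      fix u \<xi> :: "complex^'k"
      define s X where "s = norm z" and "X = norm \<xi>"
      define \<eta> where "\<eta> = u - \<xi>"
      define \<gamma> where "\<gamma> = u + conn z u - \<xi>"
      define Y Z where "Y = norm \<eta>" and "Z = norm \<gamma>"
      have nonneg: "s \<ge> 0" "X \<ge> 0" "Y \<ge> 0" "Z \<ge> 0" by (simp_all add: s_def X_def Y_def Z_def)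
      have u: "u = \<xi> + \<eta>" by (simp add: \<eta>_def)
      have \<eta>: "\<eta> = \<gamma> - conn z \<eta> - conn z \<xi>" by (simp add: \<gamma>_def u conn_add_right)
      have "Y \<le> Z + norm (conn z \<eta>) + norm (conn z \<xi>)"
        using norm_triangle_ineq4[of "\<gamma> - conn z \<eta>" "conn z \<xi>"] norm_triangle_ineq4[of \<gamma> "conn z \<eta>"]
        unfolding Y_def Z_def \<eta>[symmetric] by linarith
      also have "\<dots> \<le> Z + b * s * Y + b * s * X" unfolding s_def Y_def X_def by (intro add_mono b order_refl)
      also have "\<dots> \<le> Z + 1/2 * Y + b * s * X"
        using elim(3) nonneg by (intro add_mono mult_right_mono order_refl) (auto simp: s_def)
      finally have "Y \<le> 2 * Z + 2 * b * s * X" by simp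
      then have "Y\<^sup>2 \<le> (2 * Z + 2 * b * s * X)\<^sup>2" using nonneg by (intro power_mono)
      also have "\<dots> \<le> 2 * (2 * Z)\<^sup>2 + 2 * (2 * b * s * X)\<^sup>2"
        using sum_squares_bound[of "2 * Z" "2 * b * s * X"] by (simp add: power2_sum)
      finally have Y2: "Y\<^sup>2 \<le> 8 * Z\<^sup>2 + 8 * b\<^sup>2 * s\<^sup>2 * X\<^sup>2" by (simp add: power_mult_distrib)
      have "C * (2 * X * Y + Y\<^sup>2) \<le> C * (t * X\<^sup>2 + Y\<^sup>2 / t + Y\<^sup>2)"
        using C young_bound[OF t(1), of X Y] by simp
      also have "\<dots> = e * X\<^sup>2 + L * Y\<^sup>2" using t(2) by (simp add: L_def algebra_simps)
      also have "\<dots> \<le> e * X\<^sup>2 + L * (8 * Z\<^sup>2 + 8 * b\<^sup>2 * s\<^sup>2 * X\<^sup>2)" using L Y2 by simp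
      also have "\<dots> = e * X\<^sup>2 + 8 * L * Z\<^sup>2 + (8 * L * b\<^sup>2 * s\<^sup>2) * X\<^sup>2" by (simp add: algebra_simps)
      also have "\<dots> \<le> e * X\<^sup>2 + 8 * L * Z\<^sup>2 + e * X\<^sup>2"
        using elim(2) by (intro add_mono mult_right_mono order_refl) (auto simp: s_def)
      finally have "s\<^sup>2 * (C * (2 * X * Y + Y\<^sup>2)) \<le> s\<^sup>2 * (2 * e * X\<^sup>2 + 8 * L * Z\<^sup>2)"
        by (intro mult_left_mono) auto
      also have "\<dots> = 2 * e * s\<^sup>2 * X\<^sup>2 + (8 * L * s\<^sup>2) * Z\<^sup>2" by (simp add: algebra_simps)
      also have "\<dots> \<le> 2 * e * s\<^sup>2 * X\<^sup>2 + m * Z\<^sup>2"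
        using elim(1) by (intro add_mono mult_right_mono order_refl) (auto simp: s_def)
      finally have core: "C * s\<^sup>2 * (2 * X * Y + Y\<^sup>2) \<le> 2 * e * s\<^sup>2 * X\<^sup>2 + m * Z\<^sup>2" by (simp add: mult_ac)
      have "\<bar>Re (metric_error z u u) + second_order_loss \<xi> z\<bar> \<le> e * s\<^sup>2 * X\<^sup>2 + C * s\<^sup>2 * (2 * X * Y + Y\<^sup>2)"
        using elim(4) unfolding u s_def X_def Y_def by blast
      moreover have "m * Z\<^sup>2 \<le> Re (mform (G a) \<gamma> \<gamma>)" unfolding Z_def by (rule m)
      moreover have "e * s\<^sup>2 * X\<^sup>2 + 2 * e * s\<^sup>2 * X\<^sup>2 = \<mu> * s\<^sup>2 * X\<^sup>2" by (simp add: e_def)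
      ultimately show "Re (mform (G a) \<xi> \<xi>) + 2 * Re (mform (G a) (u + conn z u - \<xi>) \<xi>)
          - second_order_loss \<xi> z - \<mu> * (norm z)\<^sup>2 * (norm \<xi>)\<^sup>2 \<le> Re (mform (G (a + z)) u u)"
        using core metric_split[of z u \<xi>] unfolding \<gamma>_def[symmetric] s_def[symmetric] X_def[symmetric] by linarith
    qed
  qed
qed

text \<open>
  The competitor \<open>\<xi> - conn z \<xi>\<close> is \<open>\<xi>\<close> in the flattened frame up to the holomorphic error
  \<open>- conn z (conn z \<xi>)\<close> of second order. Its squared norm is of fourth order, and its product with
  \<open>\<xi>\<close> has mean zero.
\<close>

lemma pointwise_upper:
  assumes \<mu>: "\<mu> > 0"
  shows "\<forall>\<^sub>F z in nhds 0. \<forall>\<xi>. Re (mform (G (a + z)) (\<xi> - conn z \<xi>) (\<xi> - conn z \<xi>))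
     \<le> Re (mform (G a) \<xi> \<xi>) + 2 * Re (mform (G a) (- conn z (conn z \<xi>)) \<xi>)
      - second_order_loss \<xi> z + \<mu> * (norm z)\<^sup>2 * (norm \<xi>)\<^sup>2"
proof -
  define e where "e = \<mu> / 3"
  have e: "e > 0" using \<mu> by (simp add: e_def)
  obtain C where C: "C > 0" and err: "\<forall>\<^sub>F z in nhds 0. \<forall>\<xi> \<eta>. \<bar>Re (metric_error z (\<xi> + \<eta>) (\<xi> + \<eta>)) + second_order_loss \<xi> z\<bar>
     \<le> e * (norm z)\<^sup>2 * (norm \<xi>)\<^sup>2 + C * (norm z)\<^sup>2 * (2 * norm \<xi> * norm \<eta> + (norm \<eta>)\<^sup>2)"
    using metric_error_bounds[OF e] by blast
  obtain b where b: "b > 0" "\<And>v u. norm (conn v u) \<le> b * norm v * norm u"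
    using bilinear_bounded_pos[OF bilinear_conn] by blast
  define M where "M = entry_sum (G a)"
  have M: "M \<ge> 0" by (simp add: M_def entry_sum_nonneg)
  have "\<forall>\<^sub>F z in nhds (0::complex^'n). C * (2 * b * norm z + b\<^sup>2 * (norm z)\<^sup>2) \<le> e"
    by (rule eventually_nhds_norm_small[of "\<lambda>s. C * (2 * b * s + b\<^sup>2 * s\<^sup>2)"]) (use e in auto)
  moreover have "\<forall>\<^sub>F z in nhds (0::complex^'n). M * b ^ 4 * (norm z)\<^sup>2 \<le> e"
    by (rule eventually_nhds_norm_small[of "\<lambda>s. M * b ^ 4 * s\<^sup>2"]) (use e in auto)
  ultimately show ?thesis using err
  proof eventually_elim
    case (elim z)
    show ?case
    proof (intro allI)
      fix \<xi> :: "complex^'k"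
      define u \<eta> \<gamma> where "u = \<xi> - conn z \<xi>" and "\<eta> = - conn z \<xi>" and "\<gamma> = - conn z (conn z \<xi>)"
      define s X Y where "s = norm z" and "X = norm \<xi>" and "Y = norm \<eta>"
      have nonneg: "s \<ge> 0" "X \<ge> 0" "Y \<ge> 0" by (simp_all add: s_def X_def Y_def)
      have u: "u = \<xi> + \<eta>" by (simp add: u_def \<eta>_def)
      have \<gamma>: "u + conn z u - \<xi> = \<gamma>" by (simp add: u_def \<gamma>_def conn_diff_right)
      have Y: "Y \<le> b * s * X" unfolding Y_def \<eta>_def s_def X_def by (simp add: b)
      have "norm \<gamma> \<le> b * s * Y" unfolding Y_def \<eta>_def \<gamma>_def s_def by (simp add: b)
      also have "\<dots> \<le> b * s * (b * s * X)" using Y b nonneg by (intro mult_left_mono) auto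
      finally have "(norm \<gamma>)\<^sup>2 \<le> (b * s * (b * s * X))\<^sup>2" by (intro power_mono) auto
      also have "\<dots> = b ^ 4 * s\<^sup>2 * (s\<^sup>2 * X\<^sup>2)" by (simp add: power2_eq_square power4_eq_xxxx)
      finally have "M * (norm \<gamma>)\<^sup>2 \<le> M * (b ^ 4 * s\<^sup>2 * (s\<^sup>2 * X\<^sup>2))" using M by (rule mult_left_mono)
      also have "\<dots> = (M * b ^ 4 * s\<^sup>2) * (s\<^sup>2 * X\<^sup>2)" by simp
      also have "\<dots> \<le> e * (s\<^sup>2 * X\<^sup>2)" using elim(2) by (intro mult_right_mono) (auto simp: s_def)
      finally have \<gamma>_bound: "M * (norm \<gamma>)\<^sup>2 \<le> e * s\<^sup>2 * X\<^sup>2" by simp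
      have "Re (mform (G a) \<gamma> \<gamma>) \<le> M * (norm \<gamma>)\<^sup>2"
        using norm_mform_le[of "G a" \<gamma> \<gamma>] complex_Re_le_cmod[of "mform (G a) \<gamma> \<gamma>"]
        by (simp add: M_def power2_eq_square mult.assoc)
      with \<gamma>_bound have N\<gamma>: "Re (mform (G a) \<gamma> \<gamma>) \<le> e * s\<^sup>2 * X\<^sup>2" by simp
      have "C * (2 * X * Y + Y\<^sup>2) \<le> C * (2 * X * (b * s * X) + (b * s * X)\<^sup>2)"
        using C Y nonneg by (intro mult_left_mono add_mono power_mono) auto
      also have "\<dots> = (C * (2 * b * s + b\<^sup>2 * s\<^sup>2)) * X\<^sup>2" by (simp add: power2_eq_square algebra_simps)
      also have "\<dots> \<le> e * X\<^sup>2" using elim(1) by (intro mult_right_mono) (auto simp: s_def)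
      finally have "s\<^sup>2 * (C * (2 * X * Y + Y\<^sup>2)) \<le> s\<^sup>2 * (e * X\<^sup>2)" by (intro mult_left_mono) auto
      then have core: "C * s\<^sup>2 * (2 * X * Y + Y\<^sup>2) \<le> e * s\<^sup>2 * X\<^sup>2" by (simp add: mult_ac)
      have "\<bar>Re (metric_error z u u) + second_order_loss \<xi> z\<bar> \<le> e * s\<^sup>2 * X\<^sup>2 + C * s\<^sup>2 * (2 * X * Y + Y\<^sup>2)"
        using elim(3) unfolding u s_def X_def Y_def by blast
      moreover have "e * s\<^sup>2 * X\<^sup>2 + e * s\<^sup>2 * X\<^sup>2 + e * s\<^sup>2 * X\<^sup>2 = \<mu> * s\<^sup>2 * X\<^sup>2" by (simp add: e_def)
      ultimately show "Re (mform (G (a + z)) (\<xi> - conn z \<xi>) (\<xi> - conn z \<xi>))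
         \<le> Re (mform (G a) \<xi> \<xi>) + 2 * Re (mform (G a) (- conn z (conn z \<xi>)) \<xi>)
          - second_order_loss \<xi> z + \<mu> * (norm z)\<^sup>2 * (norm \<xi>)\<^sup>2"
        using core N\<gamma> metric_split[of z u \<xi>]
        unfolding \<gamma> u_def[symmetric] \<gamma>_def[symmetric] s_def[symmetric] X_def[symmetric] by linarith
    qed
  qed
qed

text \<open>
  The pointwise estimates at \<open>a + z\<close>, in the form in which they are integrated: \<open>|\<xi>|\<^sup>2\<close> is measured by
  \<open>G a\<close>.
\<close>

definition controlled_at :: "real \<Rightarrow> real \<Rightarrow> complex^'n \<Rightarrow> bool" where
  "controlled_at \<mu> m z \<longleftrightarrow> a + z \<in> U \<and>
    (\<forall>u. m * (norm u)\<^sup>2 \<le> Re (mform (G (a + z)) u u)) \<and>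
    (\<forall>u \<xi>. Re (mform (G a) \<xi> \<xi>) + 2 * Re (mform (G a) (u + conn z u - \<xi>) \<xi>)
      - second_order_loss \<xi> z - \<mu> * Re (mform (G a) \<xi> \<xi>) * (norm z)\<^sup>2 \<le> Re (mform (G (a + z)) u u)) \<and>
    (\<forall>\<xi>. Re (mform (G (a + z)) (\<xi> - conn z \<xi>) (\<xi> - conn z \<xi>))
      \<le> Re (mform (G a) \<xi> \<xi>) + 2 * Re (mform (G a) (- conn z (conn z \<xi>)) \<xi>)
        - second_order_loss \<xi> z + \<mu> * Re (mform (G a) \<xi> \<xi>) * (norm z)\<^sup>2)"

lemma eventually_controlled:
  assumes "\<mu> > 0"
  shows "\<exists>m>0. \<forall>\<^sub>F z in nhds 0. controlled_at \<mu> m z"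
proof -
  obtain m where m: "m > 0" "\<And>u. m * (norm u)\<^sup>2 \<le> Re (mform (G a) u u)" using coercive by blast
  have \<mu>: "\<mu> * m > 0" using assms m(1) by simp
  have absorb: "\<mu> * m * (norm z)\<^sup>2 * (norm \<xi>)\<^sup>2 \<le> \<mu> * Re (mform (G a) \<xi> \<xi>) * (norm z)\<^sup>2" for z :: "complex^'n" and \<xi>
  proof -
    have "(\<mu> * (norm z)\<^sup>2) * (m * (norm \<xi>)\<^sup>2) \<le> (\<mu> * (norm z)\<^sup>2) * Re (mform (G a) \<xi> \<xi>)"
      using assms m(2) by (intro mult_left_mono) auto
    then show ?thesis by (simp add: mult_ac)
  qed
  have "((\<lambda>z. a + z) \<longlongrightarrow> a) (nhds 0)"
    using tendsto_add[OF tendsto_const[of a] filterlim_ident[of "nhds 0"]] by simp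
  then have "\<forall>\<^sub>F z in nhds 0. a + z \<in> U" using open_U a_in_U by (rule topological_tendstoD)
  then have "\<forall>\<^sub>F z in nhds 0. controlled_at \<mu> (m / 2) z"
    using coercive_nearby[OF m] pointwise_lower[OF \<mu>] pointwise_upper[OF \<mu>]
  proof eventually_elim
    case (elim z)
    show ?case
      unfolding controlled_at_def
    proof (intro conjI allI)
      fix u \<xi>
      show "Re (mform (G a) \<xi> \<xi>) + 2 * Re (mform (G a) (u + conn z u - \<xi>) \<xi>)
        - second_order_loss \<xi> z - \<mu> * Re (mform (G a) \<xi> \<xi>) * (norm z)\<^sup>2 \<le> Re (mform (G (a + z)) u u)"
        using elim(3)[rule_format, of \<xi> u] absorb[of z \<xi>] by linarith
    next
      fix \<xi>
      show "Re (mform (G (a + z)) (\<xi> - conn z \<xi>) (\<xi> - conn z \<xi>))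
        \<le> Re (mform (G a) \<xi> \<xi>) + 2 * Re (mform (G a) (- conn z (conn z \<xi>)) \<xi>)
          - second_order_loss \<xi> z + \<mu> * Re (mform (G a) \<xi> \<xi>) * (norm z)\<^sup>2"
        using elim(4)[rule_format, of \<xi>] absorb[of z \<xi>] by linarith
    qed (use elim in auto)
  qed
  moreover have "m / 2 > 0" using m by simp
  ultimately show ?thesis by blast
qed

end

section \<open>Holomorphic functions of several variables\<close>

lemma holomorphic_fun_const: "holomorphic_fun S (\<lambda>_. c)"
  unfolding holomorphic_fun_def by (intro ballI exI[of _ "\<lambda>_. 0"]) auto

lemma holomorphic_fun_add:
  assumes "holomorphic_fun S f" "holomorphic_fun S g"
  shows "holomorphic_fun S (\<lambda>x. f x + g x)"
  unfolding holomorphic_fun_def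
proof
  fix x assume "x \<in> S"
  then obtain D D' where "(f has_derivative D) (at x)" "\<And>c v. D (c *s v) = c * D v"
    "(g has_derivative D') (at x)" "\<And>c v. D' (c *s v) = c * D' v"
    using assms unfolding holomorphic_fun_def by blast
  then show "\<exists>D. ((\<lambda>x. f x + g x) has_derivative D) (at x) \<and> (\<forall>c v. D (c *s v) = c * D v)"
    by (intro exI[of _ "\<lambda>v. D v + D' v"] conjI has_derivative_add) (simp_all add: algebra_simps)
qed

lemma holomorphic_fun_mult:
  assumes "holomorphic_fun S f" "holomorphic_fun S g"
  shows "holomorphic_fun S (\<lambda>x. f x * g x)"
  unfolding holomorphic_fun_def
proof
  fix x assume "x \<in> S"
  then obtain D D' where "(f has_derivative D) (at x)" "\<And>c v. D (c *s v) = c * D v"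
    "(g has_derivative D') (at x)" "\<And>c v. D' (c *s v) = c * D' v"
    using assms unfolding holomorphic_fun_def by blast
  then show "\<exists>D. ((\<lambda>x. f x * g x) has_derivative D) (at x) \<and> (\<forall>c v. D (c *s v) = c * D v)"
    by (intro exI[of _ "\<lambda>v. f x * D' v + D v * g x"] conjI has_derivative_mult) (simp_all add: algebra_simps)
qed

lemma holomorphic_fun_sum:
  "(\<And>i. i \<in> I \<Longrightarrow> holomorphic_fun S (f i)) \<Longrightarrow> holomorphic_fun S (\<lambda>x. \<Sum>i\<in>I. f i x)"
  by (induction I rule: infinite_finite_induct) (auto intro: holomorphic_fun_const holomorphic_fun_add)

lemma holomorphic_fun_subset: "holomorphic_fun S f \<Longrightarrow> T \<subseteq> S \<Longrightarrow> holomorphic_fun T f"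
  unfolding holomorphic_fun_def by blast

lemma holomorphic_fun_cong:
  assumes "holomorphic_fun S f" "open S" "\<And>x. x \<in> S \<Longrightarrow> f x = g x"
  shows "holomorphic_fun S g"
  unfolding holomorphic_fun_def
proof
  fix x assume x: "x \<in> S"
  then obtain D where D: "(f has_derivative D) (at x)" "\<forall>c v. D (c *s v) = c * D v"
    using assms(1) unfolding holomorphic_fun_def by blast
  then show "\<exists>D. (g has_derivative D) (at x) \<and> (\<forall>c v. D (c *s v) = c * D v)"
    using has_derivative_transform_within_open[OF D(1) assms(2) x assms(3)] by blast
qed

lemma holomorphic_fun_linear:
  assumes "\<And>x y. f (x + y) = f x + f y" "\<And>c x. f (c *s x) = c * f x"
  shows "holomorphic_fun S f"
proof -
  have "linear f"
    by (rule linearI) (simp_all add: assms scaleR_eq_vector_scalar, simp add: scaleR_conv_of_real)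
  then have "bounded_linear f" by (rule linear_conv_bounded_linear[THEN iffD1])
  then show ?thesis
    unfolding holomorphic_fun_def
    by (intro ballI exI[of _ f]) (auto intro: bounded_linear_imp_has_derivative assms)
qed

lemma holomorphic_fun_translate:
  assumes "holomorphic_fun S f"
  shows "holomorphic_fun {z. b + z \<in> S} (\<lambda>z. f (b + z))"
  unfolding holomorphic_fun_def
proof safe
  fix z assume "b + z \<in> S"
  then obtain D where D: "(f has_derivative D) (at (b + z))" "\<forall>c v. D (c *s v) = c * D v"
    using assms unfolding holomorphic_fun_def by blast
  have "((\<lambda>z. b + z) has_derivative (\<lambda>h. h)) (at z)" by (auto intro!: derivative_eq_intros)
  from diff_chain_at[OF this D(1)] D(2)
  show "\<exists>D. ((\<lambda>z. f (b + z)) has_derivative D) (at z) \<and> (\<forall>c v. D (c *s v) = c * D v)"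
    by (auto simp: o_def)
qed

section \<open>Comparison of integrals over balanced domains\<close>

lemma set_integrable_bounded_continuous:
  fixes F :: "'a::euclidean_space \<Rightarrow> 'b::euclidean_space"
  assumes "open P" "bounded P" "continuous_on UNIV F"
  shows "set_integrable lborel P F" "\<exists>B. \<forall>z\<in>P. norm (F z) \<le> B"
proof -
  have "compact (F ` closure P)"
    using assms by (intro compact_continuous_image) (auto intro: continuous_on_subset)
  then have "bounded (F ` closure P)" by (rule compact_imp_bounded)
  then obtain B where B: "\<And>z. z \<in> P \<Longrightarrow> norm (F z) \<le> B"
    using closure_subset[of P] unfolding bounded_iff by blast
  then show "\<exists>B. \<forall>z\<in>P. norm (F z) \<le> B" by blast
  show "set_integrable lborel P F"
    using assms B emeasure_bounded_finite[of P]
    by (intro set_integrable_continuous_bounded[of P F B]) (auto intro: continuous_on_subset)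
qed

context hermitian_germ
begin

lemma linear_conn_left: "linear (\<lambda>z. conn z u)"
  using bilinear_conn by (simp add: bilinear_def)

lemma continuous_on_conn [continuous_intros]:
  assumes "continuous_on S f" "continuous_on S g"
  shows "continuous_on S (\<lambda>x. conn (f x) (g x))"
  using bilinear_conn[unfolded bilinear_conv_bounded_bilinear] assms
  by (rule bounded_bilinear.continuous_on)

lemma continuous_on_second_order_loss: "continuous_on S (second_order_loss \<xi>)"
proof -
  have "continuous_on S (\<lambda>z. d2G z z $ \<alpha> $ \<beta>)" for \<alpha> \<beta>
    using bilinear_d2G_entry[unfolded bilinear_conv_bounded_bilinear] continuous_on_id continuous_on_id
    by (rule bounded_bilinear.continuous_on)
  then have "continuous_on S (\<lambda>z. mform (d2G z z) \<xi> \<xi>)"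
    by (intro continuous_on_mform continuous_on_const)
  then have "continuous_on S (\<lambda>z. Re (mform (d2G z z) \<xi> \<xi>) / 2)"
    by (intro continuous_on_divide continuous_on_Re continuous_on_const) auto
  moreover have "continuous_on S (\<lambda>z. Re (mform (G a) (conn z \<xi>) (conn z \<xi>)))"
    by (intro continuous_intros)
  ultimately show ?thesis unfolding second_order_loss_def[abs_def] by (intro continuous_on_diff)
qed

definition curvature_loss :: "complex^'k \<Rightarrow> complex^'n \<Rightarrow> real" where
  "curvature_loss \<xi> z = Re (mform (G a) (curv z *v \<xi>) \<xi>)"

lemma curvature_loss_eq: "curvature_loss \<xi> z = (second_order_loss \<xi> z + second_order_loss \<xi> (\<i> *s z)) / 2"
  by (simp add: second_order_loss_rotate curvature_loss_def)

lemma continuous_on_curvature_loss: "continuous_on S (curvature_loss \<xi>)"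
  unfolding curvature_loss_eq[abs_def]
  by (intro continuous_intros continuous_on_second_order_loss
      continuous_on_compose2[OF continuous_on_second_order_loss[of UNIV]]) auto

text \<open>
  Averaging the integrand over the rotation \<open>z \<mapsto> \<i> z\<close>, which preserves volume and domain.
\<close>

lemma set_integral_second_order_loss:
  assumes P: "open P" "complex_balanced P" "bounded P"
  shows "(LINT z:P|lborel. second_order_loss \<xi> z) = (LINT z:P|lborel. curvature_loss \<xi> z)"
proof -
  let ?l = "second_order_loss \<xi>"
  have rot: "(LINT z:P|lborel. ?l z) = (LINT z:P|lborel. ?l (\<i> *s z))"
    using set_integral_orthogonal(1)[OF orthogonal_transformation_phase P(1) continuous_on_second_order_loss, of \<i> \<xi>]
      complex_balanced_phase_vimage[OF P(2), of \<i>] by simp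
  have i1: "set_integrable lborel P ?l"
    by (rule set_integrable_bounded_continuous[OF P(1,3) continuous_on_second_order_loss])
  have i2: "set_integrable lborel P (\<lambda>z. ?l (\<i> *s z))"
    by (rule set_integrable_bounded_continuous[OF P(1,3)])
      (intro continuous_on_compose2[OF continuous_on_second_order_loss[of UNIV]] continuous_intros, auto)
  have "(LINT z:P|lborel. ?l z + ?l (\<i> *s z)) = 2 * (LINT z:P|lborel. ?l z)"
    using set_integral_add(2)[OF i1 i2] rot by simp
  then have "(LINT z:P|lborel. ?l z) = (LINT z:P|lborel. ?l z + ?l (\<i> *s z)) / 2" by simp
  also have "\<dots> = (LINT z:P|lborel. curvature_loss \<xi> z)"
    unfolding curvature_loss_eq[abs_def] by simp
  finally show ?thesis .
qed

lemma holomorphic_fun_mform: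
  assumes "\<And>\<beta>. holomorphic_fun P (\<lambda>z. g z $ \<beta>)"
  shows "holomorphic_fun P (\<lambda>z. mform M (g z) w)"
  unfolding mform_sum
  by (intro holomorphic_fun_sum holomorphic_fun_mult holomorphic_fun_const assms)

lemma holomorphic_fun_conn:
  assumes "\<And>\<beta>. holomorphic_fun P (\<lambda>z. g z $ \<beta>)"
  shows "holomorphic_fun P (\<lambda>z. conn z (g z) $ \<alpha>)"
proof -
  have expand: "conn z u $ \<alpha> = (\<Sum>\<beta>\<in>UNIV. u $ \<beta> * conn z (axis \<beta> 1) $ \<alpha>)" for z u
  proof -
    have "conn z u = conn z (\<Sum>\<beta>\<in>UNIV. u $ \<beta> *s axis \<beta> 1)" by (simp add: basis_expansion)
    also have "\<dots> = (\<Sum>\<beta>\<in>UNIV. u $ \<beta> *s conn z (axis \<beta> 1))"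
      using bilinear_conn by (simp add: bilinear_def linear_sum conn_scale_right)
    finally show ?thesis by simp
  qed
  have "holomorphic_fun P (\<lambda>z. \<Sum>\<beta>\<in>UNIV. g z $ \<beta> * conn z (axis \<beta> 1) $ \<alpha>)"
    by (intro holomorphic_fun_sum holomorphic_fun_mult assms holomorphic_fun_linear)
      (simp_all add: conn_add_left conn_scale_left)
  moreover have "(\<lambda>z. conn z (g z) $ \<alpha>) = (\<lambda>z. \<Sum>\<beta>\<in>UNIV. g z $ \<beta> * conn z (axis \<beta> 1) $ \<alpha>)"
    by (rule ext) (rule expand)
  ultimately show ?thesis by (simp only:)
qed

lemma set_integral_mean_value_Re:
  assumes P: "open P" "complex_balanced P" "bounded P"
    and g: "holomorphic_fun P g" "set_integrable lborel P g" "g 0 = 0"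
  shows "(LINT z:P|lborel. Re (g z)) = 0" "set_integrable lborel P (\<lambda>z. Re (g z))"
proof -
  have "integrable lborel (\<lambda>z. indicator P z *\<^sub>R g z)" using g(2) by (simp add: set_integrable_def)
  from integral_Re[OF this] integrable_Re[OF this]
  show "(LINT z:P|lborel. Re (g z)) = 0" "set_integrable lborel P (\<lambda>z. Re (g z))"
    using set_integral_mean_value[OF g(1) P(1,2) emeasure_bounded_finite[OF P(3)] g(2)] g(3)
    by (simp_all add: set_lebesgue_integral_def set_integrable_def)
qed

text \<open>
  The function with which the densities of sections are compared: the holomorphic term integrates
  to zero, and the second-order loss integrates to the curvature.
\<close>

lemma set_integral_comparison:
  assumes P: "open P" "complex_balanced P" "bounded P"
    and k: "holomorphic_fun P k" "set_integrable lborel P k" "k 0 = 0"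
  shows "set_integrable lborel P (\<lambda>z. c + 2 * Re (k z) - second_order_loss \<xi> z + q * (norm z)\<^sup>2)"
    and "(LINT z:P|lborel. c + 2 * Re (k z) - second_order_loss \<xi> z + q * (norm z)\<^sup>2)
      = measure lborel P * c - (LINT z:P|lborel. curvature_loss \<xi> z) + q * (LINT z:P|lborel. (norm z)\<^sup>2)"
proof -
  note Rek = set_integral_mean_value_Re[OF P k]
  note int = set_integrable_bounded_continuous(1)[OF P(1,3)]
  have ic: "set_integrable lborel P (\<lambda>_. c)" by (intro int continuous_intros)
  have il: "set_integrable lborel P (second_order_loss \<xi>)" by (intro int continuous_on_second_order_loss)
  have iz: "set_integrable lborel P (\<lambda>z. q * (norm z)\<^sup>2)" by (intro int continuous_intros)
  have i2: "set_integrable lborel P (\<lambda>z. 2 * Re (k z))" using Rek(2) by simp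
  note i12 = set_integral_add[OF ic i2]
  note i123 = set_integral_diff[OF i12(1) il]
  note i1234 = set_integral_add[OF i123(1) iz]
  show "set_integrable lborel P (\<lambda>z. c + 2 * Re (k z) - second_order_loss \<xi> z + q * (norm z)\<^sup>2)"
    by (rule i1234(1))
  have const: "(LINT z:P|lborel. c) = measure lborel P * c"
    using emeasure_bounded_finite[OF P(3)] P(1) by (simp add: set_lebesgue_integral_def)
  show "(LINT z:P|lborel. c + 2 * Re (k z) - second_order_loss \<xi> z + q * (norm z)\<^sup>2)
      = measure lborel P * c - (LINT z:P|lborel. curvature_loss \<xi> z) + q * (LINT z:P|lborel. (norm z)\<^sup>2)"
    unfolding i1234(2) i123(2) i12(2) const set_integral_second_order_loss[OF P, symmetric]
    using Rek(1) by simp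
qed

text \<open>
  The cross term is the real part of a holomorphic function that vanishes at the centre. It is
  integrable because \<open>|f| \<le> 1 + |f|\<^sup>2\<close> and \<open>|f|\<^sup>2\<close> is bounded by a multiple of the density \<open>N\<close>; so its
  integral is zero by the mean value property.
\<close>

lemma lower_integral:
  fixes f :: "complex^'n \<Rightarrow> complex^'k"
  defines "N \<equiv> \<lambda>z. Re (mform (G (a + z)) (f z) (f z))"
  assumes P: "open P" "complex_balanced P" "bounded P"
    and m: "m > 0" and ctrl: "\<And>z. z \<in> P \<Longrightarrow> controlled_at \<mu> m z"
    and f: "\<And>\<beta>. holomorphic_fun P (\<lambda>z. f z $ \<beta>)" "f 0 = \<xi>"
    and int: "set_integrable lborel P N"
  shows "measure lborel P * Re (mform (G a) \<xi> \<xi>) - (LINT z:P|lborel. curvature_loss \<xi> z)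
     - \<mu> * Re (mform (G a) \<xi> \<xi>) * (LINT z:P|lborel. (norm z)\<^sup>2) \<le> (LINT z:P|lborel. N z)"
proof -
  let ?c = "Re (mform (G a) \<xi> \<xi>)"
  define k where "k z = mform (G a) (f z + conn z (f z) - \<xi>) \<xi>" for z
  have k_eq: "k z = mform (G a) (f z) \<xi> + mform (G a) (conn z (f z)) \<xi> + - mform (G a) \<xi> \<xi>" for z
    by (simp add: k_def mform_diff_left mform_add_left)
  have k_holo: "holomorphic_fun P k"
    unfolding k_eq[abs_def]
    by (intro holomorphic_fun_add holomorphic_fun_const holomorphic_fun_mform holomorphic_fun_conn f)
  have "conn 0 u = 0" for u using linear_0[OF linear_conn_left] by simp
  then have k0: "k 0 = 0" by (simp add: k_def f(2))
  obtain b where b: "b > 0" "\<And>v u. norm (conn v u) \<le> b * norm v * norm u"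
    using bilinear_bounded_pos[OF bilinear_conn] by blast
  obtain R where R: "R > 0" "\<And>z. z \<in> P \<Longrightarrow> norm z \<le> R" using P(3) by (auto simp: bounded_pos)
  define M where "M = entry_sum (G a) * norm \<xi>"
  have M: "M \<ge> 0" by (simp add: M_def entry_sum_nonneg)
  have k_bound: "cmod (k z) \<le> M * (1 + b * R + norm \<xi>) + M * (1 + b * R) / m * N z" if z: "z \<in> P" for z
  proof -
    have "norm (f z + conn z (f z) - \<xi>) \<le> norm (f z) + norm (conn z (f z)) + norm \<xi>"
      using norm_triangle_ineq4[of "f z + conn z (f z)" \<xi>] norm_triangle_ineq[of "f z" "conn z (f z)"] by linarith
    also have "norm (conn z (f z)) \<le> b * R * norm (f z)"
      using b(1) R(2)[OF z] by (intro order_trans[OF b(2)] mult_right_mono mult_left_mono) auto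
    finally have 1: "norm (f z + conn z (f z) - \<xi>) \<le> (1 + b * R) * norm (f z) + norm \<xi>" by (simp add: algebra_simps)
    have "norm (f z) \<le> 1 + (norm (f z))\<^sup>2"
      using zero_le_power2[of "norm (f z) - 1/2"] by (simp add: power2_diff) (simp add: power2_eq_square)
    also have "(norm (f z))\<^sup>2 \<le> N z / m"
    proof -
      have "m * (norm (f z))\<^sup>2 \<le> N z" using ctrl[OF z] unfolding controlled_at_def N_def by blast
      then show ?thesis using m by (simp add: field_simps)
    qed
    finally have "norm (f z) \<le> 1 + N z / m" by simp
    then have 2: "(1 + b * R) * norm (f z) \<le> (1 + b * R) * (1 + N z / m)"
      using b(1) R(1) by (intro mult_left_mono) auto
    have "cmod (k z) \<le> M * norm (f z + conn z (f z) - \<xi>)"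
      using norm_mform_le[of "G a" "f z + conn z (f z) - \<xi>" \<xi>] by (simp add: k_def M_def mult_ac)
    also have "\<dots> \<le> M * ((1 + b * R) * (1 + N z / m) + norm \<xi>)"
      using M 1 2 by (intro mult_left_mono) auto
    finally show ?thesis by (simp add: algebra_simps add_divide_distrib)
  qed
  have one: "set_integrable lborel P (\<lambda>_. c)" for c :: real
    by (rule set_integrable_bounded_continuous[OF P(1,3)]) auto
  have k_int: "set_integrable lborel P k"
    unfolding set_integrable_def
  proof (rule Bochner_Integration.integrable_bound)
    let ?B = "\<lambda>z. M * (1 + b * R + norm \<xi>) + M * (1 + b * R) / m * N z"
    show "integrable lborel (\<lambda>z. indicator P z *\<^sub>R ?B z)"
      unfolding set_integrable_def[symmetric]
      by (intro set_integral_add(1) one set_integrable_mult_right int)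
    show "(\<lambda>z. indicator P z *\<^sub>R k z) \<in> borel_measurable lborel"
      using P(1) holomorphic_fun_continuous_on[OF k_holo] by (simp add: borel_measurable_continuous_on_indicator)
    show "AE z in lborel. norm (indicator P z *\<^sub>R k z) \<le> norm (indicator P z *\<^sub>R ?B z)"
      using order_trans[OF k_bound abs_ge_self] by (intro AE_I2) (auto simp: indicator_def)
  qed
  note cmp = set_integral_comparison[OF P k_holo k_int k0, of ?c \<xi> "- (\<mu> * ?c)"]
  have "measure lborel P * ?c - (LINT z:P|lborel. curvature_loss \<xi> z) - \<mu> * ?c * (LINT z:P|lborel. (norm z)\<^sup>2)
     = (LINT z:P|lborel. ?c + 2 * Re (k z) - second_order_loss \<xi> z + - (\<mu> * ?c) * (norm z)\<^sup>2)"
    unfolding cmp(2) by simp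
  also have "\<dots> \<le> (LINT z:P|lborel. N z)"
  proof (intro set_integral_mono cmp(1) int)
    fix z assume "z \<in> P"
    then have "?c + 2 * Re (k z) - second_order_loss \<xi> z - \<mu> * ?c * (norm z)\<^sup>2 \<le> N z"
      using ctrl unfolding controlled_at_def N_def k_def by blast
    then show "?c + 2 * Re (k z) - second_order_loss \<xi> z + - (\<mu> * ?c) * (norm z)\<^sup>2 \<le> N z" by simp
  qed
  finally show ?thesis .
qed

lemma upper_integral:
  fixes \<xi> :: "complex^'k"
  defines "N \<equiv> \<lambda>z. Re (mform (G (a + z)) (\<xi> - conn z \<xi>) (\<xi> - conn z \<xi>))"
  assumes P: "open P" "complex_balanced P" "bounded P"
    and ctrl: "\<And>z. z \<in> P \<Longrightarrow> controlled_at \<mu> m z"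
  shows "(LINT z:P|lborel. N z) \<le> measure lborel P * Re (mform (G a) \<xi> \<xi>) - (LINT z:P|lborel. curvature_loss \<xi> z)
     + \<mu> * Re (mform (G a) \<xi> \<xi>) * (LINT z:P|lborel. (norm z)\<^sup>2)"
    and "set_integrable lborel P N"
proof -
  let ?c = "Re (mform (G a) \<xi> \<xi>)"
  have PU: "a + z \<in> U" if "z \<in> P" for z using ctrl[OF that] by (simp add: controlled_at_def)
  define k where "k z = mform (G a) (- conn z (conn z \<xi>)) \<xi>" for z
  have k_eq: "k z = - 1 * mform (G a) (conn z (conn z \<xi>)) \<xi>" for z
    by (simp add: k_def mform_minus_left)
  have k_holo: "holomorphic_fun P k"
    unfolding k_eq[abs_def]
    by (intro holomorphic_fun_mult holomorphic_fun_const holomorphic_fun_mform holomorphic_fun_conn)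
  have "conn 0 u = 0" for u using linear_0[OF linear_conn_left] by simp
  then have k0: "k 0 = 0" by (simp add: k_def)
  have k_cont: "continuous_on UNIV k" unfolding k_def[abs_def] by (intro continuous_intros)
  have k_int: "set_integrable lborel P k" by (rule set_integrable_bounded_continuous[OF P(1,3) k_cont])
  let ?B = "\<lambda>z. ?c + 2 * Re (k z) - second_order_loss \<xi> z + \<mu> * ?c * (norm z)\<^sup>2"
  have "continuous_on UNIV ?B"
    by (intro continuous_intros k_cont continuous_on_second_order_loss)
  from set_integrable_bounded_continuous(2)[OF P(1,3) this]
  obtain B where B: "\<And>z. z \<in> P \<Longrightarrow> \<bar>?B z\<bar> \<le> B" by auto
  have point: "N z \<le> ?B z" if "z \<in> P" for z
    using ctrl[OF that] unfolding controlled_at_def N_def k_def by blast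
  have N_bound: "norm (N z) \<le> B" if z: "z \<in> P" for z
  proof -
    have "0 \<le> N z"
      unfolding N_def using pos[OF PU[OF z], of "\<xi> - conn z \<xi>"] by (cases "\<xi> - conn z \<xi> = 0") auto
    moreover have "N z \<le> B" using point[OF z] B[OF z] by linarith
    ultimately show ?thesis by simp
  qed
  have "continuous_on P N"
    unfolding N_def
    by (intro continuous_intros continuous_on_compose2[OF cont_G]) (use PU in auto)
  then show N_int: "set_integrable lborel P N"
    by (rule set_integrable_continuous_bounded[OF P(1) emeasure_bounded_finite[OF P(3)]]) (rule N_bound)
  note cmp = set_integral_comparison[OF P k_holo k_int k0, of ?c \<xi> "\<mu> * ?c"]
  have "(LINT z:P|lborel. N z) \<le> (LINT z:P|lborel. ?B z)"
    by (intro set_integral_mono N_int cmp(1) point)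
  also have "\<dots> = measure lborel P * ?c - (LINT z:P|lborel. curvature_loss \<xi> z) + \<mu> * ?c * (LINT z:P|lborel. (norm z)\<^sup>2)"
    by (rule cmp(2))
  finally show "(LINT z:P|lborel. N z) \<le> measure lborel P * ?c - (LINT z:P|lborel. curvature_loss \<xi> z)
     + \<mu> * ?c * (LINT z:P|lborel. (norm z)\<^sup>2)" .
qed

end

section \<open>Unitary matrices\<close>

lemma mform_id: "mform (mat 1) u v = (\<Sum>i\<in>UNIV. cnj (v $ i) * u $ i)"
  by (simp add: mform_def)

lemma of_real_cmod_power2: "complex_of_real ((cmod z)\<^sup>2) = cnj z * z"
  by (subst complex_norm_square) (rule mult.commute)

lemma norm_power2_eq_mform: "complex_of_real ((norm v)\<^sup>2) = mform (mat 1) v v"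
proof -
  have "(norm v)\<^sup>2 = (\<Sum>i\<in>UNIV. (cmod (v $ i))\<^sup>2)"
    by (simp add: norm_vec_def L2_set_def sum_nonneg)
  then show ?thesis by (simp only: mform_id of_real_sum of_real_cmod_power2)
qed

lemma mform_adjoint: "mform (mat 1) u (A *v v) = mform (\<chi> i j. cnj (A $ j $ i)) u v"
proof -
  have "mform (mat 1) u (A *v v) = (\<Sum>i\<in>UNIV. \<Sum>j\<in>UNIV. cnj (A $ i $ j) * (u $ i * cnj (v $ j)))"
    unfolding mform_id by (simp add: matrix_vector_mult_def sum_distrib_left sum_distrib_right mult_ac)
  also have "\<dots> = (\<Sum>j\<in>UNIV. \<Sum>i\<in>UNIV. cnj (A $ i $ j) * (u $ i * cnj (v $ j)))" by (rule sum.swap)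
  finally show ?thesis by (simp add: mform_sum)
qed

lemma unitary_group_orthogonal_transformation:
  assumes "A \<in> unitary_group"
  shows "orthogonal_transformation (\<lambda>z. A *v z)"
  unfolding orthogonal_transformation
proof
  show "linear (\<lambda>z. A *v z)"
    by (rule linearI) (simp_all add: matrix_vector_right_distrib scaleR_eq_vector_scalar vector_scalar_commute)
  show "\<forall>v. norm (A *v v) = norm v"
  proof
    fix v
    have "complex_of_real ((norm (A *v v))\<^sup>2) = mform ((\<chi> i j. cnj (A $ j $ i)) ** A) v v"
      unfolding norm_power2_eq_mform mform_adjoint mform_mult ..
    also have "\<dots> = complex_of_real ((norm v)\<^sup>2)"
    proof -
      have "(\<chi> i j. cnj (A $ j $ i)) ** A = mat 1" using assms by (simp add: unitary_group_def)
      then show ?thesis by (simp only: norm_power2_eq_mform)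
    qed
    finally have "(norm (A *v v))\<^sup>2 = (norm v)\<^sup>2" by (simp only: of_real_eq_iff)
    then show "norm (A *v v) = norm v" by simp
  qed
qed

text \<open>
  A complex Householder reflection. It can exchange two unit vectors only if their inner product is
  real, hence the phase \<open>\<omega>\<close>.
\<close>

lemma unitary_group_maps_axis:
  fixes v :: "complex^'n::finite"
  assumes v: "norm v = 1"
  obtains A \<omega> where "A \<in> unitary_group" "cmod \<omega> = 1" "A *v axis i0 1 = \<omega> *s v"
proof -
  define \<omega> where "\<omega> = (if v $ i0 = 0 then 1 else cnj (v $ i0) / cmod (v $ i0))"
  define t where "t = cmod (v $ i0)"
  have \<omega>: "cmod \<omega> = 1" by (simp add: \<omega>_def norm_divide)
  have \<omega>t: "\<omega> * v $ i0 = of_real t"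
  proof (cases "v $ i0 = 0")
    case False
    then have "\<omega> * v $ i0 = complex_of_real ((cmod (v $ i0))\<^sup>2) / cmod (v $ i0)"
      by (subst of_real_cmod_power2) (simp add: \<omega>_def)
    with False show ?thesis by (simp add: t_def power2_eq_square)
  qed (simp add: t_def)
  define y where "y = \<omega> *s v"
  have y0: "y $ i0 = of_real t" by (simp add: y_def \<omega>t)
  have ny: "norm y = 1" by (simp add: y_def norm_vector_scalar_mult \<omega> v)
  have yy: "(\<Sum>i\<in>UNIV. y $ i * cnj (y $ i)) = 1"
    using norm_power2_eq_mform[of y] ny by (simp add: mform_id mult.commute)
  define w where "w = axis i0 1 - y"
  have w_i: "w $ i = (if i = i0 then 1 else 0) - y $ i" for i by (simp add: w_def axis_def)
  have ww: "(\<Sum>i\<in>UNIV. w $ i * cnj (w $ i)) = of_real (2 * (1 - t))"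
  proof -
    have "(\<Sum>i\<in>UNIV. w $ i * cnj (w $ i)) = (\<Sum>i\<in>UNIV. (if i = i0 then 1 - y $ i - cnj (y $ i) else 0) + y $ i * cnj (y $ i))"
      by (intro sum.cong) (auto simp: w_i algebra_simps)
    then show ?thesis by (simp add: sum.distrib yy y0)
  qed
  show thesis
  proof (cases "t = 1")
    case True
    have "(norm w)\<^sup>2 = 0"
      using norm_power2_eq_mform[of w] ww True by (simp add: mform_id mult.commute)
    then have "axis i0 1 = \<omega> *s v" by (simp add: w_def y_def)
    moreover have "mat 1 \<in> (unitary_group :: (complex^'n^'n) set)"
    proof -
      have "(\<chi> i j. cnj (mat 1 $ j $ i)) = (mat 1 :: complex^'n^'n)" by (simp add: vec_eq_iff mat_def)
      then show ?thesis by (simp add: unitary_group_def)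
    qed
    ultimately show thesis using that[of "mat 1" \<omega>] \<omega> by simp
  next
    case False
    \<comment> \<open>Half the squared norm of \<open>w\<close>, so that \<open>A\<close> below is the reflection along \<open>w\<close>.\<close>
    define \<kappa> where "\<kappa> = complex_of_real (1 - t)"
    have \<kappa>: "\<kappa> \<noteq> 0" "cnj \<kappa> = \<kappa>" using False by (simp_all add: \<kappa>_def)
    define A :: "complex^'n^'n" where "A = (\<chi> i j. (if i = j then 1 else 0) - w $ i * cnj (w $ j) / \<kappa>)"
    have ww': "(\<Sum>i\<in>UNIV. w $ i * cnj (w $ i)) = 2 * \<kappa>" by (simp add: ww \<kappa>_def)
    have herm: "(\<chi> i j. cnj (A $ j $ i)) = A" by (simp add: A_def vec_eq_iff \<kappa> mult.commute)
    have "(A ** A) $ i $ j = (mat 1 :: complex^'n^'n) $ i $ j" for i j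
    proof -
      have entry: "A $ i $ k = (if k = i then 1 else 0) - w $ i * cnj (w $ k) / \<kappa>" for k by (simp add: A_def)
      have split: "A $ i $ k * A $ k $ j = (if k = i then A $ i $ j else 0) - w $ i * cnj (w $ k) / \<kappa> * A $ k $ j" for k
        by (subst entry) (simp add: left_diff_distrib)
      have "(A ** A) $ i $ j = (\<Sum>k\<in>UNIV. (if k = i then A $ i $ j else 0) - w $ i * cnj (w $ k) / \<kappa> * A $ k $ j)"
        by (simp only: matrix_matrix_mult_def vec_lambda_beta split)
      also have "\<dots> = A $ i $ j - (\<Sum>k\<in>UNIV. w $ i * cnj (w $ k) / \<kappa> * A $ k $ j)"
        by (simp add: sum_subtractf)
      also have "(\<Sum>k\<in>UNIV. w $ i * cnj (w $ k) / \<kappa> * A $ k $ j)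
          = (\<Sum>k\<in>UNIV. (if k = j then w $ i * cnj (w $ j) / \<kappa> else 0) - w $ i * cnj (w $ j) / (\<kappa> * \<kappa>) * (w $ k * cnj (w $ k)))"
        by (intro sum.cong refl) (use \<kappa>(1) in \<open>auto simp: A_def field_simps\<close>)
      also have "\<dots> = w $ i * cnj (w $ j) / \<kappa> - w $ i * cnj (w $ j) / (\<kappa> * \<kappa>) * (2 * \<kappa>)"
        by (simp add: sum_subtractf ww'[symmetric] sum_distrib_left)
      also have "\<dots> = - w $ i * cnj (w $ j) / \<kappa>" using \<kappa>(1) by (simp add: field_simps)
      finally show ?thesis by (simp add: A_def mat_def)
    qed
    then have "A ** A = mat 1" by (simp add: vec_eq_iff)
    then have "A \<in> unitary_group" by (simp add: unitary_group_def herm)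
    moreover have "A *v axis i0 1 = \<omega> *s v"
    proof -
      have "w $ i0 = \<kappa>" by (simp add: w_i y0 \<kappa>_def)
      then have "(A *v axis i0 1) $ i = y $ i" for i
        using \<kappa> by (simp add: matrix_vector_mult_def axis_def A_def if_distrib cong: if_cong)
          (auto simp: w_i y0 \<kappa>_def)
      then show ?thesis by (simp add: vec_eq_iff y_def)
    qed
    ultimately show thesis using that \<omega> by blast
  qed
qed

section \<open>Discs times balls in unitary coordinates\<close>

lemma disc_ball_eq_image: "disc_ball i0 r s A = (\<lambda>z. A *v z) ` std_disc_ball i0 r s"
  by (simp add: disc_ball_def std_disc_ball_def tail_norm_def)

context
  fixes i0 :: "'n::finite" and r s :: real and A :: "complex^'n^'n"
  assumes A: "A \<in> unitary_group"
begin

lemma vimage_disc_ball: "(\<lambda>z. A *v z) -` disc_ball i0 r s A = std_disc_ball i0 r s"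
  unfolding disc_ball_eq_image
  using orthogonal_transformation_inj[OF unitary_group_orthogonal_transformation[OF A]] by (rule inj_vimage_image_eq)

lemma open_disc_ball: "open (disc_ball i0 r s A)"
proof -
  note T = unitary_group_orthogonal_transformation[OF A]
  show ?thesis
    unfolding disc_ball_eq_image
    using open_bijective_linear_image_eq[OF orthogonal_transformation_linear[OF T] orthogonal_transformation_bij[OF T]]
      open_std_disc_ball by blast
qed

lemma norm_less_disc_ball: "z \<in> disc_ball i0 r s A \<Longrightarrow> (norm z)\<^sup>2 < r\<^sup>2 + s\<^sup>2"
  unfolding disc_ball_eq_image
  using std_disc_ball_norm_less orthogonal_transformation_norm[OF unitary_group_orthogonal_transformation[OF A]] by auto

lemma bounded_disc_ball: "bounded (disc_ball i0 r s A)"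
  unfolding bounded_iff
  using norm_less_disc_ball real_less_rsqrt less_imp_le by blast

lemma complex_balanced_disc_ball: "complex_balanced (disc_ball i0 r s A)"
  using complex_balanced_std_disc_ball[of i0 r s]
  unfolding complex_balanced_def disc_ball_eq_image
  by (auto simp: vector_scalar_commute[symmetric])

lemma set_integral_disc_ball:
  fixes F :: "complex^'n \<Rightarrow> 'b::euclidean_space"
  assumes "continuous_on (disc_ball i0 r s A) F"
  shows "(LINT z:disc_ball i0 r s A|lborel. F z) = (LINT z:std_disc_ball i0 r s|lborel. F (A *v z))"
  using set_integral_orthogonal(1)[OF unitary_group_orthogonal_transformation[OF A] open_disc_ball assms]
  by (simp only: vimage_disc_ball)

lemma measure_disc_ball: "measure lborel (disc_ball i0 r s A) = measure lborel (std_disc_ball i0 r s)"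
  using set_integral_disc_ball[of "\<lambda>_. 1::real"]
    emeasure_bounded_finite[OF bounded_disc_ball] emeasure_std_disc_ball_finite[of i0 r s]
  by (simp add: set_lebesgue_integral_def open_disc_ball open_std_disc_ball)

lemma measure_disc_ball_pos: "r > 0 \<Longrightarrow> s > 0 \<Longrightarrow> measure lborel (disc_ball i0 r s A) > 0"
  unfolding measure_disc_ball by (rule measure_std_disc_ball_pos)

lemma set_integral_norm_disc_ball:
  assumes r: "r > 0" and s: "s > 0"
  shows "(LINT z:disc_ball i0 r s A|lborel. (norm z)\<^sup>2)
    = (disc_ball_size CARD('n) r s)\<^sup>2 * measure lborel (disc_ball i0 r s A)"
proof -
  have int: "set_integrable lborel (std_disc_ball i0 r s) (\<lambda>z. (cmod (z $ i0))\<^sup>2)"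
    "set_integrable lborel (std_disc_ball i0 r s) (\<lambda>z. (tail_norm i0 z)\<^sup>2)"
  proof -
    note * = set_integrable_bounded_continuous(1)[OF open_std_disc_ball bounded_std_disc_ball]
    show "set_integrable lborel (std_disc_ball i0 r s) (\<lambda>z. (cmod (z $ i0))\<^sup>2)"
      "set_integrable lborel (std_disc_ball i0 r s) (\<lambda>z. (tail_norm i0 z)\<^sup>2)"
      by (intro * continuous_intros continuous_on_tail_norm)+
  qed
  have "(LINT z:disc_ball i0 r s A|lborel. (norm z)\<^sup>2) = (LINT z:std_disc_ball i0 r s|lborel. (norm (A *v z))\<^sup>2)"
    by (intro set_integral_disc_ball continuous_intros)
  also have "\<dots> = (LINT z:std_disc_ball i0 r s|lborel. (cmod (z $ i0))\<^sup>2 + (tail_norm i0 z)\<^sup>2)"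
    using orthogonal_transformation_norm[OF unitary_group_orthogonal_transformation[OF A]]
    by (simp only: norm_power2_tail[of _ i0])
  also have "\<dots> = (r\<^sup>2 / 2 + (real CARD('n) - 1) / real CARD('n) * s\<^sup>2) * measure lborel (std_disc_ball i0 r s)"
    unfolding set_integral_add(2)[OF int] set_integral_head_moment[OF r s] set_integral_tail_moment[OF r s]
    by (simp only: distrib_right)
  also have "r\<^sup>2 / 2 + (real CARD('n) - 1) / real CARD('n) * s\<^sup>2 = (disc_ball_size CARD('n) r s)\<^sup>2"
  proof -
    have "real CARD('n) \<ge> 1" by (simp add: Suc_leI)
    then show ?thesis unfolding disc_ball_size_def by (subst real_sqrt_pow2) auto
  qed
  finally show ?thesis by (simp only: measure_disc_ball)
qed

end

lemma set_integral_translate: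
  fixes F :: "'a::euclidean_space \<Rightarrow> 'b::euclidean_space"
  assumes "set_integrable lborel ((\<lambda>z. a + z) ` P) F"
  shows "set_integrable lborel P (\<lambda>z. F (a + z))"
    and "(LINT x:(\<lambda>z. a + z) ` P|lborel. F x) = (LINT z:P|lborel. F (a + z))"
proof -
  let ?F = "\<lambda>x. indicator ((\<lambda>z. a + z) ` P) x *\<^sub>R F x"
  have int: "integrable lborel ?F" using assms by (simp add: set_integrable_def)
  from borel_measurable_integrable[OF this] have meas: "?F \<in> borel_measurable borel"
    by (simp only: measurable_lborel2)
  have ind: "?F (a + z) = indicator P z *\<^sub>R F (a + z)" for z by (auto simp: indicator_def)
  have "integrable (distr lborel borel ((+) a)) ?F" using int by (simp add: lborel_distr_plus)
  then show "set_integrable lborel P (\<lambda>z. F (a + z))"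
    by (subst (asm) integrable_distr_eq) (use meas in \<open>auto simp: ind set_integrable_def\<close>)
  have "(LINT x|lborel. ?F x) = (LINT x|distr lborel borel ((+) a). ?F x)" by (simp add: lborel_distr_plus)
  also have "\<dots> = (LINT z|lborel. ?F (a + z))"
    by (subst integral_distr) (use meas in auto)
  finally show "(LINT x:(\<lambda>z. a + z) ` P|lborel. F x) = (LINT z:P|lborel. F (a + z))"
    by (simp only: ind set_lebesgue_integral_def)
qed

section \<open>Recovering the curvature from its means\<close>

context hermitian_germ
begin

lemma curvature_loss_scale: "curvature_loss \<xi> (c *s z) = (cmod c)\<^sup>2 * curvature_loss \<xi> z"
proof -
  have "curv (c *s z) $ \<alpha> $ \<beta> = (c * cnj c) * curv z $ \<alpha> $ \<beta>" for \<alpha> \<beta>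
    by (simp add: curv_def sum_distrib_left mult_ac)
  from matrix_vector_entrywise_scale[OF this]
  have "mform (G a) (curv (c *s z) *v \<xi>) \<xi> = complex_of_real ((cmod c)\<^sup>2) * mform (G a) (curv z *v \<xi>) \<xi>"
    by (simp only: mform_scale_left complex_norm_square)
  then show ?thesis by (simp add: curvature_loss_def)
qed

text \<open>
  After scaling by \<open>1/r\<close>, points of the domain are within \<open>\<eta>\<close> of the disc in the direction \<open>v\<close>. On
  that disc the quadratic form is \<open>|w\<^sub>1|\<^sup>2\<close> times its value at \<open>v\<close>, and the mean of \<open>|w\<^sub>1|\<^sup>2\<close> is
  \<open>r\<^sup>2/2\<close>. The difference is controlled by uniform continuity.
\<close>

lemma curvature_loss_concentration:
  assumes A: "A \<in> unitary_group" and v: "norm v = 1" and \<omega>: "cmod \<omega> = 1" "A *v axis i0 1 = \<omega> *s v"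
    and \<kappa>: "\<kappa> > 0"
  shows "\<exists>\<eta>\<^sub>0>0. \<forall>\<eta>. 0 < \<eta> \<and> \<eta> < \<eta>\<^sub>0 \<longrightarrow> (\<forall>r>0.
    \<bar>(LINT z:disc_ball i0 r (\<eta> * r) A|lborel. curvature_loss \<xi> z) / measure lborel (disc_ball i0 r (\<eta> * r) A)
      - r\<^sup>2 / 2 * curvature_loss \<xi> v\<bar> \<le> \<kappa> * r\<^sup>2)"
proof -
  let ?q = "curvature_loss \<xi>"
  have "uniformly_continuous_on (cball 0 2) ?q"
    by (intro compact_uniformly_continuous continuous_on_curvature_loss compact_cball)
  then obtain \<delta> where \<delta>: "\<delta> > 0"
    "\<And>x y. x \<in> cball 0 2 \<Longrightarrow> y \<in> cball 0 2 \<Longrightarrow> dist x y < \<delta> \<Longrightarrow> dist (?q x) (?q y) < \<kappa>"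
    using \<kappa> unfolding uniformly_continuous_on_def by metis
  \<comment> \<open>The bound by 1 keeps the rescaled points in the ball of radius 2.\<close>
  define \<eta>\<^sub>0 where "\<eta>\<^sub>0 = min \<delta> 1"
  have "\<eta>\<^sub>0 > 0" using \<delta>(1) by (simp add: \<eta>\<^sub>0_def)
  moreover have "\<bar>(LINT z:disc_ball i0 r (\<eta> * r) A|lborel. ?q z) / measure lborel (disc_ball i0 r (\<eta> * r) A)
      - r\<^sup>2 / 2 * ?q v\<bar> \<le> \<kappa> * r\<^sup>2" if \<eta>: "0 < \<eta> \<and> \<eta> < \<eta>\<^sub>0" and r: "r > 0" for \<eta> r
  proof -
    have s: "\<eta> * r > 0" using \<eta> r by simp
    let ?S = "std_disc_ball i0 r (\<eta> * r)"
    let ?V = "measure lborel ?S"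
    have V: "?V > 0" by (rule measure_std_disc_ball_pos[OF r s])
    note normA = orthogonal_transformation_norm[OF unitary_group_orthogonal_transformation[OF A]]
    have point: "\<bar>?q (A *v w) - (cmod (w $ i0))\<^sup>2 * ?q v\<bar> \<le> \<kappa> * r\<^sup>2" if w: "w \<in> ?S" for w
    proof -
      define c where "c = complex_of_real (1 / r)"
      have c: "cmod c = 1 / r" using r by (simp add: c_def norm_divide)
      define x where "x = c *s (A *v w)"
      \<comment> \<open>The projection of \<open>x\<close> to the axis of the disc.\<close>
      define y where "y = (c * w $ i0 * \<omega>) *s v"
      have y: "y = c *s (A *v (w $ i0 *s axis i0 1))"
        by (simp add: y_def vector_scalar_commute \<omega>(2) vec_eq_iff)
      have ny: "norm y < 1"
        using w r by (simp add: y_def norm_vector_scalar_mult norm_mult c \<omega>(1) v std_disc_ball_def field_simps)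
      have "x - y = c *s (A *v (w - w $ i0 *s axis i0 1))"
        unfolding x_def y matrix_vector_mult_diff_distrib by (simp add: vec_eq_iff algebra_simps)
      moreover have "norm (w - w $ i0 *s axis i0 1) = tail_norm i0 w"
      proof -
        have "(norm (w - w $ i0 *s axis i0 1))\<^sup>2 = (tail_norm i0 w)\<^sup>2"
          unfolding norm_power2_tail[of _ i0]
          by (simp add: tail_norm_def axis_def cong: L2_set_cong_simp)
        then show ?thesis by simp
      qed
      ultimately have "norm (x - y) = tail_norm i0 w / r" by (simp add: norm_vector_scalar_mult c normA)
      also have "\<dots> < \<eta>" using w r by (simp add: std_disc_ball_def field_simps)
      finally have xy: "norm (x - y) < \<eta>" .
      have "norm x \<le> norm y + norm (x - y)" using norm_triangle_ineq[of y "x - y"] by simp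
      then have "dist (?q x) (?q y) < \<kappa>"
        using xy ny \<eta> by (intro \<delta>(2)) (auto simp: \<eta>\<^sub>0_def dist_norm)
      then have "r\<^sup>2 * \<bar>?q x - ?q y\<bar> \<le> r\<^sup>2 * \<kappa>" by (intro mult_left_mono) (auto simp: dist_real_def)
      moreover have "r\<^sup>2 * ?q x = ?q (A *v w)" using r by (simp add: x_def curvature_loss_scale c power_divide)
      moreover have "r\<^sup>2 * ?q y = (cmod (w $ i0))\<^sup>2 * ?q v"
        using r by (simp add: y_def curvature_loss_scale norm_mult c \<omega>(1) power_mult_distrib power_divide)
      moreover have "r\<^sup>2 * \<bar>?q x - ?q y\<bar> = \<bar>r\<^sup>2 * ?q x - r\<^sup>2 * ?q y\<bar>"
        by (simp add: right_diff_distrib[symmetric] abs_mult)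
      ultimately show ?thesis by (simp add: mult.commute)
    qed
    note int = set_integrable_bounded_continuous(1)[OF open_std_disc_ball bounded_std_disc_ball]
    have linA: "continuous_on UNIV (\<lambda>w. A *v w)"
      using orthogonal_transformation_linear[OF unitary_group_orthogonal_transformation[OF A]]
      by (intro linear_continuous_on linear_conv_bounded_linear[THEN iffD1])
    have i1: "set_integrable lborel ?S (\<lambda>w. ?q (A *v w))"
      by (intro int continuous_on_compose2[OF continuous_on_curvature_loss[of UNIV] linA]) auto
    have i2: "set_integrable lborel ?S (\<lambda>w. (cmod (w $ i0))\<^sup>2 * ?q v)"
      by (intro int continuous_intros)
    have ic: "set_integrable lborel ?S (\<lambda>w. C)" for C :: real by (intro int continuous_intros)
    have cV: "(LINT w:?S|lborel. C) = ?V * C" for C :: real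
      using emeasure_std_disc_ball_finite[of i0 r "\<eta> * r"]
      by (simp add: set_lebesgue_integral_def open_std_disc_ball)
    have "(LINT w:?S|lborel. ?q (A *v w) - (cmod (w $ i0))\<^sup>2 * ?q v) \<le> (LINT w:?S|lborel. \<kappa> * r\<^sup>2)"
      "(LINT w:?S|lborel. - (\<kappa> * r\<^sup>2)) \<le> (LINT w:?S|lborel. ?q (A *v w) - (cmod (w $ i0))\<^sup>2 * ?q v)"
      using point by (intro set_integral_mono ic set_integral_diff(1) i1 i2; force simp: abs_le_iff)+
    then have "\<bar>(LINT w:?S|lborel. ?q (A *v w)) - r\<^sup>2 / 2 * ?V * ?q v\<bar> \<le> ?V * (\<kappa> * r\<^sup>2)"
      unfolding cV set_integral_diff(2)[OF i1 i2] set_integral_mult_left set_integral_head_moment[OF r s] by linarith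
    then have "\<bar>(LINT w:?S|lborel. ?q (A *v w)) - r\<^sup>2 / 2 * ?V * ?q v\<bar> / ?V \<le> \<kappa> * r\<^sup>2"
      using V by (simp add: field_simps)
    moreover have "\<bar>(LINT w:?S|lborel. ?q (A *v w)) - r\<^sup>2 / 2 * ?V * ?q v\<bar> / ?V
      = \<bar>(LINT w:?S|lborel. ?q (A *v w)) / ?V - r\<^sup>2 / 2 * ?q v\<bar>"
    proof -
      have "(LINT w:?S|lborel. ?q (A *v w)) / ?V - r\<^sup>2 / 2 * ?q v
        = ((LINT w:?S|lborel. ?q (A *v w)) - r\<^sup>2 / 2 * ?V * ?q v) / ?V"
        using V by (simp add: diff_divide_distrib)
      then show ?thesis using V by simp
    qed
    ultimately show ?thesis
      unfolding measure_disc_ball[OF A] set_integral_disc_ball[OF A continuous_on_curvature_loss] by simp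
  qed
  ultimately show ?thesis by blast
qed

end

text \<open>
  Along \<open>s = \<eta> r\<close> the averages are \<open>r\<^sup>2 q / 2\<close> up to \<open>\<kappa> r\<^sup>2\<close>, and their bounds are multiples of
  \<open>r\<^sup>2\<close>, so that a single small \<open>r\<close> suffices for each \<open>\<eta>\<close>. First \<open>\<eta>\<close> and then \<open>\<epsilon>\<close> tend to zero.
\<close>

lemma bound_of_concentrated_averages:
  fixes X :: "real \<Rightarrow> real \<Rightarrow> real" and q N \<nu> D :: real
  assumes conc: "\<And>\<kappa>. \<kappa> > 0 \<Longrightarrow> \<exists>\<eta>\<^sub>0>0. \<forall>\<eta>. 0 < \<eta> \<and> \<eta> < \<eta>\<^sub>0 \<longrightarrow> (\<forall>r>0. \<bar>X r (\<eta> * r) - r\<^sup>2 / 2 * q\<bar> \<le> \<kappa> * r\<^sup>2)"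
    and bound: "\<And>\<epsilon>. \<epsilon> > 0 \<Longrightarrow> \<exists>\<rho>>0. \<forall>r>0. \<forall>s>0. r\<^sup>2 + s\<^sup>2 < \<rho>\<^sup>2 \<longrightarrow> X r s \<le> (D + \<epsilon>) * (r\<^sup>2 / 2 + \<nu> * s\<^sup>2) * N"
  shows "q \<le> D * N"
proof -
  have step: "q \<le> 2 * \<epsilon> + (D + \<epsilon>) * N" if \<epsilon>: "\<epsilon> > 0" for \<epsilon>
  proof -
    obtain \<eta>\<^sub>0 where \<eta>\<^sub>0: "\<eta>\<^sub>0 > 0" "\<And>\<eta> r. 0 < \<eta> \<Longrightarrow> \<eta> < \<eta>\<^sub>0 \<Longrightarrow> r > 0 \<Longrightarrow> \<bar>X r (\<eta> * r) - r\<^sup>2 / 2 * q\<bar> \<le> \<epsilon> * r\<^sup>2"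
      using conc[OF \<epsilon>] by blast
    obtain \<rho> where \<rho>: "\<rho> > 0" "\<And>r s. r > 0 \<Longrightarrow> s > 0 \<Longrightarrow> r\<^sup>2 + s\<^sup>2 < \<rho>\<^sup>2 \<Longrightarrow> X r s \<le> (D + \<epsilon>) * (r\<^sup>2 / 2 + \<nu> * s\<^sup>2) * N"
      using bound[OF \<epsilon>] by blast
    have small: "q \<le> 2 * \<epsilon> + (D + \<epsilon>) * (1 + 2 * \<nu> * \<eta>\<^sup>2) * N" if \<eta>: "0 < \<eta>" "\<eta> < min \<eta>\<^sub>0 1" for \<eta>
    proof -
      define r where "r = \<rho> / 2"
      have r: "r > 0" using \<rho>(1) by (simp add: r_def)
      have "\<eta>\<^sup>2 \<le> 1" using \<eta> by (simp add: power_le_one)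
      then have "(\<eta> * r)\<^sup>2 \<le> r\<^sup>2" by (simp add: power_mult_distrib mult_left_le_one_le)
      moreover have "r\<^sup>2 + r\<^sup>2 < \<rho>\<^sup>2" using \<rho>(1) by (simp add: r_def power2_eq_square)
      ultimately have "r\<^sup>2 + (\<eta> * r)\<^sup>2 < \<rho>\<^sup>2" by linarith
      then have "X r (\<eta> * r) \<le> (D + \<epsilon>) * (r\<^sup>2 / 2 + \<nu> * (\<eta> * r)\<^sup>2) * N"
        using r \<eta> by (intro \<rho>(2)) auto
      moreover have "\<bar>X r (\<eta> * r) - r\<^sup>2 / 2 * q\<bar> \<le> \<epsilon> * r\<^sup>2" using \<eta> r by (intro \<eta>\<^sub>0(2)) auto
      ultimately have "r\<^sup>2 / 2 * q \<le> \<epsilon> * r\<^sup>2 + (D + \<epsilon>) * (r\<^sup>2 / 2 + \<nu> * (\<eta> * r)\<^sup>2) * N" by linarith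
      also have "\<dots> = r\<^sup>2 / 2 * (2 * \<epsilon> + (D + \<epsilon>) * (1 + 2 * \<nu> * \<eta>\<^sup>2) * N)"
        by (simp add: power_mult_distrib algebra_simps)
      finally show ?thesis using r by (simp add: mult_le_cancel_left)
    qed
    have "((\<lambda>\<eta>. 2 * \<epsilon> + (D + \<epsilon>) * (1 + 2 * \<nu> * \<eta>\<^sup>2) * N) \<longlongrightarrow> 2 * \<epsilon> + (D + \<epsilon>) * (1 + 2 * \<nu> * 0\<^sup>2) * N) (at_right 0)"
      by (intro tendsto_intros)
    moreover have "\<forall>\<^sub>F \<eta> in at_right 0. q \<le> 2 * \<epsilon> + (D + \<epsilon>) * (1 + 2 * \<nu> * \<eta>\<^sup>2) * N"
      unfolding eventually_at_right_field using \<eta>\<^sub>0(1) small by (intro exI[of _ "min \<eta>\<^sub>0 1"]) auto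
    ultimately have "q \<le> 2 * \<epsilon> + (D + \<epsilon>) * (1 + 2 * \<nu> * 0\<^sup>2) * N"
      by (intro tendsto_lowerbound) auto
    then show ?thesis by simp
  qed
  have "((\<lambda>\<epsilon>. 2 * \<epsilon> + (D + \<epsilon>) * N) \<longlongrightarrow> 2 * 0 + (D + 0) * N) (at_right 0)"
    by (intro tendsto_intros)
  moreover have "\<forall>\<^sub>F \<epsilon> in at_right 0. q \<le> 2 * \<epsilon> + (D + \<epsilon>) * N"
    unfolding eventually_at_right_field using step by (intro exI[of _ 1]) auto
  ultimately have "q \<le> 2 * 0 + (D + 0) * N" by (intro tendsto_lowerbound) auto
  then show ?thesis by simp
qed

section \<open>Hermitian bundles in a chart\<close>

text \<open>
  The trivialization is a parameter, so that the choice made in the definition of the curvature can be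
  inserted at the end.
\<close>

locale hermitian_chart =
  fixes \<Omega> :: "(complex^'n::finite) set" and E :: "('e, 'n, 'k::finite) vbundle"
    and h :: "'e \<Rightarrow> 'e \<Rightarrow> complex" and U :: "(complex^'n) set" and \<tau> :: "'e \<Rightarrow> complex^'k"
    and a :: "complex^'n"
  assumes holo: "holomorphic_vector_bundle \<Omega> E"
    and metric: "smooth_hermitian_metric \<Omega> E h"
    and chart: "(U, \<tau>) \<in> atlas E" and a_in_chart: "a \<in> U"
begin

lemma chart_facts:
  assumes "(V, \<tau>') \<in> atlas E"
  shows "open V" "V \<subseteq> \<Omega>" "linear_triv E V \<tau>'"
  using holo assms unfolding holomorphic_vector_bundle_def by blast+

lemma fibre_closed:
  assumes "x \<in> \<Omega>"
  shows "fzero E x \<in> fibre E x"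
    and "u \<in> fibre E x \<Longrightarrow> v \<in> fibre E x \<Longrightarrow> fadd E u v \<in> fibre E x"
    and "u \<in> fibre E x \<Longrightarrow> fscale E c u \<in> fibre E x"
  using holo assms unfolding holomorphic_vector_bundle_def by blast+

lemma triv_facts:
  assumes "(V, \<tau>') \<in> atlas E" "x \<in> V"
  shows "bij_betw \<tau>' (fibre E x) UNIV" "\<tau>' (fzero E x) = 0"
    and "u \<in> fibre E x \<Longrightarrow> v \<in> fibre E x \<Longrightarrow> \<tau>' (fadd E u v) = \<tau>' u + \<tau>' v"
    and "u \<in> fibre E x \<Longrightarrow> \<tau>' (fscale E c u) = c *s \<tau>' u"
  using chart_facts(3)[OF assms(1)] assms(2) unfolding linear_triv_def by blast+

lemma triv_inv_fibre: "x \<in> U \<Longrightarrow> triv_inv E \<tau> x w \<in> fibre E x"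
  unfolding triv_inv_def
  using triv_facts(1)[OF chart] by (metis UNIV_I bij_betw_imp_surj_on inv_into_into)

lemma triv_triv_inv: "x \<in> U \<Longrightarrow> \<tau> (triv_inv E \<tau> x w) = w"
  unfolding triv_inv_def
  using triv_facts(1)[OF chart] by (metis UNIV_I bij_betw_imp_surj_on f_inv_into_f)

lemma triv_inv_triv: "x \<in> U \<Longrightarrow> u \<in> fibre E x \<Longrightarrow> triv_inv E \<tau> x (\<tau> u) = u"
  unfolding triv_inv_def
  using triv_facts(1)[OF chart] by (metis bij_betw_imp_inj_on inv_into_f_f)

lemma triv_inv_add:
  assumes "x \<in> U"
  shows "triv_inv E \<tau> x (w + w') = fadd E (triv_inv E \<tau> x w) (triv_inv E \<tau> x w')"
proof -
  have x: "x \<in> \<Omega>" using assms chart_facts[OF chart] by blast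
  have "fadd E (triv_inv E \<tau> x w) (triv_inv E \<tau> x w') \<in> fibre E x"
    by (intro fibre_closed x triv_inv_fibre assms)
  from triv_inv_triv[OF assms this] show ?thesis
    by (simp add: triv_facts(3)[OF chart assms] triv_inv_fibre[OF assms] triv_triv_inv[OF assms])
qed

lemma triv_inv_scale:
  assumes "x \<in> U"
  shows "triv_inv E \<tau> x (c *s w) = fscale E c (triv_inv E \<tau> x w)"
proof -
  have x: "x \<in> \<Omega>" using assms chart_facts[OF chart] by blast
  have "fscale E c (triv_inv E \<tau> x w) \<in> fibre E x"
    by (intro fibre_closed x triv_inv_fibre assms)
  from triv_inv_triv[OF assms this] show ?thesis
    by (simp add: triv_facts(4)[OF chart assms] triv_inv_fibre[OF assms] triv_triv_inv[OF assms])
qed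

lemma metric_facts:
  assumes "x \<in> \<Omega>" "u \<in> fibre E x" "v \<in> fibre E x"
  shows "w \<in> fibre E x \<Longrightarrow> h (fadd E u v) w = h u w + h v w"
    and "h (fscale E c u) v = c * h u v" and "h v u = cnj (h u v)"
    and "u \<noteq> fzero E x \<Longrightarrow> Re (h u u) > 0"
  using metric assms unfolding smooth_hermitian_metric_def by blast+

lemma metric_in_frame:
  assumes x: "x \<in> U" and u: "u \<in> fibre E x" and v: "v \<in> fibre E x"
  shows "h u v = mform (gram E h \<tau> x) (\<tau> u) (\<tau> v)"
proof -
  define H where "H w w' = h (triv_inv E \<tau> x w) (triv_inv E \<tau> x w')" for w w'
  have x': "x \<in> \<Omega>" using x chart_facts[OF chart] by blast
  note fib = triv_inv_fibre[OF x]
  have add: "H (w + w') y = H w y + H w' y" for w w' y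
    unfolding H_def triv_inv_add[OF x] by (rule metric_facts(1)[OF x' fib fib fib])
  have scale: "H (c *s w) y = c * H w y" for c w y
    unfolding H_def triv_inv_scale[OF x] by (rule metric_facts(2)[OF x' fib fib])
  have herm: "H w y = cnj (H y w)" for w y
    unfolding H_def by (rule metric_facts(3)[OF x' fib fib])
  have zero: "H 0 y = 0" for y using scale[of 0 0 y] by simp
  have sum: "H (\<Sum>\<beta>\<in>S. f \<beta>) y = (\<Sum>\<beta>\<in>S. H (f \<beta>) y)" for S :: "'k set" and f y
    by (induction S rule: infinite_finite_induct) (simp_all add: zero add)
  have expand: "H w y = (\<Sum>\<beta>\<in>UNIV. w $ \<beta> * H (axis \<beta> 1) y)" for w y
  proof -
    have "H w y = H (\<Sum>\<beta>\<in>UNIV. w $ \<beta> *s axis \<beta> 1) y" by (simp only: basis_expansion)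
    then show ?thesis by (simp only: sum scale)
  qed
  have axis: "H (axis \<beta> 1) y = (\<Sum>\<alpha>\<in>UNIV. cnj (y $ \<alpha>) * gram E h \<tau> x $ \<alpha> $ \<beta>)" for \<beta> y
  proof -
    have "H (axis \<beta> 1) y = cnj (\<Sum>\<alpha>\<in>UNIV. y $ \<alpha> * H (axis \<alpha> 1) (axis \<beta> 1))"
      by (subst herm, subst expand) (rule refl)
    also have "\<dots> = (\<Sum>\<alpha>\<in>UNIV. cnj (y $ \<alpha>) * cnj (H (axis \<alpha> 1) (axis \<beta> 1)))" by simp
    also have "\<dots> = (\<Sum>\<alpha>\<in>UNIV. cnj (y $ \<alpha>) * H (axis \<beta> 1) (axis \<alpha> 1))" by (simp only: herm[symmetric])
    finally show ?thesis by (simp add: H_def gram_def)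
  qed
  have "h u v = H (\<tau> u) (\<tau> v)" by (simp add: H_def triv_inv_triv[OF x] u v)
  also have "\<dots> = (\<Sum>\<beta>\<in>UNIV. \<Sum>\<alpha>\<in>UNIV. gram E h \<tau> x $ \<alpha> $ \<beta> * (\<tau> u $ \<beta> * cnj (\<tau> v $ \<alpha>)))"
    by (subst expand) (simp add: axis sum_distrib_left mult_ac)
  also have "\<dots> = mform (gram E h \<tau> x) (\<tau> u) (\<tau> v)"
    unfolding mform_sum by (rule sum.swap)
  finally show ?thesis .
qed

sublocale germ: hermitian_germ U "gram E h \<tau>" a
proof
  show "twice_differentiable_at U (\<lambda>x. gram E h \<tau> x $ \<alpha> $ \<beta>) a" for \<alpha> \<beta>
  proof (rule smooth_fun_twice_differentiable)
    show "smooth_fun U (\<lambda>x. gram E h \<tau> x $ \<alpha> $ \<beta>)"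
      using metric chart unfolding smooth_hermitian_metric_def by blast
  qed (use chart_facts[OF chart] a_in_chart in auto)
next
  fix x \<alpha> \<beta> assume x: "x \<in> U"
  have "x \<in> \<Omega>" using x chart_facts(2)[OF chart] by blast
  then show "gram E h \<tau> x $ \<beta> $ \<alpha> = cnj (gram E h \<tau> x $ \<alpha> $ \<beta>)"
    unfolding gram_def vec_lambda_beta
    by (rule metric_facts(3)[OF _ triv_inv_fibre[OF x] triv_inv_fibre[OF x]])
next
  fix x and u :: "complex^'k" assume x: "x \<in> U" and u: "u \<noteq> 0"
  have "x \<in> \<Omega>" using x chart_facts(2)[OF chart] by blast
  moreover have "triv_inv E \<tau> x u \<noteq> fzero E x"
  proof
    assume "triv_inv E \<tau> x u = fzero E x"
    then have "\<tau> (triv_inv E \<tau> x u) = 0" by (simp only: triv_facts(2)[OF chart x])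
    with u show False by (simp add: triv_triv_inv[OF x])
  qed
  ultimately have "0 < Re (h (triv_inv E \<tau> x u) (triv_inv E \<tau> x u))"
    by (rule metric_facts(4)[OF _ triv_inv_fibre[OF x] triv_inv_fibre[OF x]])
  then show "0 < Re (mform (gram E h \<tau> x) u u)"
    by (simp add: metric_in_frame[OF x] triv_inv_fibre[OF x] triv_triv_inv[OF x])
qed

lemma hnorm2_in_frame: "x \<in> U \<Longrightarrow> u \<in> fibre E x \<Longrightarrow> hnorm2 h u = Re (mform (gram E h \<tau> x) (\<tau> u) (\<tau> u))"
  by (simp add: hnorm2_def metric_in_frame)

lemma chern_curvature_in_frame:
  assumes "\<tau> = (SOME \<tau>. \<exists>U. (U, \<tau>) \<in> atlas E \<and> a \<in> U)" and \<xi>: "\<xi> \<in> fibre E a"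
  shows "Re (h (chern_curvature E h a v \<xi>) \<xi>) = germ.curvature_loss (\<tau> \<xi>) v"
proof -
  have "curvature_matrix E h \<tau> j k a $ \<alpha> $ \<beta> = - dzbar k (\<lambda>y. germ.chern_form j y $ \<alpha> $ \<beta>) a" for j k \<alpha> \<beta>
    by (simp add: curvature_matrix_def chern_connection_def germ.chern_form_def)
  then have "chern_curvature E h a v \<xi> = triv_inv E \<tau> a (germ.curv v *v \<tau> \<xi>)"
    by (simp add: chern_curvature_def Let_def assms(1)[symmetric] germ.curv_def)
  then show ?thesis
    by (simp add: metric_in_frame[OF a_in_chart triv_inv_fibre[OF a_in_chart] \<xi>] triv_triv_inv[OF a_in_chart] germ.curvature_loss_def)
qed

text \<open>
  A vector function that is holomorphic in one chart is a holomorphic section in every other chart,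
  because the transition maps are fibrewise linear and holomorphic for constant vectors.
\<close>

lemma holomorphic_section_of_frame:
  assumes D: "open D" "D \<subseteq> U" and f: "\<And>\<beta>. holomorphic_fun D (\<lambda>x. f x $ \<beta>)"
  shows "holomorphic_section E D (\<lambda>x. triv_inv E \<tau> x (f x))"
  unfolding holomorphic_section_def
proof (intro conjI ballI)
  show "triv_inv E \<tau> x (f x) \<in> fibre E x" if "x \<in> D" for x
    using that D triv_inv_fibre by blast
next
  fix V\<tau>' assume "V\<tau>' \<in> atlas E"
  then obtain V \<tau>' where V: "V\<tau>' = (V, \<tau>')" "(V, \<tau>') \<in> atlas E" by (cases V\<tau>') auto
  have trans: "holomorphic_map (U \<inter> V) (\<lambda>x. \<tau>' (triv_inv E \<tau> x w))" for w
    using holo chart V(2) unfolding holomorphic_vector_bundle_def by blast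
  have "holomorphic_fun (D \<inter> V) (\<lambda>x. \<tau>' (triv_inv E \<tau> x (f x)) $ \<alpha>)" for \<alpha>
  proof (rule holomorphic_fun_cong)
    show "holomorphic_fun (D \<inter> V) (\<lambda>x. \<Sum>\<beta>\<in>UNIV. f x $ \<beta> * \<tau>' (triv_inv E \<tau> x (axis \<beta> 1)) $ \<alpha>)"
      using trans D(2) f unfolding holomorphic_map_def
      by (intro holomorphic_fun_sum holomorphic_fun_mult) (blast intro: holomorphic_fun_subset)+
    show "open (D \<inter> V)" using D(1) chart_facts(1)[OF V(2)] by blast
    fix x assume "x \<in> D \<inter> V"
    then have x: "x \<in> U" "x \<in> V" using D by auto
    define T where "T w = \<tau>' (triv_inv E \<tau> x w)" for w
    have add: "T (w + w') = T w + T w'" for w w'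
      unfolding T_def triv_inv_add[OF x(1)]
      by (rule triv_facts(3)[OF V(2) x(2) triv_inv_fibre[OF x(1)] triv_inv_fibre[OF x(1)]])
    have scale: "T (c *s w) = c *s T w" for c w
      unfolding T_def triv_inv_scale[OF x(1)] by (rule triv_facts(4)[OF V(2) x(2) triv_inv_fibre[OF x(1)]])
    have zero: "T 0 = 0" using scale[of 0 0] by simp
    have sum: "T (\<Sum>\<beta>\<in>S. g \<beta>) = (\<Sum>\<beta>\<in>S. T (g \<beta>))" for S :: "'k set" and g
      by (induction S rule: infinite_finite_induct) (simp_all add: zero add)
    have "T (f x) = T (\<Sum>\<beta>\<in>UNIV. f x $ \<beta> *s axis \<beta> 1)" by (simp only: basis_expansion)
    also have "\<dots> = (\<Sum>\<beta>\<in>UNIV. f x $ \<beta> *s T (axis \<beta> 1))" by (simp only: sum scale)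
    finally show "(\<Sum>\<beta>\<in>UNIV. f x $ \<beta> * \<tau>' (triv_inv E \<tau> x (axis \<beta> 1)) $ \<alpha>) = \<tau>' (triv_inv E \<tau> x (f x)) $ \<alpha>"
      by (simp add: T_def)
  qed
  then show "case V\<tau>' of (V, \<tau>') \<Rightarrow> holomorphic_map (D \<inter> V) (\<lambda>x. \<tau>' (triv_inv E \<tau> x (f x)))"
    by (simp add: V(1) holomorphic_map_def)
qed

end

section \<open>Asymptotics of the extension index\<close>

context hermitian_chart
begin

lemma hnorm2_pos: "\<xi> \<in> fibre E a - {fzero E a} \<Longrightarrow> hnorm2 h \<xi> > 0"
proof -
  assume \<xi>: "\<xi> \<in> fibre E a - {fzero E a}"
  have "a \<in> \<Omega>" using a_in_chart chart_facts(2)[OF chart] by blast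
  from metric_facts(4)[OF this, of \<xi> \<xi>] \<xi> show ?thesis by (simp add: hnorm2_def)
qed

definition mean_curvature :: "'n \<Rightarrow> real \<Rightarrow> real \<Rightarrow> complex^'n^'n \<Rightarrow> 'e \<Rightarrow> real" where
  "mean_curvature i0 r s A \<xi> = (LINT z:disc_ball i0 r s A|lborel. germ.curvature_loss (\<tau> \<xi>) z)
     / measure lborel (disc_ball i0 r s A)"

text \<open>
  Every admissible section is bounded below by \<open>lower_integral\<close>, and the section with components
  \<open>\<xi> - conn z \<xi>\<close> is an admissible competitor for which \<open>upper_integral\<close> holds. The mean of
  \<open>|z|\<^sup>2\<close> in the error is the squared size of the domain.
\<close>

lemma extension_index_bounds:
  assumes \<mu>: "\<mu> > 0"
  shows "\<exists>\<rho>>0. ball a \<rho> \<subseteq> \<Omega> \<and> (\<forall>r>0. \<forall>s>0. r\<^sup>2 + s\<^sup>2 < \<rho>\<^sup>2 \<longrightarrow>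
     (\<forall>A\<in>unitary_group. \<forall>\<xi>\<in>fibre E a - {fzero E a}.
       ereal (1 - mean_curvature i0 r s A \<xi> / hnorm2 h \<xi> - \<mu> * (disc_ball_size CARD('n) r s)\<^sup>2)
         \<le> extension_index E h i0 a r s A \<xi> \<and>
       extension_index E h i0 a r s A \<xi>
         \<le> ereal (1 - mean_curvature i0 r s A \<xi> / hnorm2 h \<xi> + \<mu> * (disc_ball_size CARD('n) r s)\<^sup>2)))"
proof -
  let ?G = "gram E h \<tau>"
  obtain m where m: "m > 0" and "\<forall>\<^sub>F z in nhds 0. germ.controlled_at \<mu> m z"
    using germ.eventually_controlled[OF \<mu>] by blast
  then obtain \<rho> where \<rho>: "\<rho> > 0" and ctrl: "\<And>z. norm z < \<rho> \<Longrightarrow> germ.controlled_at \<mu> m z"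
    unfolding eventually_nhds_metric dist_norm diff_0_right by blast
  have in_U: "a + z \<in> U" if "norm z < \<rho>" for z
    using ctrl[OF that] by (simp add: germ.controlled_at_def)
  have "ereal (1 - mean_curvature i0 r s A \<xi> / hnorm2 h \<xi> - \<mu> * (disc_ball_size CARD('n) r s)\<^sup>2)
         \<le> extension_index E h i0 a r s A \<xi> \<and>
       extension_index E h i0 a r s A \<xi>
         \<le> ereal (1 - mean_curvature i0 r s A \<xi> / hnorm2 h \<xi> + \<mu> * (disc_ball_size CARD('n) r s)\<^sup>2)"
    if r: "r > 0" and s: "s > 0" and rs: "r\<^sup>2 + s\<^sup>2 < \<rho>\<^sup>2" and A: "A \<in> unitary_group"
      and \<xi>: "\<xi> \<in> fibre E a - {fzero E a}" for r s A \<xi>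
  proof -
    define P where "P = disc_ball i0 r s A"
    define D where "D = (\<lambda>z. a + z) ` P"
    define V where "V = measure lborel P"
    define \<delta> where "\<delta> = (disc_ball_size CARD('n) r s)\<^sup>2"
    define N where "N = hnorm2 h \<xi>"
    have P: "open P" "complex_balanced P" "bounded P"
      unfolding P_def using open_disc_ball[OF A] complex_balanced_disc_ball[OF A]
        bounded_disc_ball[OF A] by blast+
    have V: "V > 0" unfolding V_def P_def by (rule measure_disc_ball_pos[OF A r s])
    have N: "N > 0" unfolding N_def by (rule hnorm2_pos[OF \<xi>])
    have N_frame: "Re (mform (?G a) (\<tau> \<xi>) (\<tau> \<xi>)) = N"
      unfolding N_def using \<xi> by (simp add: hnorm2_in_frame[OF a_in_chart])
    have small: "norm z < \<rho>" if "z \<in> P" for z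
    proof -
      have "(norm z)\<^sup>2 < \<rho>\<^sup>2" using norm_less_disc_ball[OF A, of z i0 r s] that rs unfolding P_def by linarith
      then show ?thesis by (rule power_less_imp_less_base) (use \<rho> in simp)
    qed
    note PU = in_U[OF small]
    have D: "open D" "D \<subseteq> U" using P(1) PU by (auto simp: D_def open_translation)
    have moment: "(LINT z:P|lborel. (norm z)\<^sup>2) = \<delta> * V"
      unfolding P_def V_def \<delta>_def by (rule set_integral_norm_disc_ball[OF A r s])
    have loss: "(LINT z:P|lborel. germ.curvature_loss (\<tau> \<xi>) z) = mean_curvature i0 r s A \<xi> * V"
      using V by (simp add: mean_curvature_def P_def V_def)
    have index: "extension_index E h i0 a r s A \<xi>
       = Inf {ereal ((LINT x:D|lborel. hnorm2 h (\<sigma> x)) / (V * N)) | \<sigma>. \<sigma> \<in> A2_space E h D \<and> \<sigma> a = \<xi>}"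
      by (simp add: extension_index_def Let_def P_def D_def V_def N_def)
    have normalize: "(V * N - C * V - \<mu> * N * (\<delta> * V)) / (V * N) = 1 - C / N - \<mu> * \<delta>"
      "(V * N - C * V + \<mu> * N * (\<delta> * V)) / (V * N) = 1 - C / N + \<mu> * \<delta>" for C
      using V N by (simp_all add: field_simps)
    have "ereal (1 - mean_curvature i0 r s A \<xi> / N - \<mu> * \<delta>) \<le> extension_index E h i0 a r s A \<xi>"
      unfolding index
    proof (rule Inf_greatest, clarify)
      fix \<sigma> assume \<sigma>: "\<sigma> \<in> A2_space E h D" and \<sigma>a: "\<xi> = \<sigma> a"
      define f where "f z = \<tau> (\<sigma> (a + z))" for z
      have fib: "\<sigma> x \<in> fibre E x" if "x \<in> D" for x
        using \<sigma> that by (simp add: A2_space_def holomorphic_section_def)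
      have "holomorphic_map (D \<inter> U) (\<lambda>x. \<tau> (\<sigma> x))"
        using \<sigma> chart by (auto simp: A2_space_def holomorphic_section_def)
      then have "holomorphic_fun D (\<lambda>x. \<tau> (\<sigma> x) $ \<beta>)" for \<beta>
        using D(2) by (simp add: holomorphic_map_def Int_absorb2)
      from holomorphic_fun_translate[OF this, of a]
      have holof: "holomorphic_fun P (\<lambda>z. f z $ \<beta>)" for \<beta>
        unfolding f_def by (rule holomorphic_fun_subset) (auto simp: D_def)
      have norm_eq: "hnorm2 h (\<sigma> (a + z)) = Re (mform (?G (a + z)) (f z) (f z))" if "z \<in> P" for z
        unfolding f_def using that PU by (intro hnorm2_in_frame fib) (auto simp: D_def)
      have f0: "f 0 = \<tau> \<xi>" by (simp add: f_def \<sigma>a)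
      have int: "set_integrable lborel D (\<lambda>x. hnorm2 h (\<sigma> x))" using \<sigma> by (simp add: A2_space_def)
      note tr = set_integral_translate[of a P "\<lambda>x. hnorm2 h (\<sigma> x)", folded D_def, OF int]
      have int': "set_integrable lborel P (\<lambda>z. Re (mform (?G (a + z)) (f z) (f z)))"
        using tr(1) norm_eq by (subst set_integrable_cong[OF refl refl norm_eq[symmetric]]) auto
      have eq': "(LINT x:D|lborel. hnorm2 h (\<sigma> x)) = (LINT z:P|lborel. Re (mform (?G (a + z)) (f z) (f z)))"
        unfolding tr(2) using P(1) by (intro set_lebesgue_integral_cong) (auto simp: norm_eq)
      have "V * N - mean_curvature i0 r s A \<xi> * V - \<mu> * N * (\<delta> * V) \<le> (LINT x:D|lborel. hnorm2 h (\<sigma> x))"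
        using germ.lower_integral[OF P m ctrl[OF small] holof f0 int']
        unfolding N_frame moment loss V_def[symmetric] eq' .
      then have "(V * N - mean_curvature i0 r s A \<xi> * V - \<mu> * N * (\<delta> * V)) / (V * N) \<le> (LINT x:D|lborel. hnorm2 h (\<sigma> x)) / (V * N)"
        using V N by (intro divide_right_mono) auto
      then show "ereal (1 - mean_curvature i0 r s A (\<sigma> a) / N - \<mu> * \<delta>) \<le> ereal ((LINT x:D|lborel. hnorm2 h (\<sigma> x)) / (V * N))"
        by (simp add: normalize \<sigma>a[symmetric])
    qed
    moreover have "extension_index E h i0 a r s A \<xi> \<le> ereal (1 - mean_curvature i0 r s A \<xi> / N + \<mu> * \<delta>)"
    proof -
      define g where "g z = \<tau> \<xi> - germ.conn z (\<tau> \<xi>)" for z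
      define \<sigma> where "\<sigma> x = triv_inv E \<tau> x (g (x - a))" for x
      have g_eq: "g (x - a) $ \<beta> = (\<tau> \<xi> + germ.conn a (\<tau> \<xi>)) $ \<beta> + - 1 * germ.conn x (\<tau> \<xi>) $ \<beta>" for x \<beta>
        using linear_diff[OF germ.linear_conn_left, of x a] by (simp add: g_def)
      have "holomorphic_fun D (\<lambda>x. g (x - a) $ \<beta>)" for \<beta>
        unfolding g_eq
        by (intro holomorphic_fun_add holomorphic_fun_mult holomorphic_fun_const germ.holomorphic_fun_conn)
      then have holo: "holomorphic_section E D \<sigma>"
        unfolding \<sigma>_def by (intro holomorphic_section_of_frame D)
      have "germ.conn 0 (\<tau> \<xi>) = 0" using linear_0[OF germ.linear_conn_left] by simp
      then have \<sigma>a: "\<sigma> a = \<xi>"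
        using \<xi> by (simp add: \<sigma>_def g_def triv_inv_triv[OF a_in_chart])
      have norm_eq: "hnorm2 h (\<sigma> (a + z)) = Re (mform (?G (a + z)) (g z) (g z))" if "z \<in> P" for z
        using PU[OF that] by (simp add: \<sigma>_def hnorm2_in_frame triv_inv_fibre triv_triv_inv)
      note up = germ.upper_integral[OF P ctrl[OF small], of "\<tau> \<xi>", folded g_def]
      have intP: "set_integrable lborel P (\<lambda>z. hnorm2 h (\<sigma> (a + z)))"
        using up(2) norm_eq by (subst set_integrable_cong[OF refl refl norm_eq]) auto
      have shift_back: "(\<lambda>z. - a + z) ` D = P" by (auto simp: D_def image_image)
      have "set_integrable lborel ((\<lambda>z. - a + z) ` D) (\<lambda>z. hnorm2 h (\<sigma> (a + z)))"
        using intP by (simp only: shift_back)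
      from set_integral_translate(1)[OF this] have int: "set_integrable lborel D (\<lambda>x. hnorm2 h (\<sigma> x))"
        by simp
      note tr = set_integral_translate[of a P "\<lambda>x. hnorm2 h (\<sigma> x)", folded D_def, OF int]
      have eq': "(LINT x:D|lborel. hnorm2 h (\<sigma> x)) = (LINT z:P|lborel. Re (mform (?G (a + z)) (g z) (g z)))"
        unfolding tr(2) using P(1) by (intro set_lebesgue_integral_cong) (auto simp: norm_eq)
      have "(LINT x:D|lborel. hnorm2 h (\<sigma> x)) \<le> V * N - mean_curvature i0 r s A \<xi> * V + \<mu> * N * (\<delta> * V)"
        using up(1) unfolding N_frame moment loss V_def[symmetric] eq' .
      then have "(LINT x:D|lborel. hnorm2 h (\<sigma> x)) / (V * N) \<le> (V * N - mean_curvature i0 r s A \<xi> * V + \<mu> * N * (\<delta> * V)) / (V * N)"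
        using V N by (intro divide_right_mono) auto
      then have "ereal ((LINT x:D|lborel. hnorm2 h (\<sigma> x)) / (V * N)) \<le> ereal (1 - mean_curvature i0 r s A \<xi> / N + \<mu> * \<delta>)"
        by (simp add: normalize)
      moreover have "\<sigma> \<in> A2_space E h D" using holo int by (simp add: A2_space_def)
      ultimately show ?thesis
        unfolding index using \<sigma>a by (intro Inf_lower2[of "ereal ((LINT x:D|lborel. hnorm2 h (\<sigma> x)) / (V * N))"]) auto
    qed
    ultimately show ?thesis by (simp add: N_def \<delta>_def)
  qed
  moreover have "ball a \<rho> \<subseteq> \<Omega>"
  proof
    fix x assume "x \<in> ball a \<rho>"
    then have "x \<in> U" using in_U[of "x - a"] by (simp add: dist_norm norm_minus_commute)
    then show "x \<in> \<Omega>" using chart_facts(2)[OF chart] by blast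
  qed
  ultimately show ?thesis using \<rho> by blast
qed

lemma griffiths_bounds_in_frame:
  assumes \<tau>: "\<tau> = (SOME \<tau>. \<exists>U. (U, \<tau>) \<in> atlas E \<and> a \<in> U)"
  shows "griffiths_bounds E h a c d \<longleftrightarrow> (\<forall>v. \<forall>\<xi>\<in>fibre E a.
    c * (norm v)\<^sup>2 * hnorm2 h \<xi> \<le> germ.curvature_loss (\<tau> \<xi>) v \<and>
    germ.curvature_loss (\<tau> \<xi>) v \<le> d * (norm v)\<^sup>2 * hnorm2 h \<xi>)"
  unfolding griffiths_bounds_def by (simp add: chern_curvature_in_frame[OF \<tau>])

lemma mean_curvature_bounds:
  assumes r: "r > 0" and s: "s > 0" and A: "A \<in> unitary_group"
    and bounds: "\<And>z. c * (norm z)\<^sup>2 * N \<le> germ.curvature_loss (\<tau> \<xi>) z"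
      "\<And>z. germ.curvature_loss (\<tau> \<xi>) z \<le> d * (norm z)\<^sup>2 * N"
  shows "c * (disc_ball_size CARD('n) r s)\<^sup>2 * N \<le> mean_curvature i0 r s A \<xi>"
    and "mean_curvature i0 r s A \<xi> \<le> d * (disc_ball_size CARD('n) r s)\<^sup>2 * N"
proof -
  let ?P = "disc_ball i0 r s A"
  let ?V = "measure lborel ?P"
  have V: "?V > 0" by (rule measure_disc_ball_pos[OF A r s])
  note int = set_integrable_bounded_continuous(1)[OF open_disc_ball[OF A] bounded_disc_ball[OF A]]
  have iq: "set_integrable lborel ?P (germ.curvature_loss (\<tau> \<xi>))"
    by (intro int germ.continuous_on_curvature_loss)
  have in2: "set_integrable lborel ?P (\<lambda>z. C * (norm z)\<^sup>2 * N)" for C by (intro int continuous_intros)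
  have eq: "(LINT z:?P|lborel. C * (norm z)\<^sup>2 * N) = C * (disc_ball_size CARD('n) r s)\<^sup>2 * N * ?V" for C
  proof -
    have "(LINT z:?P|lborel. C * (norm z)\<^sup>2 * N) = C * (LINT z:?P|lborel. (norm z)\<^sup>2) * N" by simp
    then show ?thesis by (simp add: set_integral_norm_disc_ball[OF A r s])
  qed
  have "(LINT z:?P|lborel. c * (norm z)\<^sup>2 * N) \<le> (LINT z:?P|lborel. germ.curvature_loss (\<tau> \<xi>) z)"
    by (intro set_integral_mono iq in2 bounds)
  then show "c * (disc_ball_size CARD('n) r s)\<^sup>2 * N \<le> mean_curvature i0 r s A \<xi>"
    unfolding mean_curvature_def eq using V by (simp add: pos_le_divide_eq)
  have "(LINT z:?P|lborel. germ.curvature_loss (\<tau> \<xi>) z) \<le> (LINT z:?P|lborel. d * (norm z)\<^sup>2 * N)"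
    by (intro set_integral_mono iq in2 bounds)
  then show "mean_curvature i0 r s A \<xi> \<le> d * (disc_ball_size CARD('n) r s)\<^sup>2 * N"
    unfolding mean_curvature_def eq using V by (simp add: pos_divide_le_eq)
qed

end

theorem theorem2p2:
  fixes \<Omega> :: "(complex^'n::finite) set"
    and E :: "('e, 'n, 'k::finite) vbundle"
    and h :: "'e \<Rightarrow> 'e \<Rightarrow> complex"
    and i0 :: 'n and a :: "complex^'n" and c d :: real
  assumes "CARD('n) \<ge> 2"
    and "open \<Omega>" and "connected \<Omega>"
    and "holomorphic_vector_bundle \<Omega> E"
    and "smooth_hermitian_metric \<Omega> E h"
    and "a \<in> \<Omega>" and "c \<le> d"
  shows "griffiths_bounds E h a c d \<longleftrightarrow>
    (\<forall>\<epsilon>>0. \<exists>\<rho>>0. ball a \<rho> \<subseteq> \<Omega> \<and>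
       (\<forall>r>0. \<forall>s>0. r\<^sup>2 + s\<^sup>2 < \<rho>\<^sup>2 \<longrightarrow>
          (\<forall>A\<in>unitary_group. \<forall>\<xi>\<in>fibre E a - {fzero E a}.
             ereal (1 - (d + \<epsilon>) * (disc_ball_size CARD('n) r s)\<^sup>2) \<le> extension_index E h i0 a r s A \<xi> \<and>
             extension_index E h i0 a r s A \<xi> \<le> ereal (1 - (c - \<epsilon>) * (disc_ball_size CARD('n) r s)\<^sup>2))))"
proof -
  \<comment> \<open>The definition of the curvature selects this chart, so the whole argument is carried out in it.\<close>
  define \<tau> where "\<tau> = (SOME \<tau>. \<exists>U. (U, \<tau>) \<in> atlas E \<and> a \<in> U)"
  have "\<forall>x\<in>\<Omega>. \<exists>(U, \<tau>)\<in>atlas E. x \<in> U"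
    using assms(4) unfolding holomorphic_vector_bundle_def by (elim conjE)
  with assms(6) obtain p where "p \<in> atlas E" "case p of (U, \<tau>) \<Rightarrow> a \<in> U" by blast
  then have "\<exists>\<tau> U. (U, \<tau>) \<in> atlas E \<and> a \<in> U" by (cases p) auto
  then have "\<exists>U. (U, \<tau>) \<in> atlas E \<and> a \<in> U" unfolding \<tau>_def by (rule someI_ex)
  then obtain U where U: "(U, \<tau>) \<in> atlas E" "a \<in> U" by blast
  interpret hermitian_chart \<Omega> E h U \<tau> a
    by unfold_locales (use assms U in auto)
  let ?q = "\<lambda>\<xi>. germ.curvature_loss (\<tau> \<xi>)"
  let ?\<delta> = "\<lambda>r s. (disc_ball_size CARD('n) r s)\<^sup>2"
  let ?L = "\<lambda>r s A \<xi>. extension_index E h i0 a r s A \<xi>"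
  let ?R = "\<lambda>\<epsilon>. \<exists>\<rho>>0. ball a \<rho> \<subseteq> \<Omega> \<and> (\<forall>r>0. \<forall>s>0. r\<^sup>2 + s\<^sup>2 < \<rho>\<^sup>2 \<longrightarrow>
    (\<forall>A\<in>unitary_group. \<forall>\<xi>\<in>fibre E a - {fzero E a}.
      ereal (1 - (d + \<epsilon>) * ?\<delta> r s) \<le> ?L r s A \<xi> \<and> ?L r s A \<xi> \<le> ereal (1 - (c - \<epsilon>) * ?\<delta> r s)))"
  note frame = griffiths_bounds_in_frame[OF \<tau>_def]
  show ?thesis
  proof
    assume grif: "griffiths_bounds E h a c d"
    show "\<forall>\<epsilon>>0. ?R \<epsilon>"
    proof (intro allI impI)
      fix \<epsilon> :: real assume \<epsilon>: "\<epsilon> > 0"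
      obtain \<rho> where \<rho>: "\<rho> > 0" "ball a \<rho> \<subseteq> \<Omega>"
        and key: "\<And>r s A \<xi>. r > 0 \<Longrightarrow> s > 0 \<Longrightarrow> r\<^sup>2 + s\<^sup>2 < \<rho>\<^sup>2 \<Longrightarrow> A \<in> unitary_group \<Longrightarrow> \<xi> \<in> fibre E a - {fzero E a} \<Longrightarrow>
          ereal (1 - mean_curvature i0 r s A \<xi> / hnorm2 h \<xi> - \<epsilon> * ?\<delta> r s) \<le> ?L r s A \<xi> \<and>
          ?L r s A \<xi> \<le> ereal (1 - mean_curvature i0 r s A \<xi> / hnorm2 h \<xi> + \<epsilon> * ?\<delta> r s)"
        using extension_index_bounds[OF \<epsilon>, of i0] by blast
      have "ereal (1 - (d + \<epsilon>) * ?\<delta> r s) \<le> ?L r s A \<xi> \<and> ?L r s A \<xi> \<le> ereal (1 - (c - \<epsilon>) * ?\<delta> r s)"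
        if r: "r > 0" and s: "s > 0" and rs: "r\<^sup>2 + s\<^sup>2 < \<rho>\<^sup>2" and A: "A \<in> unitary_group"
          and \<xi>: "\<xi> \<in> fibre E a - {fzero E a}" for r s A \<xi>
      proof -
        have N: "hnorm2 h \<xi> > 0" by (rule hnorm2_pos[OF \<xi>])
        have "c * (norm z)\<^sup>2 * hnorm2 h \<xi> \<le> ?q \<xi> z" "?q \<xi> z \<le> d * (norm z)\<^sup>2 * hnorm2 h \<xi>" for z
          using grif \<xi> unfolding frame by blast+
        note mc = mean_curvature_bounds[OF r s A this, of i0]
        have "c * ?\<delta> r s \<le> mean_curvature i0 r s A \<xi> / hnorm2 h \<xi>" "mean_curvature i0 r s A \<xi> / hnorm2 h \<xi> \<le> d * ?\<delta> r s"
          using mc N by (simp_all add: pos_le_divide_eq pos_divide_le_eq)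
        then have "ereal (1 - (d + \<epsilon>) * ?\<delta> r s) \<le> ereal (1 - mean_curvature i0 r s A \<xi> / hnorm2 h \<xi> - \<epsilon> * ?\<delta> r s)"
          "ereal (1 - mean_curvature i0 r s A \<xi> / hnorm2 h \<xi> + \<epsilon> * ?\<delta> r s) \<le> ereal (1 - (c - \<epsilon>) * ?\<delta> r s)"
          by (simp_all add: algebra_simps)
        with key[OF r s rs A \<xi>] show ?thesis by (meson order_trans)
      qed
      with \<rho> show "?R \<epsilon>" by blast
    qed
  next
    assume R: "\<forall>\<epsilon>>0. ?R \<epsilon>"
    define \<nu> where "\<nu> = (real CARD('n) - 1) / real CARD('n)"
    have "\<nu> \<ge> 0" using assms(1) by (simp add: \<nu>_def)
    then have \<delta>: "?\<delta> r s = r\<^sup>2 / 2 + \<nu> * s\<^sup>2" for r s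
      unfolding disc_ball_size_def \<nu>_def by (intro real_sqrt_pow2) simp
    have unit: "c * hnorm2 h \<xi> \<le> ?q \<xi> v \<and> ?q \<xi> v \<le> d * hnorm2 h \<xi>"
      if \<xi>: "\<xi> \<in> fibre E a - {fzero E a}" and v: "norm v = 1" for \<xi> v
    proof -
      let ?N = "hnorm2 h \<xi>"
      have N: "?N > 0" by (rule hnorm2_pos[OF \<xi>])
      obtain A \<omega> where A: "A \<in> unitary_group" and \<omega>: "cmod \<omega> = 1" "A *v axis i0 1 = \<omega> *s v"
        using unitary_group_maps_axis[OF v] by blast
      let ?X = "\<lambda>r s. mean_curvature i0 r s A \<xi>"
      note conc = germ.curvature_loss_concentration[OF A v \<omega>, of _ "\<tau> \<xi>", folded mean_curvature_def]
      have conc_neg: "\<exists>\<eta>\<^sub>0>0. \<forall>\<eta>. 0 < \<eta> \<and> \<eta> < \<eta>\<^sub>0 \<longrightarrow> (\<forall>r>0. \<bar>- ?X r (\<eta> * r) - r\<^sup>2 / 2 * (- ?q \<xi> v)\<bar> \<le> \<kappa> * r\<^sup>2)"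
        if "\<kappa> > 0" for \<kappa>
      proof -
        have neg: "\<bar>- x - y * (- z)\<bar> = \<bar>x - y * z\<bar>" for x y z :: real by simp
        show ?thesis unfolding neg by (rule conc[OF that])
      qed
      have both: "\<exists>\<rho>>0. \<forall>r>0. \<forall>s>0. r\<^sup>2 + s\<^sup>2 < \<rho>\<^sup>2 \<longrightarrow>
          ?X r s \<le> (d + \<epsilon>) * (r\<^sup>2 / 2 + \<nu> * s\<^sup>2) * ?N \<and> - ?X r s \<le> (- c + \<epsilon>) * (r\<^sup>2 / 2 + \<nu> * s\<^sup>2) * ?N"
        if \<epsilon>: "\<epsilon> > 0" for \<epsilon>
      proof -
        have \<epsilon>2: "\<epsilon> / 2 > 0" using \<epsilon> by simp
        from R[rule_format, OF \<epsilon>2] obtain \<rho>\<^sub>1 where \<rho>\<^sub>1: "\<rho>\<^sub>1 > 0"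
          and index_all: "\<forall>r>0. \<forall>s>0. r\<^sup>2 + s\<^sup>2 < \<rho>\<^sub>1\<^sup>2 \<longrightarrow> (\<forall>A\<in>unitary_group. \<forall>\<xi>\<in>fibre E a - {fzero E a}.
            ereal (1 - (d + \<epsilon> / 2) * ?\<delta> r s) \<le> ?L r s A \<xi> \<and> ?L r s A \<xi> \<le> ereal (1 - (c - \<epsilon> / 2) * ?\<delta> r s))"
          by (elim exE conjE)
        note index = index_all[rule_format, OF _ _ _ A \<xi>]
        from extension_index_bounds[OF \<epsilon>2, of i0] obtain \<rho>\<^sub>2 where \<rho>\<^sub>2: "\<rho>\<^sub>2 > 0"
          and key_all: "\<forall>r>0. \<forall>s>0. r\<^sup>2 + s\<^sup>2 < \<rho>\<^sub>2\<^sup>2 \<longrightarrow> (\<forall>A\<in>unitary_group. \<forall>\<xi>\<in>fibre E a - {fzero E a}.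
            ereal (1 - mean_curvature i0 r s A \<xi> / hnorm2 h \<xi> - \<epsilon> / 2 * ?\<delta> r s) \<le> ?L r s A \<xi> \<and>
            ?L r s A \<xi> \<le> ereal (1 - mean_curvature i0 r s A \<xi> / hnorm2 h \<xi> + \<epsilon> / 2 * ?\<delta> r s))"
          by (elim exE conjE)
        note key = key_all[rule_format, OF _ _ _ A \<xi>]
        define \<rho> where "\<rho> = min \<rho>\<^sub>1 \<rho>\<^sub>2"
        have "\<rho> > 0" using \<rho>\<^sub>1 \<rho>\<^sub>2 by (simp add: \<rho>_def)
        moreover have "?X r s \<le> (d + \<epsilon>) * (r\<^sup>2 / 2 + \<nu> * s\<^sup>2) * ?N \<and> - ?X r s \<le> (- c + \<epsilon>) * (r\<^sup>2 / 2 + \<nu> * s\<^sup>2) * ?N"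
          if r: "r > 0" and s: "s > 0" and rs: "r\<^sup>2 + s\<^sup>2 < \<rho>\<^sup>2" for r s
        proof -
          have "\<rho>\<^sup>2 \<le> \<rho>\<^sub>1\<^sup>2" "\<rho>\<^sup>2 \<le> \<rho>\<^sub>2\<^sup>2" using \<open>\<rho> > 0\<close> by (auto simp: \<rho>_def intro!: power_mono)
          then have rs1: "r\<^sup>2 + s\<^sup>2 < \<rho>\<^sub>1\<^sup>2" and rs2: "r\<^sup>2 + s\<^sup>2 < \<rho>\<^sub>2\<^sup>2" using rs by linarith+
          have "ereal (1 - (d + \<epsilon> / 2) * ?\<delta> r s) \<le> ereal (1 - ?X r s / ?N + \<epsilon> / 2 * ?\<delta> r s)"
            using index[OF r s rs1] key[OF r s rs2] by (blast intro: order_trans)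
          then have "?X r s / ?N \<le> (d + \<epsilon>) * ?\<delta> r s" by (simp add: algebra_simps)
          moreover have "ereal (1 - ?X r s / ?N - \<epsilon> / 2 * ?\<delta> r s) \<le> ereal (1 - (c - \<epsilon> / 2) * ?\<delta> r s)"
            using index[OF r s rs1] key[OF r s rs2] by (blast intro: order_trans)
          then have "- (?X r s / ?N) \<le> (- c + \<epsilon>) * ?\<delta> r s" by (simp add: algebra_simps)
          ultimately show ?thesis using N unfolding \<delta> by (simp add: field_simps)
        qed
        ultimately show ?thesis by blast
      qed
      have upper: "\<exists>\<rho>>0. \<forall>r>0. \<forall>s>0. r\<^sup>2 + s\<^sup>2 < \<rho>\<^sup>2 \<longrightarrow> ?X r s \<le> (d + \<epsilon>) * (r\<^sup>2 / 2 + \<nu> * s\<^sup>2) * ?N"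
        and lower: "\<exists>\<rho>>0. \<forall>r>0. \<forall>s>0. r\<^sup>2 + s\<^sup>2 < \<rho>\<^sup>2 \<longrightarrow> - ?X r s \<le> (- c + \<epsilon>) * (r\<^sup>2 / 2 + \<nu> * s\<^sup>2) * ?N"
        if "\<epsilon> > 0" for \<epsilon>
        using both[OF that] by fast+
      have "?q \<xi> v \<le> d * ?N"
      proof (rule bound_of_concentrated_averages[where X = ?X and \<nu> = \<nu>])
        fix \<kappa> :: real assume "\<kappa> > 0"
        then show "\<exists>\<eta>\<^sub>0>0. \<forall>\<eta>. 0 < \<eta> \<and> \<eta> < \<eta>\<^sub>0 \<longrightarrow> (\<forall>r>0. \<bar>?X r (\<eta> * r) - r\<^sup>2 / 2 * ?q \<xi> v\<bar> \<le> \<kappa> * r\<^sup>2)"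
          by (rule conc)
      qed (rule upper)
      moreover have "- ?q \<xi> v \<le> - c * ?N"
      proof (rule bound_of_concentrated_averages[where X = "\<lambda>r s. - ?X r s" and \<nu> = \<nu>])
        fix \<kappa> :: real assume "\<kappa> > 0"
        then show "\<exists>\<eta>\<^sub>0>0. \<forall>\<eta>. 0 < \<eta> \<and> \<eta> < \<eta>\<^sub>0 \<longrightarrow> (\<forall>r>0. \<bar>- ?X r (\<eta> * r) - r\<^sup>2 / 2 * - ?q \<xi> v\<bar> \<le> \<kappa> * r\<^sup>2)"
          by (rule conc_neg)
      qed (rule lower)
      ultimately show ?thesis by simp
    qed
    show "griffiths_bounds E h a c d"
      unfolding frame
    proof (intro allI ballI)
      fix v \<xi> assume \<xi>: "\<xi> \<in> fibre E a"
      show "c * (norm v)\<^sup>2 * hnorm2 h \<xi> \<le> ?q \<xi> v \<and> ?q \<xi> v \<le> d * (norm v)\<^sup>2 * hnorm2 h \<xi>"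
      proof (cases "\<xi> = fzero E a \<or> v = 0")
        case True
        have "?q \<xi> 0 = 0" using germ.curvature_loss_scale[of "\<tau> \<xi>" 0 0] by simp
        moreover have "hnorm2 h \<xi> = 0 \<and> ?q \<xi> v = 0" if "\<xi> = fzero E a"
        proof -
          have "\<tau> \<xi> = 0" using that triv_facts(2)[OF chart a_in_chart] by simp
          then show ?thesis
            using hnorm2_in_frame[OF a_in_chart \<xi>] by (simp add: germ.curvature_loss_def)
        qed
        ultimately show ?thesis using True by auto
      next
        case False
        define w where "w = complex_of_real (inverse (norm v)) *s v"
        have nv: "norm v > 0" using False by simp
        have w: "norm w = 1" using nv by (simp add: w_def norm_vector_scalar_mult norm_inverse)
        have vw: "v = complex_of_real (norm v) *s w" using nv by (simp add: w_def vec_eq_iff)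
        have q: "?q \<xi> v = (norm v)\<^sup>2 * ?q \<xi> w"
          by (subst vw) (simp add: germ.curvature_loss_scale)
        have "c * hnorm2 h \<xi> \<le> ?q \<xi> w \<and> ?q \<xi> w \<le> d * hnorm2 h \<xi>"
          using unit[OF _ w, of \<xi>] \<xi> False by blast
        then have "(norm v)\<^sup>2 * (c * hnorm2 h \<xi>) \<le> ?q \<xi> v \<and> ?q \<xi> v \<le> (norm v)\<^sup>2 * (d * hnorm2 h \<xi>)"
          unfolding q by (auto intro: mult_left_mono)
        then show ?thesis by (simp add: mult_ac)
      qed
    qed
  qed
qed

end
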